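(* Let $n\ge 1$, let $\mathbb{F}$ be an arbitrary field, and let $C\subseteq\mathbb{R}^n$ be a full-dimensional pointed convex polyhedral cone generated by a finite subset of $\mathbb{Z}^n$. Let $R_{\mathbb{F}}=\mathbb{F}[C^\vee\cap\mathbb{Z}^n]$ be the toric $\mathbb{F}$-algebra associated to $C$, and assume that the divisor class group $\operatorname{Cl}(R_{\mathbb{F}})$ is finite. Let $\mathcal{B}$ be a finite generating set for the semigroup $C^\vee\cap\mathbb{Z}^n$, let $v_C\in\mathbb{Z}^n$ be the sum of the primitive generators of $C$, and set $$U:=\operatorname{lcm}\Big\{\max_{w\in\mathcal{B}}(w\bullet v_C),\ \#\operatorname{Cl}(R_{\mathbb{F}})\Big\}\in\mathbb{Z}_{>0}.$$ Then $P^{(U(r-1)+1)}\subseteq P^r$ for all integers $r>0$, all monomial prime ideals $P$ of $R_{\mathbb{F}}$, and all height one prime ideals $P$ of $R_{\mathbb{F}}$.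
   Context: Here $\bullet$ is the dot product on $\mathbb{R}^n$. Full-dimensional means that $C$ spans $\mathbb{R}^n$; pointed means that $C$ contains no line through the origin. The dual cone is $C^\vee=\{w\in\mathbb{R}^n : w\bullet v\ge 0\text{ for all }v\in C\}$. The primitive generators of $C$ are the vectors $u_\rho$, one for each one-dimensional face (ray) $\rho$ of $C$, where $u_\rho$ is the unique primitive vector of $\mathbb{Z}^n$ in $\rho$; a vector $v\in\mathbb{Z}^n$ is primitive if $\frac1k v\notin\mathbb{Z}^n$ for all integers $k>1$. The toric algebra $R_{\mathbb{F}}=\mathbb{F}[C^\vee\cap\mathbb{Z}^n]$ is the semigroup algebra of $C^\vee\cap\mathbb{Z}^n$, with $\mathbb{F}$-basis of monomials $\{\chi^\ell : \ell\in C^\vee\cap\mathbb{Z}^n\}$, $\chi^{\ell}\chi^{\ell'}=\chi^{\ell+\ell'}$; it is a Noetherian normal domain. An ideal of $R_{\mathbb{F}}$ is monomial if it is generated by a subset of these monomials. For a Noetherian normal domain $R$, $\operatorname{Cl}(R)$ is the free abelian group on the height one primes of $R$ modulo principal divisors. For a prime ideal $P$ of a Noetherian domain $R$ and an integer $a\ge1$, the symbolic power is $P^{(a)}=P^aR_P\cap R=\{f\in R : uf\in P^a\text{ for some }u\in R\setminus P\}$. *)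

theory Defs
  imports
    "HOL-Analysis.Analysis"
    "HOL-Library.Poly_Mapping"
    "HOL-Library.Extended_Nat"
    "HOL-Algebra.Ideal_Product"
    "HOL-Algebra.Free_Abelian_Groups"
begin

section \<open>Cones and lattice points\<close>

definition real_vec :: "int ^ 'n \<Rightarrow> real ^ 'n" where
  "real_vec v = (\<chi> i. of_int (v $ i))"

definition lattice_inner :: "int ^ 'n \<Rightarrow> int ^ 'n \<Rightarrow> int" where
  "lattice_inner w v = (\<Sum>i\<in>UNIV. w $ i * v $ i)"

definition rational_polyhedral_cone :: "(real ^ 'n) set \<Rightarrow> bool" where
  "rational_polyhedral_cone C \<longleftrightarrow>
     (\<exists>S :: (int ^ 'n) set. finite S \<and> C = convex_cone hull (real_vec ` S))"

definition full_dimensional :: "(real ^ 'n) set \<Rightarrow> bool" where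
  "full_dimensional C \<longleftrightarrow> span C = UNIV"

definition pointed :: "(real ^ 'n) set \<Rightarrow> bool" where
  "pointed C \<longleftrightarrow> \<not> (\<exists>v. v \<noteq> 0 \<and> range (\<lambda>t. t *\<^sub>R v) \<subseteq> C)"

definition dual_cone :: "(real ^ 'n) set \<Rightarrow> (real ^ 'n) set" where
  "dual_cone C = {w. \<forall>v\<in>C. w \<bullet> v \<ge> 0}"

definition dual_lattice_points :: "(real ^ 'n) set \<Rightarrow> (int ^ 'n) set" where
  "dual_lattice_points C = {l. real_vec l \<in> dual_cone C}"

definition primitive_vec :: "int ^ 'n \<Rightarrow> bool" where
  "primitive_vec v \<longleftrightarrow>
     (\<forall>k::int. k > 1 \<longrightarrow> (1 / of_int k) *\<^sub>R real_vec v \<notin> range real_vec)"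

(* "\<rho> edge_of C" means that \<rho> is a face of C of dimension one.  In a pointed cone such a
   face is a half-line from the origin; it contains exactly one primitive vector if C is rational. *)
definition primitive_generators :: "(real ^ 'n) set \<Rightarrow> (int ^ 'n) set" where
  "primitive_generators C = {u. primitive_vec u \<and> (\<exists>\<rho>. \<rho> edge_of C \<and> real_vec u \<in> \<rho>)}"

definition generator_sum :: "(real ^ 'n) set \<Rightarrow> int ^ 'n" where
  "generator_sum C = (\<Sum>u\<in>primitive_generators C. u)"

(* Semigroups of lattice points are taken with their identity 0, so 0 is obtained as the
   empty combination and need not belong to a generating set. *)
definition generates_semigroup :: "(int ^ 'n) set \<Rightarrow> (int ^ 'n) set \<Rightarrow> bool" where
  "generates_semigroup B S \<longleftrightarrow>
     S = {(\<Sum>b\<in>B. int (a b) *s b) | a :: int ^ 'n \<Rightarrow> nat. True}"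


section \<open>Semigroup algebras\<close>

(* Multiplication of finitely supported functions is convolution, so
   single l 1 * single l' 1 = single (l + l') 1. *)
definition semigroup_algebra :: "'m::comm_monoid_add set \<Rightarrow> ('m \<Rightarrow>\<^sub>0 'k::field) ring" where
  "semigroup_algebra S =
     \<lparr> carrier = {p. Poly_Mapping.keys p \<subseteq> S}, monoid.mult = (*), one = 1, ring.zero = 0, add = (+) \<rparr>"

definition toric_algebra :: "(real ^ 'n) set \<Rightarrow> (int ^ 'n \<Rightarrow>\<^sub>0 'k::field) ring" where
  "toric_algebra C = semigroup_algebra (dual_lattice_points C)"

definition monomial :: "'m \<Rightarrow> ('m \<Rightarrow>\<^sub>0 'k::field)" where
  "monomial l = Poly_Mapping.single l 1"

definition monomial_ideal :: "(real ^ 'n) set \<Rightarrow> (int ^ 'n \<Rightarrow>\<^sub>0 'k::field) set \<Rightarrow> bool" where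
  "monomial_ideal C I \<longleftrightarrow>
     (\<exists>M \<subseteq> dual_lattice_points C. I = genideal (toric_algebra C) (monomial ` M))"

lemma cring_semigroup_algebra:
  fixes S :: "'m::comm_monoid_add set"
  assumes "0 \<in> S" and "\<And>x y. x \<in> S \<Longrightarrow> y \<in> S \<Longrightarrow> x + y \<in> S"
  shows "cring (semigroup_algebra S :: ('m \<Rightarrow>\<^sub>0 'k::field) ring)" (is "cring ?R")
proof (rule cringI)
  have neg: "- x \<in> carrier ?R" if "x \<in> carrier ?R" for x
    using that by (simp add: semigroup_algebra_def)
  show "abelian_group ?R"
  proof (rule abelian_groupI)
    fix x assume "x \<in> carrier ?R"
    then show "\<exists>y\<in>carrier ?R. y \<oplus>\<^bsub>?R\<^esub> x = \<zero>\<^bsub>?R\<^esub>"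
      using neg by (intro bexI[of _ "- x"]) (auto simp: semigroup_algebra_def)
  qed (use keys_add in \<open>fastforce simp: semigroup_algebra_def algebra_simps\<close>)+
  show "Group.comm_monoid ?R"
  proof (rule comm_monoidI)
    fix x y assume "x \<in> carrier ?R" "y \<in> carrier ?R"
    then show "x \<otimes>\<^bsub>?R\<^esub> y \<in> carrier ?R"
      using keys_mult[of x y] assms(2) by (fastforce simp: semigroup_algebra_def)
  qed (use assms(1) in \<open>auto simp: semigroup_algebra_def algebra_simps\<close>)
qed (auto simp: semigroup_algebra_def algebra_simps)

lemma cring_toric_algebra:
  "cring (toric_algebra C :: (int ^ 'n \<Rightarrow>\<^sub>0 'k::field) ring)"
proof -
  have "real_vec (x + y) = real_vec x + real_vec y" for x y :: "int ^ 'n"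
    by (simp add: real_vec_def vec_eq_iff)
  moreover have "real_vec (0 :: int ^ 'n) = 0"
    by (simp add: real_vec_def vec_eq_iff)
  ultimately show ?thesis
    unfolding toric_algebra_def
    by (intro cring_semigroup_algebra)
      (auto simp: dual_lattice_points_def dual_cone_def inner_add_left)
qed


section \<open>Symbolic powers and the divisor class group\<close>

abbreviation ideal_power :: "('a, 'b) ring_scheme \<Rightarrow> 'a set \<Rightarrow> nat \<Rightarrow> 'a set" where
  "ideal_power R I a \<equiv> I [^]\<^bsub>ideals_set R\<^esub> a"

definition symbolic_power :: "('a, 'b) ring_scheme \<Rightarrow> 'a set \<Rightarrow> nat \<Rightarrow> 'a set" where
  "symbolic_power R P a =
     {f \<in> carrier R. \<exists>u \<in> carrier R - P. u \<otimes>\<^bsub>R\<^esub> f \<in> ideal_power R P a}"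

definition height :: "('a, 'b) ring_scheme \<Rightarrow> 'a set \<Rightarrow> enat" where
  "height R P = Sup {enat k | k. \<exists>Q :: nat \<Rightarrow> 'a set.
     (\<forall>i\<le>k. primeideal (Q i) R) \<and> (\<forall>i<k. Q i \<subset> Q (Suc i)) \<and> Q k = P}"

definition height_one_primes :: "('a, 'b) ring_scheme \<Rightarrow> 'a set set" where
  "height_one_primes R = {P. primeideal P R \<and> height R P = 1}"

(* For a height one prime P of a Noetherian normal domain R this is the valuation of the
   discrete valuation ring R_P: as P^a R_P contracts to the a-th symbolic power in R, the
   value of f \<noteq> 0 is the largest a with f \<in> P^a R_P.  The value at f = 0 is irrelevant. *)
definition valuation_at :: "('a, 'b) ring_scheme \<Rightarrow> 'a set \<Rightarrow> 'a \<Rightarrow> nat" where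
  "valuation_at R P f = (GREATEST a. f \<in> symbolic_power R P a)"

(* The divisors of the elements f/g \<noteq> 0 of the fraction field of R.  Their supports are
   finite when R is Noetherian, so no f/g is lost by asking D to be finitely supported. *)
definition principal_divisors :: "('a, 'b) ring_scheme \<Rightarrow> ('a set \<Rightarrow>\<^sub>0 int) set" where
  "principal_divisors R =
     {D \<in> carrier (free_Abelian_group (height_one_primes R)).
        \<exists>f \<in> carrier R - {\<zero>\<^bsub>R\<^esub>}. \<exists>g \<in> carrier R - {\<zero>\<^bsub>R\<^esub>}.
          \<forall>P \<in> height_one_primes R.
            Poly_Mapping.lookup D P = int (valuation_at R P f) - int (valuation_at R P g)}"

definition class_group :: "('a, 'b) ring_scheme \<Rightarrow> ('a set \<Rightarrow>\<^sub>0 int) set monoid" where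
  "class_group R = free_Abelian_group (height_one_primes R) Mod principal_divisors R"

end

(* For a monomial prime P, the sum w of the primitive generators vanishing on the face of monomials
   outside P is a weight that is 0 on that face and at least 1 on the other monomials. Lowest forms
   with respect to w show that the exponents m in P^(a) satisfy w(m) >= a, and each element of B has
   weight at most max (b . v_C), so m needs enough summands from B outside the face to lie in P^r.

   For a height one prime P, R is shown to be a Krull domain without Noetherian or factoriality
   arguments. Its essential valuations are the minima of m . u over the support, for primitive
   generators u, and the p-adic valuations of the principal ideal domains obtained by inverting all
   elements homogeneous in one coordinate; an element of the Laurent polynomial ring that is divisible
   by g in each of these localizations is divisible by g. Then card Cl(R) * P is the divisor of some
   h in R, and every element of P^(U(r-1)+1) is a multiple of h^(k(r-1)), k = U / card Cl(R), with
   cofactor in P. *)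
theory Submission
  imports Defs "HOL-Algebra.Multiplicative_Group"
begin

section \<open>Lowest forms of Laurent polynomials\<close>

text \<open>The two arguments of the lcm serve the two classes of primes separately: for monomial
  primes \<open>U\<close> has to be at least the largest weight, for height one primes it has to be
  a multiple of the class number. In both cases the 1 added to \<open>U * (r - 1)\<close> secures
  one more factor from \<open>P\<close>. The valuations are of two kinds because a quotient of
  elements of R can leave R in two ways: it is not a Laurent polynomial, or it is one with an
  exponent outside the dual cone. The rays measure the second defect. For the first, Laurent
  polynomials in several variables admit no division with remainder, but inverting everything
  homogeneous in one coordinate leaves Laurent polynomials in that variable over a field, where the
  Euclidean algorithm works. Fractions are avoided: localized divisibility is divisibility after
  multiplication by a homogeneous element. Recovering honest divisibility from the n localized ones
  then replaces Gauss's lemma.\<close>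

definition wmin :: "('m \<Rightarrow> int) \<Rightarrow> ('m \<Rightarrow>\<^sub>0 'k::zero) \<Rightarrow> int" where
  "wmin w f = Min (w ` Poly_Mapping.keys f)"

text \<open>The initial form of \<open>f\<close> along \<open>w\<close>. \<open>wmin w 0\<close> is
  the unspecified \<open>Min {}\<close>, which does no harm here because the lowest form of 0 is 0
  whatever that value is.\<close>

definition lform :: "('m \<Rightarrow> int) \<Rightarrow> ('m \<Rightarrow>\<^sub>0 'k::zero) \<Rightarrow> ('m \<Rightarrow>\<^sub>0 'k)" where
  "lform w f = Poly_Mapping.mapp (\<lambda>m c. if w m = wmin w f then c else 0) f"

definition homogeneous :: "('m \<Rightarrow> int) \<Rightarrow> ('m \<Rightarrow>\<^sub>0 'k::zero) \<Rightarrow> bool" where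
  "homogeneous w f \<longleftrightarrow> (\<forall>a\<in>Poly_Mapping.keys f. \<forall>b\<in>Poly_Mapping.keys f. w a = w b)"

lemma homogeneousD:
  "homogeneous w f \<Longrightarrow> a \<in> Poly_Mapping.keys f \<Longrightarrow> b \<in> Poly_Mapping.keys f \<Longrightarrow> w a = w b"
  unfolding homogeneous_def by blast

lemma keys_nonempty: "f \<noteq> 0 \<Longrightarrow> Poly_Mapping.keys f \<noteq> {}"
  by (metis Poly_Mapping.poly_mapping_eqI ex_in_conv in_keys_iff lookup_zero)

lemma wmin_le: "m \<in> Poly_Mapping.keys f \<Longrightarrow> wmin w f \<le> w m"
  by (simp add: wmin_def)

lemma wmin_attained:
  assumes "f \<noteq> 0"
  obtains m where "m \<in> Poly_Mapping.keys f" "w m = wmin w f"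
proof -
  have "wmin w f \<in> w ` Poly_Mapping.keys f"
    unfolding wmin_def using keys_nonempty[OF assms] by (intro Min_in) auto
  then show ?thesis using that by auto
qed

lemma le_wmin_iff: "f \<noteq> 0 \<Longrightarrow> c \<le> wmin w f \<longleftrightarrow> (\<forall>m\<in>Poly_Mapping.keys f. c \<le> w m)"
  by (simp add: wmin_def keys_nonempty)

lemma wmin_eqI:
  assumes "m \<in> Poly_Mapping.keys f" "\<And>k. k \<in> Poly_Mapping.keys f \<Longrightarrow> w m \<le> w k"
  shows "wmin w f = w m"
  unfolding wmin_def using assms by (intro Min_eqI) auto

lemma lookup_lform: "Poly_Mapping.lookup (lform w f) m = (if w m = wmin w f then Poly_Mapping.lookup f m else 0)"
  by (simp add: lform_def lookup_mapp when_def in_keys_iff)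

lemma lform_zero [simp]: "lform w 0 = 0"
  by (rule poly_mapping_eqI) (simp add: lookup_lform)

lemma keys_lform: "Poly_Mapping.keys (lform w f) = {m \<in> Poly_Mapping.keys f. w m = wmin w f}"
  by (auto simp: in_keys_iff lookup_lform split: if_splits)

lemma lform_nonzero: "f \<noteq> 0 \<Longrightarrow> lform w f \<noteq> 0"
  by (metis (mono_tags, lifting) empty_iff keys_lform keys_zero mem_Collect_eq wmin_attained)

lemma homogeneous_lform: "homogeneous w (lform w f)"
  by (auto simp: homogeneous_def keys_lform)

lemma homogeneous_lform_other: "homogeneous v f \<Longrightarrow> homogeneous v (lform w f)"
  by (auto simp: homogeneous_def keys_lform)

lemma lform_homogeneous:
  assumes "homogeneous w f" shows "lform w f = f"
proof (rule poly_mapping_eqI)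
  fix m
  show "Poly_Mapping.lookup (lform w f) m = Poly_Mapping.lookup f m"
  proof (cases "m \<in> Poly_Mapping.keys f")
    case True
    then have "w m = wmin w f"
      using assms unfolding homogeneous_def by (metis wmin_eqI order_refl)
    then show ?thesis by (simp add: lookup_lform)
  qed (simp add: lookup_lform in_keys_iff)
qed

lemma keys_minus_lform: "m \<in> Poly_Mapping.keys (f - lform w f) \<Longrightarrow> m \<in> Poly_Mapping.keys f \<and> wmin w f < w m"
  for f :: "'m \<Rightarrow>\<^sub>0 'k::ab_group_add"
  using wmin_le[of m f w] by (auto simp: in_keys_iff lookup_minus lookup_lform split: if_splits)

lemma keys_timesE:
  assumes "m \<in> Poly_Mapping.keys (f * g)"
  obtains a b where "a \<in> Poly_Mapping.keys f" "b \<in> Poly_Mapping.keys g" "m = a + b"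
  using keys_mult[of f g] assms by auto

context
  fixes w :: "'m::comm_monoid_add \<Rightarrow> int"
  assumes add: "\<And>x y. w (x + y) = w x + w y"
begin

lemma keys_mult_wmin: "m \<in> Poly_Mapping.keys (f * g) \<Longrightarrow> wmin w f + wmin w g \<le> w m"
  for f g :: "'m \<Rightarrow>\<^sub>0 'k::comm_ring_1"
  by (elim keys_timesE) (simp add: add add_mono wmin_le)

lemma keys_lform_mult: "m \<in> Poly_Mapping.keys (lform w f * lform w g) \<Longrightarrow> w m = wmin w f + wmin w g"
  for f g :: "'m \<Rightarrow>\<^sub>0 'k::comm_ring_1"
  by (elim keys_timesE) (simp add: add keys_lform)

text \<open>In fg = in(f) in(g) + (f - in(f)) g + in(f) (g - in(g)) the last two products only have
  exponents of weight strictly above \<open>wmin w f + wmin w g\<close>.\<close>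

lemma lookup_mult_lform:
  fixes f g :: "'m \<Rightarrow>\<^sub>0 'k::comm_ring_1"
  assumes "w m = wmin w f + wmin w g"
  shows "Poly_Mapping.lookup (f * g) m = Poly_Mapping.lookup (lform w f * lform w g) m"
proof -
  have "Poly_Mapping.lookup (f * g) m = Poly_Mapping.lookup
      (lform w f * lform w g + (f - lform w f) * g + lform w f * (g - lform w g)) m"
    by (simp add: algebra_simps)
  moreover have "m \<notin> Poly_Mapping.keys ((f - lform w f) * g)"
  proof
    assume "m \<in> Poly_Mapping.keys ((f - lform w f) * g)"
    then obtain a b where "a \<in> Poly_Mapping.keys (f - lform w f)" "b \<in> Poly_Mapping.keys g" "m = a + b"
      by (elim keys_timesE)
    then show False using keys_minus_lform[of a f w] wmin_le[of b g w] assms add[of a b] by simp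
  qed
  moreover have "m \<notin> Poly_Mapping.keys (lform w f * (g - lform w g))"
  proof
    assume "m \<in> Poly_Mapping.keys (lform w f * (g - lform w g))"
    then obtain a b where "a \<in> Poly_Mapping.keys (lform w f)" "b \<in> Poly_Mapping.keys (g - lform w g)" "m = a + b"
      by (elim keys_timesE)
    then show False using keys_minus_lform[of b g w] assms add[of a b] by (simp add: keys_lform)
  qed
  ultimately show ?thesis by (simp only: lookup_add in_keys_iff not_not add_0_right)
qed

text \<open>That the product of the lowest forms survives is a hypothesis because the absence of
  zero divisors is itself proved by means of this lemma.\<close>

lemma mult_nonzero_lform:
  fixes f g :: "'m \<Rightarrow>\<^sub>0 'k::comm_ring_1"
  assumes "lform w f * lform w g \<noteq> 0"
  shows "f * g \<noteq> 0" "wmin w (f * g) = wmin w f + wmin w g" "lform w (f * g) = lform w f * lform w g"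
proof -
  obtain m where m: "m \<in> Poly_Mapping.keys (lform w f * lform w g)"
    using keys_nonempty[OF assms] by blast
  then have wm: "w m = wmin w f + wmin w g" by (rule keys_lform_mult)
  have mk: "m \<in> Poly_Mapping.keys (f * g)"
    using m lookup_mult_lform[OF wm] by (simp add: in_keys_iff)
  then show "f * g \<noteq> 0" by auto
  show eq: "wmin w (f * g) = wmin w f + wmin w g"
    using wmin_eqI[OF mk, of w] keys_mult_wmin wm by auto
  show "lform w (f * g) = lform w f * lform w g"
  proof (rule poly_mapping_eqI)
    fix k
    show "Poly_Mapping.lookup (lform w (f * g)) k = Poly_Mapping.lookup (lform w f * lform w g) k"
    proof (cases "w k = wmin w f + wmin w g")
      case True
      then show ?thesis by (simp only: lookup_lform eq lookup_mult_lform if_True simp_thms)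
    next
      case False
      then have "Poly_Mapping.lookup (lform w f * lform w g) k = 0"
        using keys_lform_mult by (auto simp: in_keys_iff)
      then show ?thesis using False by (simp only: lookup_lform eq if_False)
    qed
  qed
qed

end

section \<open>Absence of zero divisors among Laurent polynomials\<close>

lemma single_eq_0_iff: "Poly_Mapping.single m c = 0 \<longleftrightarrow> c = 0"
  by (metis lookup_single_eq lookup_zero single_zero)

lemma keys_subset_singleton: "Poly_Mapping.keys f \<subseteq> {m} \<Longrightarrow> f = Poly_Mapping.single m (Poly_Mapping.lookup f m)"
  by (rule poly_mapping_eqI) (auto simp: lookup_single when_def in_keys_iff)

text \<open>Terminal case of the two reductions to lowest forms, for zero divisors and for
  divisibility; the terms reached here are units of the Laurent ring.\<close>

lemma coordinate_homogeneous_single: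
  fixes f :: "int ^ 'n \<Rightarrow>\<^sub>0 'k::zero"
  assumes "\<And>i. homogeneous (\<lambda>m. m $ i) f" "f \<noteq> 0"
  shows "\<exists>m c. c \<noteq> 0 \<and> f = Poly_Mapping.single m c"
proof -
  obtain m where m: "m \<in> Poly_Mapping.keys f" using keys_nonempty[OF assms(2)] by blast
  have sub: "Poly_Mapping.keys f \<subseteq> {m}"
  proof
    fix k assume k: "k \<in> Poly_Mapping.keys f"
    have "k $ i = m $ i" for i
      using assms(1)[of i] m k unfolding homogeneous_def by blast
    then show "k \<in> {m}" by (simp add: vec_eq_iff)
  qed
  have "Poly_Mapping.lookup f m \<noteq> 0" using m by (simp add: in_keys_iff)
  with keys_subset_singleton[OF sub] show ?thesis by blast
qed

text \<open>If some coordinate is not constant on the two supports, passing to lowest forms shrinks them;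
  otherwise both factors are terms.\<close>

lemma laurent_mult_nonzero:
  fixes f g :: "int ^ 'n \<Rightarrow>\<^sub>0 'k::field"
  assumes "f \<noteq> 0" "g \<noteq> 0"
  shows "f * g \<noteq> 0"
  using assms
proof (induction "card (Poly_Mapping.keys f) + card (Poly_Mapping.keys g)" arbitrary: f g rule: less_induct)
  case less
  show ?case
  proof (cases "\<forall>i. homogeneous (\<lambda>m. m $ i) f \<and> homogeneous (\<lambda>m. m $ i) g")
    case True
    obtain a c where "c \<noteq> 0" "f = Poly_Mapping.single a c"
      using coordinate_homogeneous_single[OF _ less.prems(1)] True by (metis (no_types, lifting))
    moreover obtain b d where "d \<noteq> 0" "g = Poly_Mapping.single b d"
      using coordinate_homogeneous_single[OF _ less.prems(2)] True by (metis (no_types, lifting))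
    ultimately have "f * g = Poly_Mapping.single (a + b) (c * d)" "c * d \<noteq> 0"
      by (simp_all only: mult_single) simp
    then show ?thesis using single_eq_0_iff by metis
  next
    case False
    then obtain i where i: "\<not> (homogeneous (\<lambda>m. m $ i) f \<and> homogeneous (\<lambda>m. m $ i) g)" by blast
    define w where "w = (\<lambda>m::int^'n. m $ i)"
    have le: "card (Poly_Mapping.keys (lform w h)) \<le> card (Poly_Mapping.keys h)" for h :: "int ^ 'n \<Rightarrow>\<^sub>0 'k"
      by (rule card_mono) (auto simp: keys_lform)
    have lt: "card (Poly_Mapping.keys (lform w h)) < card (Poly_Mapping.keys h)" if "\<not> homogeneous w h"
      for h :: "int ^ 'n \<Rightarrow>\<^sub>0 'k"
    proof (rule psubset_card_mono)
      have "Poly_Mapping.keys (lform w h) \<noteq> Poly_Mapping.keys h"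
        using that homogeneous_lform[of w h] by (auto simp: homogeneous_def)
      then show "Poly_Mapping.keys (lform w h) \<subset> Poly_Mapping.keys h" by (auto simp: keys_lform)
    qed simp
    have "card (Poly_Mapping.keys (lform w f)) + card (Poly_Mapping.keys (lform w g))
      < card (Poly_Mapping.keys f) + card (Poly_Mapping.keys g)"
      using i[folded w_def] lt[of f] lt[of g] le[of f] le[of g] by linarith
    then have "lform w f * lform w g \<noteq> 0"
      using less.hyps lform_nonzero less.prems by blast
    then show ?thesis by (rule mult_nonzero_lform[rotated]) (simp add: w_def)
  qed
qed

lemma laurent_mult_eq_0_iff [simp]:
  fixes f g :: "int ^ 'n \<Rightarrow>\<^sub>0 'k::field"
  shows "f * g = 0 \<longleftrightarrow> f = 0 \<or> g = 0"
  using laurent_mult_nonzero[of f g] by auto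

lemma laurent_mult_left_cancel:
  fixes f g h :: "int ^ 'n \<Rightarrow>\<^sub>0 'k::field"
  assumes "h * f = h * g" "h \<noteq> 0"
  shows "f = g"
proof -
  have "h * (f - g) = 0" using assms(1) by (simp add: algebra_simps)
  then show ?thesis using assms(2) by simp
qed

lemma laurent_power_eq_0_iff [simp]:
  fixes f :: "int ^ 'n \<Rightarrow>\<^sub>0 'k::field"
  shows "f ^ a = 0 \<longleftrightarrow> f = 0 \<and> a > 0"
  by (induction a) auto

section \<open>Extremal weights and widths of products\<close>

locale weight =
  fixes w :: "int ^ 'n \<Rightarrow> int"
  assumes add: "\<And>x y. w (x + y) = w x + w y"
begin

lemma zero: "w 0 = 0"
  using add[of 0 0] by simp

lemma wmin_mult:
  fixes f g :: "int ^ 'n \<Rightarrow>\<^sub>0 'k::field"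
  assumes "f \<noteq> 0" "g \<noteq> 0"
  shows "wmin w (f * g) = wmin w f + wmin w g"
  by (rule mult_nonzero_lform(2)) (simp_all add: add assms lform_nonzero)

lemma lform_mult:
  fixes f g :: "int ^ 'n \<Rightarrow>\<^sub>0 'k::field"
  shows "lform w (f * g) = lform w f * lform w g"
proof (cases "f = 0 \<or> g = 0")
  case True
  have "lform w (0 :: int ^ 'n \<Rightarrow>\<^sub>0 'k) = 0" by (rule lform_zero)
  then show ?thesis using True by (elim disjE) (simp_all only: mult_zero_left mult_zero_right)
next
  case False
  then show ?thesis
    by (intro mult_nonzero_lform(3)) (simp_all add: add lform_nonzero)
qed

text \<open>Written through \<open>wmin\<close> for the negated weight, so that additivity on
  products is inherited from \<open>wmin_mult\<close>.\<close>

definition wmax :: "(int ^ 'n \<Rightarrow>\<^sub>0 'k::field) \<Rightarrow> int" where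
  "wmax f = - wmin (\<lambda>m. - w m) f"

text \<open>The degree of \<open>f\<close> as a Laurent polynomial in the direction of
  \<open>w\<close>. Multiplication by nonzero homogeneous elements does not change it, which makes
  it the Euclidean function once these are inverted.\<close>

definition width :: "(int ^ 'n \<Rightarrow>\<^sub>0 'k::field) \<Rightarrow> nat" where
  "width f = nat (wmax f - wmin w f)"

lemma le_wmax: "m \<in> Poly_Mapping.keys f \<Longrightarrow> w m \<le> wmax f"
  using wmin_le[of m f "\<lambda>m. - w m"] by (simp add: wmax_def)

lemma wmax_attained:
  assumes "f \<noteq> 0"
  obtains m where "m \<in> Poly_Mapping.keys f" "w m = wmax f"
  using wmin_attained[OF assms, of "\<lambda>m. - w m"] by (metis wmax_def minus_minus)

lemma wmin_le_wmax: "f \<noteq> 0 \<Longrightarrow> wmin w f \<le> wmax f"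
  by (metis le_wmax wmin_attained)

lemma wmax_mult:
  assumes "f \<noteq> 0" "g \<noteq> 0"
  shows "wmax (f * g) = wmax f + wmax g"
proof -
  interpret neg: weight "\<lambda>m. - w m" by standard (simp add: add)
  show ?thesis unfolding wmax_def neg.wmin_mult[OF assms] by linarith
qed

lemma int_width: "f \<noteq> 0 \<Longrightarrow> int (width f) = wmax f - wmin w f"
  using wmin_le_wmax[of f] unfolding width_def by simp

lemma width_mult:
  assumes "f \<noteq> 0" "g \<noteq> 0"
  shows "width (f * g) = width f + width g"
proof -
  have "int (width (f * g)) = int (width f) + int (width g)"
    unfolding int_width[OF assms(1)] int_width[OF assms(2)] int_width[OF laurent_mult_nonzero[OF assms]]
      wmax_mult[OF assms] wmin_mult[OF assms] by linarith
  then show ?thesis by (simp only: of_nat_add[symmetric] of_nat_eq_iff)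
qed

lemma homogeneous_iff_width: 
  assumes "f \<noteq> 0"
  shows "homogeneous w f \<longleftrightarrow> width f = 0"
proof
  assume hom: "homogeneous w f"
  obtain a b where "a \<in> Poly_Mapping.keys f" "w a = wmin w f" "b \<in> Poly_Mapping.keys f" "w b = wmax f"
    using wmin_attained[OF assms] wmax_attained[OF assms] by metis
  then have "wmax f = wmin w f"
    using homogeneousD[OF hom] by metis
  then show "width f = 0" by (simp add: width_def)
next
  assume "width f = 0"
  then have le: "wmax f \<le> wmin w f" by (simp add: width_def)
  show "homogeneous w f"
    unfolding homogeneous_def
  proof (intro ballI)
    fix a b assume "a \<in> Poly_Mapping.keys f" "b \<in> Poly_Mapping.keys f"
    then show "w a = w b"
      using le le_wmax[of a f] le_wmax[of b f] wmin_le[of a f w] wmin_le[of b f w] by linarith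
  qed
qed

text \<open>Widths are natural numbers, so their sum is 0 only if both are; the set of elements to
  be inverted is therefore saturated.\<close>

lemma homogeneous_mult_iff:
  fixes f g :: "int ^ 'n \<Rightarrow>\<^sub>0 'k::field"
  assumes "f \<noteq> 0" "g \<noteq> 0"
  shows "homogeneous w (f * g) \<longleftrightarrow> homogeneous w f \<and> homogeneous w g"
  using assms by (simp add: homogeneous_iff_width width_mult)

lemma width_one [simp]: "width (1 :: int ^ 'n \<Rightarrow>\<^sub>0 'k::field) = 0"
proof -
  have "homogeneous w (1 :: int ^ 'n \<Rightarrow>\<^sub>0 'k)" by (simp add: homogeneous_def)
  then show ?thesis by (simp add: homogeneous_iff_width)
qed

lemma width_power: "f \<noteq> 0 \<Longrightarrow> width (f ^ a) = a * width f"
  by (induction a) (auto simp: width_mult)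

end

section \<open>Divisibility up to homogeneous elements\<close>

lemma homogeneous_single: "homogeneous w (Poly_Mapping.single m c)"
  by (auto simp: homogeneous_def split: if_splits)

context weight
begin

text \<open>Division from the bottom: \<open>f\<close> and \<open>g\<close> are cross-multiplied by
  each other's lowest forms, so that the lowest terms cancel. The lower end of the weights rises,
  the upper end stays bounded because \<open>width g \<le> width f\<close>, and the multiplier stays
  homogeneous, being a power of the lowest form of \<open>g\<close>.\<close>

lemma pseudo_division:
  fixes f g :: "int ^ 'n \<Rightarrow>\<^sub>0 'k::field"
  assumes "g \<noteq> 0"
  shows "\<exists>t q r. t \<noteq> 0 \<and> homogeneous w t \<and> t * f = q * g + r \<and> (r = 0 \<or> width r < width g)"
proof (induction "width f" arbitrary: f rule: less_induct)
  case less
  show ?case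
  proof (cases "f = 0 \<or> width f < width g")
    case True
    then show ?thesis
      by (intro exI[of _ 1] exI[of _ 0] exI[of _ f]) (simp add: homogeneous_def)
  next
    case False
    then have f: "f \<noteq> 0" "width g \<le> width f" by auto
    define s where "s = lform w g"
    have s: "s \<noteq> 0" "homogeneous w s"
      by (simp_all add: s_def lform_nonzero assms homogeneous_lform)
    define h where "h = s * f - lform w f * g"
    show ?thesis
    proof (cases "h = 0")
      case True
      then have "s * f = lform w f * g + 0" by (simp add: h_def)
      with s show ?thesis by blast
    next
      case h: False
      have "w m \<le> wmin w g + wmax f" if m: "m \<in> Poly_Mapping.keys h" for m
      proof -
        have "m \<in> Poly_Mapping.keys (s * f) \<or> m \<in> Poly_Mapping.keys (lform w f * g)"
          using m keys_diff[of "s * f" "lform w f * g"] by (auto simp: h_def)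
        then show ?thesis
        proof
          assume "m \<in> Poly_Mapping.keys (s * f)"
          then obtain a b where "a \<in> Poly_Mapping.keys s" "b \<in> Poly_Mapping.keys f" "m = a + b"
            by (rule keys_timesE)
          then show ?thesis
            using le_wmax[of b f] by (simp add: s_def keys_lform add)
        next
          assume "m \<in> Poly_Mapping.keys (lform w f * g)"
          then obtain a b where "a \<in> Poly_Mapping.keys (lform w f)" "b \<in> Poly_Mapping.keys g" "m = a + b"
            by (rule keys_timesE)
          \<comment> \<open>A rearrangement of \<open>width g \<le> width f\<close>.\<close>
          moreover have "wmax g + wmin w f \<le> wmax f + wmin w g"
            using f int_width[OF f(1)] int_width[OF assms] by linarith
          ultimately show ?thesis
            using le_wmax[of b g] by (simp add: s_def keys_lform add)
        qed
      qed
      then have max: "wmax h \<le> wmin w g + wmax f"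
        using wmax_attained[OF h] by metis
      have "wmin w g + wmin w f < w m" if m: "m \<in> Poly_Mapping.keys h" for m
      proof -
        \<comment> \<open>The product of the two lowest forms occurs in both terms of
          \<open>h\<close> and cancels; what is left has strictly larger weight.\<close>
        have "h = s * (f - lform w f) - lform w f * (g - lform w g)"
          by (simp add: h_def s_def algebra_simps)
        then have "m \<in> Poly_Mapping.keys (s * (f - lform w f)) \<or> m \<in> Poly_Mapping.keys (lform w f * (g - lform w g))"
          using m keys_diff[of "s * (f - lform w f)" "lform w f * (g - lform w g)"] by auto
        then show ?thesis
        proof
          assume "m \<in> Poly_Mapping.keys (s * (f - lform w f))"
          then obtain a b where "a \<in> Poly_Mapping.keys s" "b \<in> Poly_Mapping.keys (f - lform w f)" "m = a + b"
            by (rule keys_timesE)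
          then show ?thesis
            using keys_minus_lform[of b f w] by (simp add: s_def keys_lform add)
        next
          assume "m \<in> Poly_Mapping.keys (lform w f * (g - lform w g))"
          then obtain a b where "a \<in> Poly_Mapping.keys (lform w f)" "b \<in> Poly_Mapping.keys (g - lform w g)" "m = a + b"
            by (rule keys_timesE)
          then show ?thesis
            using keys_minus_lform[of b g w] by (simp add: s_def keys_lform add)
        qed
      qed
      then have "wmin w g + wmin w f < wmin w h"
        using wmin_attained[OF h, of w] by metis
      then have "int (width h) < int (width f)"
        using max int_width[OF h] int_width[OF f(1)] by linarith
      then have "width h < width f" by simp
      from less.hyps[OF this] obtain t q r where
        t: "t \<noteq> 0" "homogeneous w t" "t * h = q * g + r" "r = 0 \<or> width r < width g" by blast
      have "(t * s) * f = (q + t * lform w f) * g + r"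
        using t(3) by (simp add: h_def algebra_simps)
      moreover have "t * s \<noteq> 0" "homogeneous w (t * s)"
        using t s by (simp_all add: homogeneous_mult_iff)
      ultimately show ?thesis using t(4) by blast
    qed
  qed
qed

text \<open>Divisibility after inverting all nonzero homogeneous elements; the localized ring is a
  principal ideal domain by pseudo-division with respect to the width.\<close>

definition hdvd :: "(int ^ 'n \<Rightarrow>\<^sub>0 'k::field) \<Rightarrow> (int ^ 'n \<Rightarrow>\<^sub>0 'k) \<Rightarrow> bool" (infix "hdvd" 50) where
  "p hdvd f \<longleftrightarrow> (\<exists>t. t \<noteq> 0 \<and> homogeneous w t \<and> p dvd t * f)"

lemma hdvdI: "t \<noteq> 0 \<Longrightarrow> homogeneous w t \<Longrightarrow> t * f = p * q \<Longrightarrow> p hdvd f"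
  unfolding hdvd_def by auto

lemma hdvdE:
  assumes "p hdvd f"
  obtains t q where "t \<noteq> 0" "homogeneous w t" "t * f = p * q"
  using assms unfolding hdvd_def dvd_def by blast

lemma hdvd_refl [simp]: "p hdvd p"
  by (rule hdvdI[of 1 _ _ 1]) (simp_all add: homogeneous_def)

lemma hdvd_trans: 
  assumes "a hdvd b" "b hdvd c"
  shows "a hdvd c"
proof -
  obtain t q where t: "t \<noteq> 0" "homogeneous w t" "t * b = a * q" by (rule hdvdE[OF assms(1)])
  obtain s r where s: "s \<noteq> 0" "homogeneous w s" "s * c = b * r" by (rule hdvdE[OF assms(2)])
  have "(t * s) * c = (t * b) * r" using s(3) by (simp add: mult.assoc)
  also have "\<dots> = a * (q * r)" unfolding t(3) by (simp add: mult.assoc)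
  finally show ?thesis using t s by (intro hdvdI[of "t * s"]) (simp_all add: homogeneous_mult_iff)
qed

lemma hdvd_add:
  assumes "a hdvd b" "a hdvd c"
  shows "a hdvd (b + c)"
proof -
  obtain t q where t: "t \<noteq> 0" "homogeneous w t" "t * b = a * q" by (rule hdvdE[OF assms(1)])
  obtain s r where s: "s \<noteq> 0" "homogeneous w s" "s * c = a * r" by (rule hdvdE[OF assms(2)])
  have "(t * s) * (b + c) = s * (t * b) + t * (s * c)" by (simp add: algebra_simps)
  also have "\<dots> = a * (s * q + t * r)" unfolding s t by (simp add: algebra_simps)
  finally show ?thesis using t s by (intro hdvdI[of "t * s"]) (simp_all add: homogeneous_mult_iff)
qed

lemma dvd_imp_hdvd: "a dvd b \<Longrightarrow> a hdvd b"
  by (metis hdvd_def homogeneous_single mult_1 single_one zero_neq_one)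

lemma hdvd_mult: "a hdvd b \<Longrightarrow> a hdvd b * c"
  using dvd_imp_hdvd hdvd_trans by (metis dvd_triv_left)

lemma hdvd_mult_mono:
  assumes "a hdvd b" "c hdvd d"
  shows "a * c hdvd b * d"
proof -
  obtain t q where t: "t \<noteq> 0" "homogeneous w t" "t * b = a * q" by (rule hdvdE[OF assms(1)])
  obtain s r where s: "s \<noteq> 0" "homogeneous w s" "s * d = c * r" by (rule hdvdE[OF assms(2)])
  have "(t * s) * (b * d) = (t * b) * (s * d)" by (simp add: algebra_simps)
  also have "\<dots> = (a * c) * (q * r)" unfolding s t by (simp add: algebra_simps)
  finally show ?thesis using t s by (intro hdvdI[of "t * s"]) (simp_all add: homogeneous_mult_iff)
qed

lemma hdvd_power_mono: "a hdvd b \<Longrightarrow> a ^ n hdvd b ^ n"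
  by (induction n) (auto intro: hdvd_mult_mono)

lemma homogeneous_mult_hdvd: 
  assumes "s \<noteq> 0" "homogeneous w s"
  shows "s * f hdvd f"
  by (rule hdvdI[of s _ _ 1]) (use assms in simp_all)

lemma hdvd_width_le:
  assumes "a hdvd b" "b \<noteq> 0"
  shows "a \<noteq> 0 \<and> width a \<le> width b"
proof -
  obtain t q where t: "t \<noteq> 0" "homogeneous w t" "t * b = a * q" by (rule hdvdE[OF assms(1)])
  then have nz: "a \<noteq> 0" "q \<noteq> 0" using assms(2) laurent_mult_nonzero[of t b] by auto
  then have "width t + width b = width a + width q"
    using t assms(2) by (metis width_mult)
  then show ?thesis using t nz by (simp add: homogeneous_iff_width)
qed

text \<open>The cofactor then has width 0, so it is homogeneous and can serve as multiplier in the
  opposite direction: divisors of equal width are associates.\<close>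

lemma hdvd_width_eq:
  assumes "a hdvd b" "b \<noteq> 0" "width a = width b"
  shows "b hdvd a"
proof -
  obtain t q where t: "t \<noteq> 0" "homogeneous w t" "t * b = a * q" by (rule hdvdE[OF assms(1)])
  then have nz: "a \<noteq> 0" "q \<noteq> 0" using assms(2) laurent_mult_nonzero[of t b] by auto
  then have "width t + width b = width a + width q"
    using t assms(2) by (metis width_mult)
  then have "homogeneous w q" using t nz assms(3) by (simp add: homogeneous_iff_width)
  then show ?thesis using t(3) nz by (intro hdvdI[of q _ _ t]) (simp_all add: mult.commute)
qed

lemma homogeneous_hdvd: "d \<noteq> 0 \<Longrightarrow> homogeneous w d \<Longrightarrow> d hdvd f"
  by (rule hdvdI[of d _ _ f]) simp_all

text \<open>Irreducibility in the localized ring: among the divisors of \<open>p\<close>, width 0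
  marks the units and width \<open>width p\<close> the associates of \<open>p\<close>.\<close>

definition hprime :: "(int ^ 'n \<Rightarrow>\<^sub>0 'k::field) \<Rightarrow> bool" where
  "hprime p \<longleftrightarrow> p \<noteq> 0 \<and> width p > 0 \<and> (\<forall>d. d hdvd p \<longrightarrow> width d = 0 \<or> width d = width p)"

text \<open>Bezout: by pseudo-division, a nonzero element of least width in the ideal of
  \<open>p\<close> and \<open>a\<close> divides both after localization. As a divisor of
  \<open>p\<close> it is an associate of \<open>p\<close>, which gives \<open>p hdvd a\<close>, or a
  unit, which gives \<open>p hdvd b\<close>.\<close>

lemma hprime_dvd_mult:
  assumes p: "hprime p" and dvd: "p hdvd a * b"
  shows "p hdvd a \<or> p hdvd b"
proof -
  have p0: "p \<noteq> 0" using p by (simp add: hprime_def)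
  define I where "I = {x * p + y * a |x y. True}"
  have pI: "p \<in> I" unfolding I_def by (rule CollectI, intro exI[of _ 1] exI[of _ 0]) simp
  have aI: "a \<in> I" unfolding I_def by (rule CollectI, intro exI[of _ 0] exI[of _ 1]) simp
  obtain d where d: "d \<in> I" "d \<noteq> 0" and min: "\<And>e. e \<in> I \<Longrightarrow> e \<noteq> 0 \<Longrightarrow> width d \<le> width e"
    using ex_has_least_nat[of "\<lambda>d. d \<in> I \<and> d \<noteq> 0" p width] pI p0 by blast
  have ddvd: "d hdvd e" if eI: "e \<in> I" for e
  proof -
    obtain t q r where t: "t \<noteq> 0" "homogeneous w t" "t * e = q * d + r" "r = 0 \<or> width r < width d"
      using pseudo_division[OF d(2)] by blast
    obtain x y x' y' where xy: "e = x * p + y * a" "d = x' * p + y' * a"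
      using eI d(1) unfolding I_def by blast
    have "r = t * e - q * d" unfolding t(3) by simp
    also have "\<dots> = (t * x - q * x') * p + (t * y - q * y') * a"
      unfolding xy by (simp add: algebra_simps)
    finally have "r = (t * x - q * x') * p + (t * y - q * y') * a" .
    then have "r \<in> I" unfolding I_def by blast
    then have "r = 0" using t(4) min by fastforce
    then show ?thesis using t by (intro hdvdI[of t _ _ q]) (simp_all add: mult.commute)
  qed
  have "width d = 0 \<or> width d = width p" using ddvd[OF pI] p by (auto simp: hprime_def)
  then show ?thesis
  proof
    assume "width d = width p"
    then have "p hdvd d" using hdvd_width_eq ddvd[OF pI] p0 by blast
    then show ?thesis using hdvd_trans ddvd[OF aI] by blast
  next
    assume "width d = 0"
    then have hom: "homogeneous w d" using d by (simp add: homogeneous_iff_width)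
    obtain x y where "d = x * p + y * a" using d(1) unfolding I_def by blast
    then have db: "d * b = p * (x * b) + (a * b) * y" by (simp add: algebra_simps)
    have "p hdvd d * b" unfolding db
      by (intro hdvd_add hdvd_mult dvd dvd_imp_hdvd) simp
    moreover have "d * b hdvd b" by (rule homogeneous_mult_hdvd[OF d(2) hom])
    ultimately show ?thesis using hdvd_trans by blast
  qed
qed

lemma exists_hprime_hdvd:
  assumes "f \<noteq> 0" "width f > 0"
  shows "\<exists>p. hprime p \<and> p hdvd f"
proof -
  obtain p where p: "p hdvd f" "width p > 0"
    and min: "\<And>q. q hdvd f \<Longrightarrow> width q > 0 \<Longrightarrow> width p \<le> width q"
    using ex_has_least_nat[of "\<lambda>p. p hdvd f \<and> width p > 0" f width] assms hdvd_refl by blast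
  have p0: "p \<noteq> 0" using hdvd_width_le[OF p(1) assms(1)] by simp
  have "width d = 0 \<or> width d = width p" if "d hdvd p" for d
    using hdvd_width_le[OF that p0] min[OF hdvd_trans[OF that p(1)]] by (metis gr0I le_antisym)
  then have "hprime p" using p p0 by (simp add: hprime_def)
  with p(1) show ?thesis by blast
qed

text \<open>For \<open>f \<noteq> 0\<close> the exponents are bounded by \<open>width f\<close>, so
  a greatest one exists; every power of \<open>p\<close> divides 0, and the value there is
  unspecified.\<close>

definition hval :: "(int ^ 'n \<Rightarrow>\<^sub>0 'k::field) \<Rightarrow> (int ^ 'n \<Rightarrow>\<^sub>0 'k) \<Rightarrow> nat" where
  "hval p f = (GREATEST a. p ^ a hdvd f)"

lemma hval_bound:
  assumes "hprime p" "f \<noteq> 0" "p ^ a hdvd f"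
  shows "a \<le> width f"
proof -
  have "p \<noteq> 0" "width p \<ge> 1" using assms(1) by (auto simp: hprime_def)
  then have "a \<le> a * width p" by simp
  also have "\<dots> = width (p ^ a)" using \<open>p \<noteq> 0\<close> by (simp add: width_power)
  also have "\<dots> \<le> width f" using hdvd_width_le[OF assms(3,2)] by simp
  finally show ?thesis .
qed

lemma power_hval_hdvd:
  assumes "hprime p" "f \<noteq> 0"
  shows "p ^ hval p f hdvd f"
  unfolding hval_def
  by (rule GreatestI_nat[of _ 0 "width f"]) (use hval_bound[OF assms] in \<open>auto intro: dvd_imp_hdvd\<close>)

lemma hval_ge: "hprime p \<Longrightarrow> f \<noteq> 0 \<Longrightarrow> p ^ a hdvd f \<Longrightarrow> a \<le> hval p f"
  unfolding hval_def by (rule Greatest_le_nat[of _ _ "width f"]) (auto intro: hval_bound)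

lemma hval_cofactor:
  assumes "hprime p" "f \<noteq> 0"
  obtains t g where "t \<noteq> 0" "homogeneous w t" "t * f = p ^ hval p f * g" "g \<noteq> 0" "\<not> p hdvd g"
proof -
  obtain t g where t: "t \<noteq> 0" "homogeneous w t" "t * f = p ^ hval p f * g"
    by (rule hdvdE[OF power_hval_hdvd[OF assms]])
  have "g \<noteq> 0" using t assms(2) laurent_mult_nonzero[of t f] by auto
  moreover have "\<not> p hdvd g"
  proof
    assume "p hdvd g"
    then have "p ^ hval p f * p hdvd t * f" unfolding t(3) by (intro hdvd_mult_mono) simp_all
    then have "p ^ Suc (hval p f) hdvd f"
      using hdvd_trans homogeneous_mult_hdvd[OF t(1,2)] by (metis power_Suc mult.commute)
    then show False using hval_ge[OF assms] by fastforce
  qed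
  ultimately show ?thesis using that t by blast
qed

lemma hval_eqI:
  assumes p: "hprime p" and "f \<noteq> 0" "t \<noteq> 0" "homogeneous w t" "t * f = p ^ a * g" "\<not> p hdvd g"
  shows "hval p f = a"
proof (rule antisym)
  show "a \<le> hval p f" by (rule hval_ge[OF p assms(2) hdvdI[OF assms(3-5)]])
  show "hval p f \<le> a"
  proof (rule ccontr)
    assume "\<not> hval p f \<le> a"
    then obtain k where k: "hval p f = a + Suc k" using less_imp_Suc_add[of a "hval p f"] by auto
    obtain s h where s: "s \<noteq> 0" "homogeneous w s" "s * f = p ^ hval p f * h"
      by (rule hdvdE[OF power_hval_hdvd[OF assms(1,2)]])
    have "p ^ a * (s * g) = s * (t * f)" unfolding assms(5) by (simp add: algebra_simps)
    also have "\<dots> = t * (s * f)" by (simp add: algebra_simps)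
    also have "\<dots> = p ^ a * (p * (t * p ^ k * h))"
      unfolding s(3) k by (simp add: power_add algebra_simps)
    finally have "s * g = p * (t * p ^ k * h)"
      by (rule laurent_mult_left_cancel) (use p in \<open>simp add: hprime_def\<close>)
    then have "p hdvd g" by (rule hdvdI[OF s(1,2)])
    then show False using assms(6) by simp
  qed
qed

lemma hval_mult:
  assumes p: "hprime p" and "f \<noteq> 0" "g \<noteq> 0"
  shows "hval p (f * g) = hval p f + hval p g"
proof -
  obtain t a where t: "t \<noteq> 0" "homogeneous w t" "t * f = p ^ hval p f * a" "a \<noteq> 0" "\<not> p hdvd a"
    by (rule hval_cofactor[OF p assms(2)])
  obtain s b where s: "s \<noteq> 0" "homogeneous w s" "s * g = p ^ hval p g * b" "b \<noteq> 0" "\<not> p hdvd b"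
    by (rule hval_cofactor[OF p assms(3)])
  show ?thesis
  proof (rule hval_eqI[OF p])
    have "(t * s) * (f * g) = (t * f) * (s * g)" by (simp add: algebra_simps)
    also have "\<dots> = p ^ (hval p f + hval p g) * (a * b)"
      unfolding t s by (simp add: power_add algebra_simps)
    finally show "(t * s) * (f * g) = p ^ (hval p f + hval p g) * (a * b)" .
    show "\<not> p hdvd a * b" using hprime_dvd_mult[OF p] t s by blast
  qed (use t s assms in \<open>simp_all add: homogeneous_mult_iff\<close>)
qed

lemma hval_pos_iff: 
  assumes "hprime p" "f \<noteq> 0"
  shows "hval p f > 0 \<longleftrightarrow> p hdvd f"
proof
  assume "hval p f > 0"
  then have "p hdvd p ^ hval p f" by (intro dvd_imp_hdvd) (simp add: dvd_power)
  then show "p hdvd f" using power_hval_hdvd[OF assms] hdvd_trans by blast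
next
  assume "p hdvd f"
  then show "hval p f > 0" using hval_ge[OF assms, of 1] by simp
qed

lemma hprime_not_hdvd_homogeneous:
  assumes "hprime p" "t \<noteq> 0" "homogeneous w t"
  shows "\<not> p hdvd t"
  using hdvd_width_le[of p t] assms homogeneous_iff_width[of t] by (auto simp: hprime_def)

lemma hval_homogeneous: "hprime p \<Longrightarrow> t \<noteq> 0 \<Longrightarrow> homogeneous w t \<Longrightarrow> hval p t = 0"
  using hprime_not_hdvd_homogeneous hval_pos_iff by blast

lemma hval_self: 
  assumes "hprime p" shows "hval p p = 1"
proof (rule hval_eqI[OF assms])
  show "(1::int ^ 'n \<Rightarrow>\<^sub>0 'a) * p = p ^ 1 * 1" by simp
  show "\<not> p hdvd 1" by (rule hprime_not_hdvd_homogeneous[OF assms]) (simp_all add: homogeneous_def)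
qed (use assms in \<open>auto simp: hprime_def homogeneous_def\<close>)

text \<open>One prime of \<open>g\<close> at a time is cancelled from both \<open>g\<close> and
  \<open>f\<close>. The homogeneous multipliers have value 0 everywhere, so the comparison of values
  passes to the cofactors, and the width of \<open>g\<close> drops by
  \<open>width p\<close>.\<close>

lemma hdvd_if_hval_le:
  assumes "f \<noteq> 0" "g \<noteq> 0" "\<And>p. hprime p \<Longrightarrow> hval p g \<le> hval p f"
  shows "g hdvd f"
  using assms
proof (induction "width g" arbitrary: f g rule: less_induct)
  case less
  show ?case
  proof (cases "width g = 0")
    case True
    then show ?thesis using less.prems homogeneous_hdvd homogeneous_iff_width by blast
  next
    case False
    then obtain p where p: "hprime p" "p hdvd g" using exists_hprime_hdvd less.prems(2) by blast
    then have "hval p f > 0" using less.prems hval_pos_iff by (metis gr0I leD)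
    then have "p hdvd f" using p less.prems hval_pos_iff by blast
    then obtain s f' where s: "s \<noteq> 0" "homogeneous w s" "s * f = p * f'" by (rule hdvdE)
    obtain t g' where t: "t \<noteq> 0" "homogeneous w t" "t * g = p * g'" by (rule hdvdE[OF p(2)])
    have p0: "p \<noteq> 0" "width p > 0" using p by (auto simp: hprime_def)
    have nz: "f' \<noteq> 0" "g' \<noteq> 0" using s t less.prems laurent_mult_nonzero[of s f] laurent_mult_nonzero[of t g] by auto
    have "width t + width g = width p + width g'" using t nz p0 less.prems by (metis width_mult)
    then have "width g' < width g" using p0 t homogeneous_iff_width[of t] by simp
    moreover have "hval q g' \<le> hval q f'" if q: "hprime q" for q
    proof -
      have "hval q t + hval q g = hval q p + hval q g'" "hval q s + hval q f = hval q p + hval q f'"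
        using t s nz p0 less.prems q by (metis hval_mult)+
      then show ?thesis using less.prems(3)[OF q] hval_homogeneous[OF q t(1,2)] hval_homogeneous[OF q s(1,2)] by simp
    qed
    ultimately have "g' hdvd f'" using less.hyps nz by blast
    then have "p * g' hdvd p * f'" by (intro hdvd_mult_mono) simp_all
    moreover have "s * f hdvd f" by (rule homogeneous_mult_hdvd[OF s(1,2)])
    moreover have "g hdvd t * g" by (simp add: dvd_imp_hdvd)
    ultimately show ?thesis unfolding s t using hdvd_trans by metis
  qed
qed

lemma hprime_hdvd_eq:
  assumes "hprime p" "hprime q" "p hdvd q"
  shows "q hdvd p"
  using assms hdvd_width_eq[OF assms(3)] unfolding hprime_def by (metis less_numeral_extra(3))

lemma hval_cong:
  assumes "hprime p" "hprime q" "p hdvd q"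
  shows "hval p = hval q"
proof
  fix f
  have "p ^ a hdvd f \<longleftrightarrow> q ^ a hdvd f" for a
    using hprime_hdvd_eq[OF assms] assms(3) hdvd_power_mono hdvd_trans by metis
  then show "hval p f = hval q f" by (simp add: hval_def)
qed

text \<open>Valuations are counted rather than primes, since every prime has infinitely many
  associates; by \<open>hval_cong\<close> these all give the same function.\<close>

lemma finite_hval:
  assumes "f \<noteq> 0"
  shows "finite {hval p |p. hprime p \<and> p hdvd f}"
  using assms
proof (induction "width f" arbitrary: f rule: less_induct)
  case less
  show ?case
  proof (cases "width f = 0")
    case True
    then have "{hval p |p. hprime p \<and> p hdvd f} = {}"
      using hprime_not_hdvd_homogeneous less.prems homogeneous_iff_width by blast
    then show ?thesis by (simp only: finite.emptyI)
  next
    case False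
    then obtain p where p: "hprime p" "p hdvd f" using exists_hprime_hdvd less.prems by blast
    then have p0: "p \<noteq> 0" "width p > 0" by (auto simp: hprime_def)
    obtain t g where t: "t \<noteq> 0" "homogeneous w t" "t * f = p * g" by (rule hdvdE[OF p(2)])
    have nz: "g \<noteq> 0" using t less.prems laurent_mult_nonzero[of t f] by auto
    have "width t + width f = width p + width g" using t nz p0 less.prems by (metis width_mult)
    then have lt: "width g < width f" using p0 t homogeneous_iff_width[of t] by simp
    have "{hval q |q. hprime q \<and> q hdvd f} \<subseteq> insert (hval p) {hval q |q. hprime q \<and> q hdvd g}"
    proof
      fix v assume "v \<in> {hval q |q. hprime q \<and> q hdvd f}"
      then obtain q where q: "v = hval q" "hprime q" "q hdvd f" by blast
      have "q hdvd p * g" using hdvd_mult[OF q(3), of t] t(3) by (simp add: mult.commute)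
      then have "q hdvd p \<or> q hdvd g" by (rule hprime_dvd_mult[OF q(2)])
      then show "v \<in> insert (hval p) {hval q |q. hprime q \<and> q hdvd g}"
        using q p hval_cong by blast
    qed
    then show ?thesis using less.hyps[OF lt nz] finite_subset by blast
  qed
qed

end

section \<open>Divisibility recovered from the coordinate localizations\<close>

lemma weight_coordinate: "weight (\<lambda>m. m $ i)"
  by standard simp

lemma homogeneous_minus_lform:
  fixes f :: "'m \<Rightarrow>\<^sub>0 'k::ab_group_add"
  assumes "homogeneous v f"
  shows "homogeneous v (f - lform w f)"
  unfolding homogeneous_def
proof (intro ballI)
  fix a b assume "a \<in> Poly_Mapping.keys (f - lform w f)" "b \<in> Poly_Mapping.keys (f - lform w f)"
  then show "v a = v b"
    using keys_minus_lform[of a f w] keys_minus_lform[of b f w] homogeneousD[OF assms, of a b] by blast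
qed

lemma single_dvd:
  fixes f :: "int ^ 'n \<Rightarrow>\<^sub>0 'k::field"
  assumes "c \<noteq> 0"
  shows "Poly_Mapping.single m c dvd f"
proof
  show "f = Poly_Mapping.single m c * (Poly_Mapping.single (- m) (1 / c) * f)"
    using assms by (simp add: mult_single flip: mult.assoc)
qed

text \<open>Cutting off the lowest form of the cofactor in the coordinate \<open>n\<close> reduces the claim for
  \<open>insert n A\<close> to the one for \<open>A\<close>.\<close>

lemma dvd_if_dvd_up_to_homogeneous_aux:
  fixes t q :: "int ^ 'n \<Rightarrow>\<^sub>0 'k::field"
  assumes "finite A" "t \<noteq> 0"
    and "\<And>i. i \<notin> A \<Longrightarrow> homogeneous (\<lambda>m. m $ i) t" "\<And>i. i \<notin> A \<Longrightarrow> homogeneous (\<lambda>m. m $ i) q"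
    and "\<And>i. i \<in> A \<Longrightarrow> \<exists>s. s \<noteq> 0 \<and> (\<forall>j. j \<notin> A \<or> j = i \<longrightarrow> homogeneous (\<lambda>m. m $ j) s) \<and> t dvd s * q"
  shows "t dvd q"
  using assms
proof (induction A arbitrary: t q rule: finite_induct)
  case empty
  have "\<exists>m c. c \<noteq> 0 \<and> t = Poly_Mapping.single m c"
    by (rule coordinate_homogeneous_single[OF empty.prems(2,1)]) simp
  then obtain m c where "c \<noteq> 0" "t = Poly_Mapping.single m c" by blast
  then show ?case using single_dvd by metis
next
  case (insert n A)
  interpret w: weight "\<lambda>m. m $ n" by (rule weight_coordinate)
  let ?hom = "\<lambda>i. homogeneous (\<lambda>m. m $ i) :: (int ^ 'n \<Rightarrow>\<^sub>0 'k) \<Rightarrow> bool"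
  \<comment> \<open>The hypothesis at \<open>i = n\<close>: this multiplier is homogeneous in
    \<open>n\<close> and in all coordinates outside \<open>insert n A\<close>, hence in all outside
    \<open>A\<close>, and so the induction hypothesis can be used for divisibility by
    \<open>s\<close>.\<close>
  obtain s where s: "s \<noteq> 0" "\<And>j. j \<notin> A \<Longrightarrow> ?hom j s" "t dvd s * q"
    using insert.prems(4)[of n] by blast
  obtain q' where q': "s * q = t * q'" using s(3) by (elim dvdE)
  \<comment> \<open>Stated for arbitrary \<open>r\<close>, so that lowest forms can be split off
    from \<open>r\<close> one after another; the intended \<open>r\<close> is the cofactor
    \<open>q'\<close>.\<close>
  have lowest: "s dvd r" if "\<And>j. j \<notin> insert n A \<Longrightarrow> ?hom j r"
    "\<And>i. i \<in> A \<Longrightarrow> \<exists>u. u \<noteq> 0 \<and> (\<forall>j. j \<notin> insert n A \<or> j = i \<longrightarrow> ?hom j u) \<and> s dvd u * r" for r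
    using that
  proof (induction "card (Poly_Mapping.keys r)" arbitrary: r rule: less_induct)
    case less
    show ?case
    proof (cases "r = 0")
      case False
      define l where "l = lform (\<lambda>m. m $ n) r"
      have l0: "l \<noteq> 0" using False by (simp add: l_def lform_nonzero)
      have "s dvd l"
      proof (rule insert.IH[OF s(1,2)])
        fix j assume "j \<notin> A"
        then show "?hom j l"
          using less.prems(1)[of j] homogeneous_lform homogeneous_lform_other unfolding l_def by blast
      next
        fix i assume "i \<in> A"
        then obtain u where u: "u \<noteq> 0" "\<And>j. j \<notin> insert n A \<or> j = i \<Longrightarrow> ?hom j u" "s dvd u * r"
          using less.prems(2) by blast
        obtain x where x: "u * r = s * x" using u(3) by (elim dvdE)
        \<comment> \<open>Lowest forms along \<open>n\<close> are taken on both sides of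
          \<open>u * r = s * x\<close>; \<open>s\<close> is its own lowest form.\<close>
        have "lform (\<lambda>m. m $ n) u * l = lform (\<lambda>m. m $ n) (u * r)"
          by (simp only: w.lform_mult l_def)
        also have "\<dots> = s * lform (\<lambda>m. m $ n) x"
          unfolding x w.lform_mult using lform_homogeneous[OF s(2)[OF insert.hyps(2)]] by simp
        finally have "s dvd lform (\<lambda>m. m $ n) u * l" by simp
        moreover have "?hom j (lform (\<lambda>m. m $ n) u)" if j: "j \<notin> A \<or> j = i" for j
        proof (cases "j = n")
          case True
          then show ?thesis by (simp only: homogeneous_lform)
        next
          case False
          then have "?hom j u" using j u(2) by blast
          then show ?thesis by (rule homogeneous_lform_other)
        qed
        ultimately show "\<exists>u. u \<noteq> 0 \<and> (\<forall>j. j \<notin> A \<or> j = i \<longrightarrow> ?hom j u) \<and> s dvd u * l"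
          using lform_nonzero[OF u(1)] by blast
      qed
      moreover have "s dvd r - l"
      proof (rule less.hyps)
        show "card (Poly_Mapping.keys (r - l)) < card (Poly_Mapping.keys r)"
        proof (rule psubset_card_mono)
          obtain m where m: "m \<in> Poly_Mapping.keys l" using keys_nonempty[OF l0] by blast
          then have m': "m \<in> Poly_Mapping.keys r" "m $ n = wmin (\<lambda>m. m $ n) r"
            by (simp_all add: l_def keys_lform)
          have "m \<notin> Poly_Mapping.keys (r - l)"
          proof
            assume "m \<in> Poly_Mapping.keys (r - l)"
            then have "wmin (\<lambda>m. m $ n) r < m $ n" unfolding l_def by (rule keys_minus_lform[THEN conjunct2])
            then show False using m'(2) by linarith
          qed
          moreover have "Poly_Mapping.keys (r - l) \<subseteq> Poly_Mapping.keys r"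
            unfolding l_def by (rule subsetI, drule keys_minus_lform, erule conjunct1)
          ultimately show "Poly_Mapping.keys (r - l) \<subset> Poly_Mapping.keys r" using m'(1) by blast
        qed simp
        show "?hom j (r - l)" if "j \<notin> insert n A" for j
          using less.prems(1)[OF that] homogeneous_minus_lform unfolding l_def by blast
        show "\<exists>u. u \<noteq> 0 \<and> (\<forall>j. j \<notin> insert n A \<or> j = i \<longrightarrow> ?hom j u) \<and> s dvd u * (r - l)"
          if "i \<in> A" for i
          using less.prems(2)[OF that] \<open>s dvd l\<close> by (metis dvd_diff dvd_mult right_diff_distrib)
      qed
      ultimately have "s dvd (r - l) + l" by (intro dvd_add)
      then show ?thesis by simp
    qed simp
  qed
  have "s dvd q'"
  proof (cases "q' = 0")
    case False
    then have q0: "q \<noteq> 0" using q' insert.prems(1) laurent_mult_nonzero[of t q'] by auto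
    show ?thesis
    proof (rule lowest)
      fix j assume j: "j \<notin> insert n A"
      interpret v: weight "\<lambda>m. m $ j" by (rule weight_coordinate)
      have "?hom j (s * q)" using j s insert.prems(3) q0 by (simp add: v.homogeneous_mult_iff)
      then show "?hom j q'" using False insert.prems(1) unfolding q' by (simp add: v.homogeneous_mult_iff)
    next
      fix i assume i: "i \<in> A"
      obtain u where u: "u \<noteq> 0" "\<forall>j. j \<notin> insert n A \<or> j = i \<longrightarrow> ?hom j u" "t dvd u * q"
        using insert.prems(4)[of i] i by blast
      obtain x where x: "u * q = t * x" using u(3) by (elim dvdE)
      \<comment> \<open>Since \<open>s * q = t * q'\<close>, the divisibility
        \<open>t dvd u * q\<close> turns into \<open>s dvd u * q'\<close>, which is what
        \<open>lowest\<close> asks for.\<close>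
      have "t * (u * q') = u * (s * q)" unfolding q' by (simp add: mult_ac)
      also have "\<dots> = s * (u * q)" by (simp add: mult_ac)
      also have "\<dots> = t * (s * x)" unfolding x by (simp add: mult_ac)
      finally have "u * q' = s * x" using laurent_mult_left_cancel insert.prems(1) by blast
      then show "\<exists>u. u \<noteq> 0 \<and> (\<forall>j. j \<notin> insert n A \<or> j = i \<longrightarrow> ?hom j u) \<and> s dvd u * q'"
        using u by (metis dvd_triv_left)
    qed
  qed simp
  then obtain x where "q' = s * x" by (elim dvdE)
  then have "s * q = s * (t * x)" unfolding q' by (simp add: mult_ac)
  then have "q = t * x" using laurent_mult_left_cancel s(1) by blast
  then show ?case by simp
qed

text \<open>Takes the place of unique factorization of Laurent polynomials. For
  \<open>A = UNIV\<close> the homogeneity conditions outside \<open>A\<close> are void.\<close>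

lemma dvd_if_dvd_up_to_homogeneous:
  fixes f g :: "int ^ 'n \<Rightarrow>\<^sub>0 'k::field"
  assumes "g \<noteq> 0" "\<And>i. \<exists>t. t \<noteq> 0 \<and> homogeneous (\<lambda>m. m $ i) t \<and> g dvd t * f"
  shows "g dvd f"
  by (rule dvd_if_dvd_up_to_homogeneous_aux[of UNIV]) (use assms in auto)

section \<open>Essential valuations and Krull domains\<close>

context cring
begin

lemma ideal_power_0: "ideal_power R I 0 = carrier R"
  by (simp add: nat_pow_def ideals_set_def)

lemma ideal_power_Suc: "ideal_power R I (Suc a) = ideal_power R I a \<cdot> I"
  by (simp add: nat_pow_def ideals_set_def)

lemma ideal_ideal_power: "ideal I R \<Longrightarrow> ideal (ideal_power R I a) R"
  by (induction a) (simp_all only: ideal_power_0 ideal_power_Suc oneideal ideal_prod_is_ideal)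

lemma pow_in_ideal_power:
  assumes "ideal I R" "x \<in> I"
  shows "x [^] a \<in> ideal_power R I a"
proof (induction a)
  case 0
  show ?case unfolding ideal_power_0 by simp
next
  case (Suc a)
  then show ?case unfolding ideal_power_Suc nat_pow_Suc using assms(2) by (intro ideal_prod.prod)
qed

lemma ideal_power_antimono:
  assumes "ideal I R" "a \<le> b"
  shows "ideal_power R I b \<subseteq> ideal_power R I a"
  using assms(2)
proof (induction rule: dec_induct)
  case (step n)
  have "ideal_power R I n \<cdot> I \<subseteq> ideal_power R I n"
    using ideal_prod_inter[OF ideal_ideal_power[OF assms(1)] assms(1)] by blast
  with step.IH show ?case unfolding ideal_power_Suc by blast
qed simp

lemma ideal_power_mult:
  assumes "ideal I R" "x \<in> ideal_power R I a" "y \<in> ideal_power R I b"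
  shows "x \<otimes> y \<in> ideal_power R I (a + b)"
proof -
  interpret ideals: Group.comm_monoid "ideals_set R" by (rule ideals_set_is_comm_monoid)
  have "I \<in> carrier (ideals_set R)" using assms(1) by (simp add: ideals_set_def)
  then have "ideal_power R I (a + b) = ideal_power R I a \<cdot> ideal_power R I b"
    by (simp add: ideals.nat_pow_mult[symmetric]) (simp add: ideals_set_def)
  then show ?thesis using assms by (auto intro: ideal_prod.prod)
qed

end

section \<open>Chains of primes and height one\<close>

lemma one_le_height:
  assumes "primeideal P R" "primeideal Q R" "Q \<subset> P"
  shows "1 \<le> height R P"
  unfolding height_def one_enat_def
proof (rule Sup_upper, rule CollectI, intro exI[of _ "1::nat"] exI[of _ "\<lambda>i. if i = 0 then Q else P"] conjI)
qed (use assms in auto)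

lemma two_le_height:
  assumes "primeideal P R" "primeideal Q R" "Q \<subset> P" "primeideal Q' R" "Q' \<subset> Q"
  shows "2 \<le> height R P"
proof -
  have "enat 2 \<le> height R P"
    unfolding height_def
  proof (rule Sup_upper, rule CollectI, intro exI[of _ "2::nat"]
      exI[of _ "\<lambda>i::nat. if i = 0 then Q' else if i = 1 then Q else P"] conjI allI impI)
    fix i :: nat assume "i < 2"
    then have "i = 0 \<or> i = 1" by auto
    then show "(if i = 0 then Q' else if i = 1 then Q else P)
      \<subset> (if Suc i = 0 then Q' else if Suc i = 1 then Q else P)" using assms by auto
  qed (use assms in auto)
  then show ?thesis by (simp add: numeral_eq_enat)
qed

context "domain"
begin

lemma zero_subset_primeideal: "primeideal P R \<Longrightarrow> P \<noteq> {\<zero>} \<Longrightarrow> {\<zero>} \<subset> P"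
  using additive_subgroup.zero_closed[of P R] by (auto simp: primeideal_def ideal_def)

lemma height_one_minimal:
  assumes "height R P = 1" "primeideal P R" "primeideal Q R" "Q \<subseteq> P" "Q \<noteq> {\<zero>}"
  shows "Q = P"
proof (rule ccontr)
  assume "Q \<noteq> P"
  then have "2 \<le> height R P"
    using assms zeroprimeideal zero_subset_primeideal by (intro two_le_height[of P R Q "{\<zero>}"]) auto
  then show False using assms(1) by simp
qed

lemma height_one_nonzero:
  assumes "height R P = 1" "primeideal P R"
  shows "P \<noteq> {\<zero>}"
proof
  assume P: "P = {\<zero>}"
  have "height R P \<le> 0"
    unfolding height_def
  proof (rule Sup_least, clarify)
    fix k Q assume Q: "\<forall>i\<le>k. primeideal (Q i) R" "\<forall>i<k. Q i \<subset> Q (Suc i)" "P = Q k"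
    have "k = 0"
    proof (rule ccontr)
      assume "k \<noteq> 0"
      then obtain j where j: "k = Suc j" using not0_implies_Suc by blast
      then have "Q j \<subset> {\<zero>}" "primeideal (Q j) R" using Q P by auto
      then show False using zero_subset_primeideal[of "Q j"] by blast
    qed
    then show "enat k \<le> 0" by (simp add: zero_enat_def)
  qed
  then show False using assms by simp
qed

lemma height_oneI:
  assumes "primeideal P R" "P \<noteq> {\<zero>}" "\<And>Q. primeideal Q R \<Longrightarrow> Q \<subseteq> P \<Longrightarrow> Q \<noteq> {\<zero>} \<Longrightarrow> Q = P"
  shows "height R P = 1"
proof (rule antisym)
  show "1 \<le> height R P"
    using one_le_height[OF assms(1) zeroprimeideal] zero_subset_primeideal assms by blast
  show "height R P \<le> 1"
    unfolding height_def
  proof (rule Sup_least, clarify)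
    fix k Q assume Q: "\<forall>i\<le>k. primeideal (Q i) R" "\<forall>i<k. Q i \<subset> Q (Suc i)" "P = Q k"
    have "k \<le> 1"
    proof (rule ccontr)
      assume "\<not> k \<le> 1"
      then obtain j where j: "k = Suc (Suc j)" by (metis One_nat_def not_less_eq_eq not0_implies_Suc le0)
      then have pr: "primeideal (Q j) R" "primeideal (Q (Suc j)) R" "Q j \<subset> Q (Suc j)" "Q (Suc j) \<subset> P"
        using Q by auto
      then have "\<zero> \<in> Q j" using additive_subgroup.zero_closed[of "Q j" R] by (auto simp: primeideal_def ideal_def)
      then have "Q (Suc j) \<noteq> {\<zero>}" using pr(3) by auto
      then show False using assms(3)[OF pr(2)] pr(4) by blast
    qed
    then show "enat k \<le> 1" by (simp add: one_enat_def)
  qed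
qed

end

text \<open>Values are natural numbers, so the infinite value of zero is adjoined by hand.\<close>

definition valuation_ideal :: "('a, 'b) ring_scheme \<Rightarrow> ('a \<Rightarrow> nat) \<Rightarrow> nat \<Rightarrow> 'a set" where
  "valuation_ideal R v a = {f \<in> carrier R. f = \<zero>\<^bsub>R\<^esub> \<or> a \<le> v f}"

text \<open>The last axiom says that \<open>v\<close> becomes a discrete valuation with valuation ring the localization
  of \<open>R\<close> at the prime ideal of elements of positive value; the ultrametric inequality follows.\<close>

locale essential_valuation = "domain" +
  fixes v :: "'a \<Rightarrow> nat"
  assumes val_mult: "\<lbrakk>f \<in> carrier R; f \<noteq> \<zero>; g \<in> carrier R; g \<noteq> \<zero>\<rbrakk> \<Longrightarrow> v (f \<otimes> g) = v f + v g"
    and uniformizer: "\<exists>p\<in>carrier R. p \<noteq> \<zero> \<and> v p = 1"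
    and local_dvd: "\<lbrakk>f \<in> carrier R; f \<noteq> \<zero>; g \<in> carrier R; g \<noteq> \<zero>; v g \<le> v f\<rbrakk> \<Longrightarrow>
      \<exists>u\<in>carrier R. \<exists>z\<in>carrier R. u \<noteq> \<zero> \<and> v u = 0 \<and> u \<otimes> f = g \<otimes> z"
begin

abbreviation center :: "'a set" where "center \<equiv> valuation_ideal R v (Suc 0)"

lemma val_one [simp]: "v \<one> = 0"
  using val_mult[of \<one> \<one>] by simp

lemma pow_nonzero: "f \<in> carrier R \<Longrightarrow> f \<noteq> \<zero> \<Longrightarrow> f [^] (a::nat) \<noteq> \<zero>"
  by (induction a) (auto simp: integral_iff)

lemma val_pow: "f \<in> carrier R \<Longrightarrow> f \<noteq> \<zero> \<Longrightarrow> v (f [^] (a::nat)) = a * v f"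
  by (induction a) (simp_all add: val_mult pow_nonzero)

text \<open>From \<open>u \<otimes> f = g \<otimes> z\<close> follows
  \<open>u \<otimes> (f \<oplus> g) = g \<otimes> (z \<oplus> u)\<close>, and \<open>u\<close> has
  value 0.\<close>

lemma val_add_aux:
  assumes f: "f \<in> carrier R" "f \<noteq> \<zero>" and g: "g \<in> carrier R" "g \<noteq> \<zero>" and "f \<oplus> g \<noteq> \<zero>" "v g \<le> v f"
  shows "v g \<le> v (f \<oplus> g)"
proof -
  obtain u z where u: "u \<in> carrier R" "z \<in> carrier R" "u \<noteq> \<zero>" "v u = 0" "u \<otimes> f = g \<otimes> z"
    using local_dvd[OF f g assms(6)] by blast
  have eq: "u \<otimes> (f \<oplus> g) = g \<otimes> (z \<oplus> u)"
    using u f g by (simp add: r_distr m_comm)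
  have "u \<otimes> (f \<oplus> g) \<noteq> \<zero>" using u f g assms by (simp add: integral_iff)
  then have "z \<oplus> u \<noteq> \<zero>" using eq u g by auto
  then have "v u + v (f \<oplus> g) = v g + v (z \<oplus> u)"
    using eq val_mult[of u "f \<oplus> g"] val_mult[of g "z \<oplus> u"] u f g assms by simp
  then show ?thesis using u by simp
qed

lemma val_add:
  assumes "f \<in> carrier R" "f \<noteq> \<zero>" "g \<in> carrier R" "g \<noteq> \<zero>" "f \<oplus> g \<noteq> \<zero>" "c \<le> v f" "c \<le> v g"
  shows "c \<le> v (f \<oplus> g)"
  using val_add_aux[of f g] val_add_aux[of g f] assms by (metis a_comm le_trans nat_le_linear)

lemma ideal_valuation_ideal: "ideal (valuation_ideal R v a) R"
proof (rule idealI[OF ring_axioms])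
  show "subgroup (valuation_ideal R v a) (add_monoid R)"
  proof (rule add.subgroupI)
    fix x assume x: "x \<in> valuation_ideal R v a"
    then have xc: "x \<in> carrier R" by (simp add: valuation_ideal_def)
    show "\<ominus> x \<in> valuation_ideal R v a"
    proof (cases "x = \<zero>")
      case False
      \<comment> \<open>Negation is multiplication by -1; as values are nonnegative, it cannot lower
        them.\<close>
      have "\<ominus> \<one> \<noteq> \<zero>" using minus_minus[of \<one>] by (metis minus_zero one_closed one_not_zero)
      then have "v x \<le> v (\<ominus> \<one> \<otimes> x)" using val_mult[of "\<ominus> \<one>" x] False xc by simp
      moreover have "\<ominus> \<one> \<otimes> x = \<ominus> x" using xc by (simp add: l_minus)
      ultimately show ?thesis using x xc False by (auto simp: valuation_ideal_def)
    qed (use x in \<open>simp add: valuation_ideal_def\<close>)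
  next
    fix x y assume "x \<in> valuation_ideal R v a" "y \<in> valuation_ideal R v a"
    then show "x \<oplus>\<^bsub>R\<^esub> y \<in> valuation_ideal R v a"
      using val_add[of x y a] by (cases "x = \<zero>"; cases "y = \<zero>") (auto simp: valuation_ideal_def)
  qed (auto simp: valuation_ideal_def)
next
  fix b x assume b: "b \<in> valuation_ideal R v a" "x \<in> carrier R"
  then have bc: "b \<in> carrier R" by (simp add: valuation_ideal_def)
  show xb: "x \<otimes> b \<in> valuation_ideal R v a"
    using b val_mult[of x b] by (cases "x = \<zero>"; cases "b = \<zero>") (auto simp: valuation_ideal_def)
  show "b \<otimes> x \<in> valuation_ideal R v a" using xb m_comm[OF b(2) bc] by simp
qed

lemma not_center: "f \<in> carrier R \<Longrightarrow> f \<notin> center \<longleftrightarrow> f \<noteq> \<zero> \<and> v f = 0"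
  by (auto simp: valuation_ideal_def)

lemma primeideal_center: "primeideal center R"
proof (rule primeidealI[OF ideal_valuation_ideal is_cring])
  have "\<one> \<notin> center" using not_center[of \<one>] by simp
  then show "carrier R \<noteq> center" by blast
next
  fix a b assume "a \<in> carrier R" "b \<in> carrier R" "a \<otimes> b \<in> center"
  then show "a \<in> center \<or> b \<in> center"
    using val_mult[of a b] not_center[of "a \<otimes> b"] not_center[of a] not_center[of b] integral_iff[of a b]
    by auto
qed

lemma ideal_power_center_subset: "ideal_power R center a \<subseteq> valuation_ideal R v a"
proof (induction a)
  case 0
  show ?case unfolding ideal_power_0 by (auto simp: valuation_ideal_def)
next
  case (Suc a)
  show ?case
  proof
    fix x assume "x \<in> ideal_power R center (Suc a)"
    then have "x \<in> ideal_power R center a \<cdot> center" by (simp only: ideal_power_Suc)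
    then show "x \<in> valuation_ideal R v (Suc a)"
    proof (induction x rule: ideal_prod.induct)
      case (prod i j)
      then have "i \<in> valuation_ideal R v a" using Suc by blast
      then show ?case using prod(2) val_mult[of i j]
        by (cases "i = \<zero>"; cases "j = \<zero>") (auto simp: valuation_ideal_def)
    next
      case (sum s1 s2)
      then show ?case
        using ideal_valuation_ideal[of "Suc a"] additive_subgroup.a_closed by (metis ideal.axioms(1))
    qed
  qed
qed

text \<open>An element of value at least \<open>a\<close> is compared with \<open>p [^] a\<close>
  for a uniformizer \<open>p\<close>: some multiple of it by an element outside the center is
  divisible by that power. Conversely, multipliers outside the center do not change values.\<close>

lemma symbolic_power_center: "symbolic_power R center a = valuation_ideal R v a"
proof (intro equalityI subsetI)
  fix f assume "f \<in> symbolic_power R center a"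
  then obtain u where f: "f \<in> carrier R" and u: "u \<in> carrier R" "u \<notin> center" "u \<otimes> f \<in> ideal_power R center a"
    by (auto simp: symbolic_power_def)
  then have "u \<otimes> f \<in> valuation_ideal R v a" using ideal_power_center_subset by blast
  then show "f \<in> valuation_ideal R v a"
    using u(1,2) f val_mult[of u f] not_center[of u] by (cases "f = \<zero>") (auto simp: valuation_ideal_def integral_iff)
next
  fix f assume f: "f \<in> valuation_ideal R v a"
  then have fc: "f \<in> carrier R" by (simp add: valuation_ideal_def)
  interpret power_ideal: ideal "ideal_power R center a" R
    by (rule ideal_ideal_power[OF ideal_valuation_ideal])
  have one: "\<one> \<in> carrier R - center" using not_center[of \<one>] by simp
  show "f \<in> symbolic_power R center a"
  proof (cases "f = \<zero>")
    case True
    then have "\<one> \<otimes> f \<in> ideal_power R center a" using power_ideal.zero_closed by (simp only: l_one zero_closed)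
    then show ?thesis using one fc unfolding symbolic_power_def by blast
  next
    case False
    obtain p where p: "p \<in> carrier R" "p \<noteq> \<zero>" "v p = 1" using uniformizer by blast
    have "v (p [^] a) \<le> v f" using f False p by (simp add: valuation_ideal_def val_pow)
    then obtain u z where u: "u \<in> carrier R" "z \<in> carrier R" "u \<noteq> \<zero>" "v u = 0" "u \<otimes> f = p [^] a \<otimes> z"
      using local_dvd[of f "p [^] a"] fc False p pow_nonzero by auto
    have "p \<in> center" using p by (simp add: valuation_ideal_def)
    then have "u \<otimes> f \<in> ideal_power R center a"
      unfolding u(5) by (intro power_ideal.I_r_closed pow_in_ideal_power ideal_valuation_ideal u(2))
    moreover have "u \<in> carrier R - center" using u not_center by simp
    ultimately show ?thesis using fc unfolding symbolic_power_def by blast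
  qed
qed

lemma valuation_at_center:
  assumes "f \<in> carrier R" "f \<noteq> \<zero>"
  shows "valuation_at R center f = v f"
  unfolding valuation_at_def symbolic_power_center
  by (rule Greatest_equality) (use assms in \<open>auto simp: valuation_ideal_def\<close>)

text \<open>A nonzero prime \<open>Q\<close> inside the center contains some
  \<open>f \<noteq> \<zero>\<close>, which locally divides a power of the uniformizer
  \<open>p\<close>; so \<open>p\<close> lies in \<open>Q\<close>, and \<open>p\<close> locally
  divides everything of positive value. The multipliers have value 0 and hence stay outside
  \<open>Q\<close>.\<close>

lemma height_center: "height R center = 1"
proof (rule height_oneI[OF primeideal_center])
  obtain p where p: "p \<in> carrier R" "p \<noteq> \<zero>" "v p = 1" using uniformizer by blast
  then have pc: "p \<in> center" by (simp add: valuation_ideal_def)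
  then show "center \<noteq> {\<zero>}" using p(2) by blast
  fix Q assume Q: "primeideal Q R" "Q \<subseteq> center" "Q \<noteq> {\<zero>}"
  interpret Q: primeideal Q R by fact
  obtain f where f: "f \<in> Q" "f \<noteq> \<zero>" using zero_subset_primeideal[OF Q(1,3)] by blast
  have fc: "f \<in> carrier R" using f by (rule_tac Q.Icarr)
  have cancel: "x \<in> Q" if u: "u \<in> carrier R" "u \<noteq> \<zero>" "v u = 0" "u \<otimes> x \<in> Q" "x \<in> carrier R" for u x
    using Q.I_prime[OF u(1,5,4)] not_center[OF u(1)] Q(2) u by blast
  have pow: "p \<in> Q" if "p [^] a \<in> Q" for a :: nat
    using that
  proof (induction a)
    case 0
    then have "\<one> \<in> center" using Q(2) by auto
    then show ?case using not_center[of \<one>] by simp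
  next
    case (Suc a)
    then show ?case using Q.I_prime[of "p [^] a" p] p by auto
  qed
  obtain u z where u: "u \<in> carrier R" "z \<in> carrier R" "u \<noteq> \<zero>" "v u = 0" "u \<otimes> p [^] v f = f \<otimes> z"
    using local_dvd[of "p [^] v f" f] fc f p pow_nonzero by (auto simp: val_pow)
  have "u \<otimes> p [^] v f \<in> Q" unfolding u(5) using f(1) u(2) by (rule Q.I_r_closed)
  then have "p [^] v f \<in> Q" using cancel[OF u(1,3,4)] p by simp
  then have pQ: "p \<in> Q" by (rule pow)
  have "center \<subseteq> Q"
  proof
    fix y assume y: "y \<in> center"
    then have yc: "y \<in> carrier R" by (simp add: valuation_ideal_def)
    show "y \<in> Q"
    proof (cases "y = \<zero>")
      case False
      then have "v p \<le> v y" using y p by (simp add: valuation_ideal_def)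
      then obtain u z where u: "u \<in> carrier R" "z \<in> carrier R" "u \<noteq> \<zero>" "v u = 0" "u \<otimes> y = p \<otimes> z"
        using local_dvd[of y p] yc False p by auto
      have "u \<otimes> y \<in> Q" unfolding u(5) using pQ u(2) by (rule Q.I_r_closed)
      then show ?thesis using cancel[OF u(1,3,4)] yc by simp
    qed (simp add: Q.zero_closed)
  qed
  with Q(2) show "Q = center" by blast
qed

end

text \<open>The intersection of the valuation rings is expressed as a divisibility criterion inside
  \<open>R\<close>, without a fraction field. Different members of \<open>V\<close> may share a
  center; they then agree on the nonzero elements of \<open>R\<close>.\<close>

locale krull_domain = "domain" +
  fixes V :: "('a \<Rightarrow> nat) set"
  assumes valuations: "v \<in> V \<Longrightarrow> essential_valuation R v"
    and dvd_if_val_le: "\<lbrakk>f \<in> carrier R; f \<noteq> \<zero>; g \<in> carrier R; g \<noteq> \<zero>; \<And>v. v \<in> V \<Longrightarrow> v g \<le> v f\<rbrakk> \<Longrightarrow>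
      \<exists>z\<in>carrier R. f = g \<otimes> z"
    and finite_support: "\<lbrakk>f \<in> carrier R; f \<noteq> \<zero>\<rbrakk> \<Longrightarrow> finite {v \<in> V. 0 < v f}"
begin

text \<open>Suppose that no center lies in \<open>P\<close>, and let \<open>f\<close> be a nonzero
  element of \<open>P\<close>. Each of the finitely many valuations positive on \<open>f\<close> has
  an element of its center outside \<open>P\<close>. A product of powers of these stays outside
  \<open>P\<close> but dominates \<open>f\<close> in every valuation, so it is a multiple of
  \<open>f\<close>, a contradiction.\<close>

lemma height_one_primes_eq: "height_one_primes R = (\<lambda>v. valuation_ideal R v (Suc 0)) ` V"
proof (intro equalityI subsetI)
  fix P assume "P \<in> (\<lambda>v. valuation_ideal R v (Suc 0)) ` V"
  then obtain v where v: "v \<in> V" "P = valuation_ideal R v (Suc 0)" by blast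
  interpret v: essential_valuation R v by (rule valuations[OF v(1)])
  show "P \<in> height_one_primes R"
    unfolding v(2) height_one_primes_def using v.primeideal_center v.height_center by blast
next
  fix P assume "P \<in> height_one_primes R"
  then have P: "primeideal P R" "height R P = 1" by (auto simp: height_one_primes_def)
  interpret P: primeideal P R by fact
  obtain f where f: "f \<in> P" "f \<noteq> \<zero>"
    using zero_subset_primeideal[OF P(1) height_one_nonzero[OF P(2,1)]] by blast
  have fc: "f \<in> carrier R" using f by (rule_tac P.Icarr)
  have "\<exists>v\<in>V. valuation_ideal R v (Suc 0) \<subseteq> P"
  proof (rule ccontr)
    assume none: "\<not> ?thesis"
    have prod: "\<exists>y\<in>carrier R. y \<notin> P \<and> (\<forall>v\<in>W. v f \<le> v y)" if "finite W" "W \<subseteq> V" for W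
      using that
    proof (induction W rule: finite_induct)
      case empty
      have "\<one> \<notin> P"
        using P.I_notcarr P.one_imp_carrier by blast
      then show ?case by blast
    next
      case (insert v W)
      then obtain y where y: "y \<in> carrier R" "y \<notin> P" "\<forall>v\<in>W. v f \<le> v y" by blast
      interpret v: essential_valuation R v using insert.prems valuations by blast
      obtain x where x: "x \<in> valuation_ideal R v (Suc 0)" "x \<notin> P" using none insert.prems by blast
      have xc: "x \<in> carrier R" using x by (simp add: valuation_ideal_def)
      have nz: "z \<noteq> \<zero>" if "z \<notin> P" for z using that P.zero_closed by blast
      have vx: "1 \<le> v x" using x nz by (auto simp: valuation_ideal_def)
      have xa: "x [^] a \<notin> P" for a :: nat
      proof (induction a)
        case 0
        show ?case using P.I_notcarr P.one_imp_carrier by auto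
      next
        case (Suc a)
        then show ?case using P.I_prime[of "x [^] a" x] x xc by auto
      qed
      \<comment> \<open>The exponent \<open>v f\<close> is large enough because
        \<open>1 \<le> v x\<close>; the values already reached by \<open>y\<close> can only
        grow.\<close>
      have "x [^] v f \<otimes> y \<notin> P" using P.I_prime[of "x [^] v f" y] xa xc y by auto
      moreover have "v' f \<le> v' (x [^] v f \<otimes> y)" if "v' \<in> insert v W" for v'
      proof -
        interpret v': essential_valuation R v' using insert.prems that valuations by blast
        have eq: "v' (x [^] v f \<otimes> y) = v f * v' x + v' y"
          using v'.val_mult[of "x [^] v f" y] v'.val_pow[of x "v f"] nz xa x xc y by simp
        show ?thesis
        proof (cases "v' = v")
          case True
          have "v f * 1 \<le> v f * v x" using vx by (intro mult_le_mono2)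
          then show ?thesis unfolding eq unfolding True by linarith
        next
          case False
          then show ?thesis unfolding eq using that y(3) by (auto intro: trans_le_add2)
        qed
      qed
      ultimately show ?case using xc y by (intro bexI[of _ "x [^] v f \<otimes> y"]) auto
    qed
    obtain y where y: "y \<in> carrier R" "y \<notin> P" "\<forall>v\<in>{v \<in> V. 0 < v f}. v f \<le> v y"
      using prod[OF finite_support[OF fc f(2)]] by blast
    have "y \<noteq> \<zero>" using y P.zero_closed by blast
    moreover have "v f \<le> v y" if "v \<in> V" for v using y(3) that by (cases "v f = 0") auto
    ultimately obtain z where "z \<in> carrier R" "y = f \<otimes> z"
      using dvd_if_val_le[OF y(1) _ fc f(2)] by blast
    then have "y \<in> P" using P.I_r_closed f(1) by blast
    with y(2) show False by blast
  qed
  then obtain v where v: "v \<in> V" "valuation_ideal R v (Suc 0) \<subseteq> P" by blast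
  interpret v: essential_valuation R v by (rule valuations[OF v(1)])
  have "valuation_ideal R v (Suc 0) = P"
    by (rule height_one_minimal[OF P(2,1) v.primeideal_center v(2) height_one_nonzero])
      (use v.primeideal_center v.height_center in auto)
  then show "P \<in> (\<lambda>v. valuation_ideal R v (Suc 0)) ` V" using v(1) by blast
qed

lemma valuation_at_mult:
  assumes "P \<in> height_one_primes R" "f \<in> carrier R" "f \<noteq> \<zero>" "g \<in> carrier R" "g \<noteq> \<zero>"
  shows "valuation_at R P (f \<otimes> g) = valuation_at R P f + valuation_at R P g"
proof -
  obtain v where v: "v \<in> V" "P = valuation_ideal R v (Suc 0)" using assms(1) height_one_primes_eq by auto
  interpret v: essential_valuation R v by (rule valuations[OF v(1)])
  show ?thesis unfolding v(2) using assms by (simp add: v.valuation_at_center v.val_mult integral_iff)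
qed

lemma subgroup_principal_divisors:
  "subgroup (principal_divisors R) (free_Abelian_group (height_one_primes R))"
proof (rule group.subgroupI[OF group_free_Abelian_group])
  show "principal_divisors R \<subseteq> carrier (free_Abelian_group (height_one_primes R))"
    unfolding principal_divisors_def by blast
  have "0 \<in> principal_divisors R"
    unfolding principal_divisors_def by (auto intro!: bexI[of _ \<one>])
  then show "principal_divisors R \<noteq> {}" by blast
next
  fix D assume "D \<in> principal_divisors R"
  then obtain f g where D: "Poly_Mapping.keys D \<subseteq> height_one_primes R"
    and fg: "f \<in> carrier R - {\<zero>}" "g \<in> carrier R - {\<zero>}" "\<forall>P \<in> height_one_primes R.
      Poly_Mapping.lookup D P = int (valuation_at R P f) - int (valuation_at R P g)"
    unfolding principal_divisors_def by auto
  have "- D \<in> carrier (free_Abelian_group (height_one_primes R))" using D by simp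
  moreover have "\<forall>P \<in> height_one_primes R.
      Poly_Mapping.lookup (- D) P = int (valuation_at R P g) - int (valuation_at R P f)"
    using fg by simp
  ultimately have "- D \<in> principal_divisors R"
    unfolding principal_divisors_def using fg by blast
  then show "inv\<^bsub>free_Abelian_group (height_one_primes R)\<^esub> D \<in> principal_divisors R"
    using D by simp
next
  fix D E assume "D \<in> principal_divisors R"
  then obtain f g where D: "Poly_Mapping.keys D \<subseteq> height_one_primes R"
    and fg: "f \<in> carrier R - {\<zero>}" "g \<in> carrier R - {\<zero>}" "\<forall>P \<in> height_one_primes R.
      Poly_Mapping.lookup D P = int (valuation_at R P f) - int (valuation_at R P g)"
    unfolding principal_divisors_def by auto
  assume "E \<in> principal_divisors R"
  then obtain f' g' where E: "Poly_Mapping.keys E \<subseteq> height_one_primes R"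
    and fg': "f' \<in> carrier R - {\<zero>}" "g' \<in> carrier R - {\<zero>}" "\<forall>P \<in> height_one_primes R.
      Poly_Mapping.lookup E P = int (valuation_at R P f') - int (valuation_at R P g')"
    unfolding principal_divisors_def by auto
  have "Poly_Mapping.keys (D + E) \<subseteq> height_one_primes R"
    using keys_add[of D E] D E by blast
  moreover have "f \<otimes> f' \<in> carrier R - {\<zero>}" "g \<otimes> g' \<in> carrier R - {\<zero>}"
    using fg fg' by (auto simp: integral_iff)
  moreover have "Poly_Mapping.lookup (D + E) P = int (valuation_at R P (f \<otimes> f')) - int (valuation_at R P (g \<otimes> g'))"
    if "P \<in> height_one_primes R" for P
    using that fg fg' by (simp add: lookup_add valuation_at_mult)
  ultimately have "D + E \<in> principal_divisors R"
    unfolding principal_divisors_def by auto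
  then show "D \<otimes>\<^bsub>free_Abelian_group (height_one_primes R)\<^esub> E \<in> principal_divisors R"
    by simp
qed

text \<open>Lagrange's theorem in the class group, applied to the coset of \<open>P\<close>.\<close>

lemma card_class_group_multiple_principal:
  assumes P: "P \<in> height_one_primes R"
  shows "frag_cmul (int (card (carrier (class_group R)))) (frag_of P) \<in> principal_divisors R"
proof -
  let ?F = "free_Abelian_group (height_one_primes R)" and ?D = "principal_divisors R"
  interpret F: comm_group ?F by (rule abelian_free_Abelian_group)
  have normal: "?D \<lhd> ?F" by (rule F.subgroup_imp_normal[OF subgroup_principal_divisors])
  interpret N: normal ?D ?F by (rule normal)
  interpret Cl: group "class_group R" unfolding class_group_def by (rule N.factorgroup_is_group)
  let ?x = "frag_of P"
  have x: "?x \<in> carrier ?F" using P by simp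
  have pow: "(?D #>\<^bsub>?F\<^esub> ?x) [^]\<^bsub>class_group R\<^esub> n = ?D #>\<^bsub>?F\<^esub> (?x [^]\<^bsub>?F\<^esub> n)" for n :: nat
  proof (induction n)
    case 0
    show ?case
      using F.coset_join2[OF F.one_closed subgroup_principal_divisors] N.one_closed
      by (simp add: class_group_def nat_pow_def)
  next
    case (Suc n)
    have "(?D #>\<^bsub>?F\<^esub> ?x) [^]\<^bsub>class_group R\<^esub> Suc n
      = (?D #>\<^bsub>?F\<^esub> (?x [^]\<^bsub>?F\<^esub> n)) <#>\<^bsub>?F\<^esub> (?D #>\<^bsub>?F\<^esub> ?x)"
      unfolding Cl.nat_pow_Suc Suc by (simp add: class_group_def FactGroup_def)
    also have "\<dots> = ?D #>\<^bsub>?F\<^esub> (?x [^]\<^bsub>?F\<^esub> n \<otimes>\<^bsub>?F\<^esub> ?x)"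
      by (rule N.rcos_sum[OF F.nat_pow_closed[OF x] x])
    finally show ?case unfolding F.nat_pow_Suc .
  qed
  define N where "N = card (carrier (class_group R))"
  have "?D #>\<^bsub>?F\<^esub> ?x \<in> carrier (class_group R)"
    unfolding class_group_def carrier_FactGroup using x by blast
  from Cl.pow_order_eq_1[OF this] have "?D #>\<^bsub>?F\<^esub> (?x [^]\<^bsub>?F\<^esub> N) = ?D"
    unfolding pow by (simp add: order_def N_def class_group_def)
  then have "?x [^]\<^bsub>?F\<^esub> N \<in> ?D"
    by (rule F.coset_join1[OF _ F.nat_pow_closed[OF x] subgroup_principal_divisors])
  then show ?thesis by (simp add: N_def)
qed

theorem symbolic_power_subset_ideal_power:
  assumes P: "P \<in> height_one_primes R" and N: "0 < card (carrier (class_group R))"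
    and U: "card (carrier (class_group R)) dvd U" "0 < U" and r: "0 < r"
  shows "symbolic_power R P (U * (r - 1) + 1) \<subseteq> ideal_power R P r"
proof -
  define N where "N = card (carrier (class_group R))"
  have N0: "0 < N" using assms by (simp add: N_def)
  obtain k where k: "U = N * k" using U(1) unfolding N_def by blast
  then have k0: "0 < k" using U(2) by (cases k) auto
  obtain f g where fg: "f \<in> carrier R" "f \<noteq> \<zero>" "g \<in> carrier R" "g \<noteq> \<zero>"
    and div: "\<And>Q. Q \<in> height_one_primes R \<Longrightarrow>
      Poly_Mapping.lookup (frag_cmul (int N) (frag_of P)) Q = int (valuation_at R Q f) - int (valuation_at R Q g)"
    using card_class_group_multiple_principal[OF P, folded N_def]
    unfolding principal_divisors_def by auto
  have val: "v f = v g + (if valuation_ideal R v (Suc 0) = P then N else 0)" if "v \<in> V" for v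
  proof -
    interpret v: essential_valuation R v by (rule valuations[OF that])
    have "valuation_ideal R v (Suc 0) \<in> height_one_primes R" using that height_one_primes_eq by blast
    from div[OF this] show ?thesis
      using fg by (auto simp: v.valuation_at_center split: if_splits)
  qed
  \<comment> \<open>All values of \<open>f\<close> are at least those of \<open>g\<close>, so the
    fraction f/g, whose divisor is \<open>N\<close> times \<open>P\<close>, belongs to the
    ring.\<close>
  then obtain h where h: "h \<in> carrier R" "f = g \<otimes> h"
    using dvd_if_val_le[OF fg] by (metis le_add1)
  have h0: "h \<noteq> \<zero>" using h fg by auto
  have valh: "v h = (if valuation_ideal R v (Suc 0) = P then N else 0)" if "v \<in> V" for v
  proof -
    interpret v: essential_valuation R v by (rule valuations[OF that])
    show ?thesis using val[OF that] v.val_mult[OF fg(3,4) h(1) h0] by (simp add: h(2))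
  qed
  obtain v where v: "v \<in> V" "P = valuation_ideal R v (Suc 0)" using P height_one_primes_eq by auto
  interpret v: essential_valuation R v by (rule valuations[OF v(1)])
  interpret P: ideal P R unfolding v(2) by (rule v.ideal_valuation_ideal)
  have "v h = N" using valh[OF v(1)] unfolding v(2)[symmetric] by (simp only: simp_thms if_True)
  then have hP: "h \<in> P" unfolding v(2) valuation_ideal_def using N0 h(1) by simp
  show ?thesis
  proof
    fix y assume "y \<in> symbolic_power R P (U * (r - 1) + 1)"
    then have y: "y \<in> valuation_ideal R v (U * (r - 1) + 1)"
      unfolding v(2) v.symbolic_power_center .
    then have yc: "y \<in> carrier R" by (simp add: valuation_ideal_def)
    interpret Pr: ideal "ideal_power R P r" R by (rule ideal_ideal_power[OF P.ideal_axioms])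
    show "y \<in> ideal_power R P r"
    proof (cases "y = \<zero>")
      case False
      \<comment> \<open>The divisor of \<open>x\<close> is
        \<open>N * k * (r - 1) = U * (r - 1)\<close> times \<open>P\<close>.\<close>
      define x where "x = h [^] (k * (r - 1))"
      have x: "x \<in> carrier R" "x \<noteq> \<zero>" unfolding x_def using h h0 v.pow_nonzero by auto
      have valx: "v' x = (if valuation_ideal R v' (Suc 0) = P then U * (r - 1) else 0)" if "v' \<in> V" for v'
      proof -
        interpret v': essential_valuation R v' by (rule valuations[OF that])
        show ?thesis using valh[OF that] h h0 by (simp add: x_def v'.val_pow k)
      qed
      have valy: "U * (r - 1) + 1 \<le> v y" using y False by (simp add: valuation_ideal_def)
      have "v' x \<le> v' y" if v': "v' \<in> V" for v'
      proof (cases "valuation_ideal R v' (Suc 0) = P")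
        case True
        interpret v': essential_valuation R v' by (rule valuations[OF v'])
        \<comment> \<open>\<open>v'\<close> and \<open>v\<close> may be different functions with the
          same center \<open>P\<close>; \<open>valuation_at\<close> depends on the center
          alone.\<close>
        have "v' y = v y"
          using v'.valuation_at_center[OF yc False] v.valuation_at_center[OF yc False] True v(2) by simp
        then show ?thesis using valx[OF v'] valy True by simp
      qed (simp add: valx[OF v'])
      then obtain z where z: "z \<in> carrier R" "y = x \<otimes> z" using dvd_if_val_le[OF yc False x] by blast
      have z0: "z \<noteq> \<zero>" using z False x by auto
      \<comment> \<open>The summand 1 in the symbolic exponent is what puts the cofactor into
        \<open>P\<close>.\<close>
      have "1 \<le> v z" using valy valx[OF v(1)] v.val_mult[OF x z(1) z0] z(2) v(2) by simp
      then have "z \<in> P" unfolding v(2) using z by (simp add: valuation_ideal_def)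
      then have "y \<in> ideal_power R P (Suc (k * (r - 1)))"
        unfolding ideal_power_Suc z(2) x_def
        by (intro ideal_prod.prod pow_in_ideal_power P.ideal_axioms hP)
      \<comment> \<open>One factor comes from \<open>z\<close>, the remaining
        \<open>k * (r - 1) \<ge> r - 1\<close> from the power of \<open>h\<close>.\<close>
      moreover have "r \<le> Suc (k * (r - 1))"
      proof -
        have "1 * (r - 1) \<le> k * (r - 1)" using k0 by (intro mult_le_mono1) simp
        then show ?thesis unfolding mult_1 by linarith
      qed
      ultimately show ?thesis using ideal_power_antimono[OF P.ideal_axioms] by blast
    qed simp
  qed
qed

end

section \<open>Rational pointed cones\<close>

lemma real_vec_simps [simp]:
  "real_vec (x + y) = real_vec x + real_vec y" "real_vec (x - y) = real_vec x - real_vec y"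
  "real_vec (0 :: int ^ 'n) = 0" "real_vec (c *s x) = of_int c *\<^sub>R real_vec x"
  by (simp_all add: real_vec_def vec_eq_iff)

lemma real_vec_eq_iff [simp]: "real_vec x = real_vec y \<longleftrightarrow> x = y"
  by (simp add: real_vec_def vec_eq_iff)

lemma real_vec_eq_0_iff [simp]: "real_vec x = 0 \<longleftrightarrow> x = 0"
  using real_vec_eq_iff[of x 0] by (simp only: real_vec_simps)

lemma inner_real_vec: "real_vec x \<bullet> real_vec y = of_int (lattice_inner x y)"
  by (simp add: real_vec_def lattice_inner_def inner_vec_def)

lemma lattice_inner_left [simp]:
  "lattice_inner (x + y) z = lattice_inner x z + lattice_inner y z"
  "lattice_inner (x - y) z = lattice_inner x z - lattice_inner y z"
  "lattice_inner (- x) z = - lattice_inner x z"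
  "lattice_inner (c *s x) z = c * lattice_inner x z"
  "lattice_inner 0 z = 0"
  by (simp_all add: lattice_inner_def sum.distrib sum_subtractf sum_distrib_left sum_negf algebra_simps)

lemma lattice_inner_right [simp]:
  "lattice_inner z (x + y) = lattice_inner z x + lattice_inner z y"
  "lattice_inner z (c *s x) = c * lattice_inner z x"
  "lattice_inner z 0 = 0"
  by (simp_all add: lattice_inner_def sum.distrib sum_distrib_left algebra_simps)

lemma lattice_inner_sum_left: "lattice_inner (\<Sum>b\<in>B. f b) z = (\<Sum>b\<in>B. lattice_inner (f b) z)"
  by (induction B rule: infinite_finite_induct) auto

lemma lattice_inner_sum_right: "lattice_inner z (\<Sum>b\<in>B. f b) = (\<Sum>b\<in>B. lattice_inner z (f b))"
  by (induction B rule: infinite_finite_induct) auto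

lemma lattice_inner_axis: "lattice_inner (axis i 1) z = z $ i"
proof -
  have "lattice_inner (axis i 1) z = (\<Sum>j\<in>UNIV. if j = i then z $ j else 0)"
    unfolding lattice_inner_def by (rule sum.cong) (simp_all add: axis_def)
  then show ?thesis by simp
qed

text \<open>\<open>k\<close> is the positive generator of the ideal of all values \<open>lattice_inner b s\<close>.\<close>

lemma content_decomposition:
  fixes s :: "int ^ 'n"
  assumes "s \<noteq> 0"
  obtains k u b where "k > 0" "s = k *s u" "lattice_inner b u = 1"
proof -
  obtain i where i: "s $ i \<noteq> 0" using assms by (auto simp: vec_eq_iff)
  have "lattice_inner (sgn (s $ i) *s axis i 1) s > 0"
    using i by (simp add: lattice_inner_axis sgn_if)
  then obtain b where b: "lattice_inner b s > 0"
    and min: "\<And>c. lattice_inner c s > 0 \<Longrightarrow> nat (lattice_inner b s) \<le> nat (lattice_inner c s)"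
    using ex_has_least_nat[of "\<lambda>b. lattice_inner b s > 0" _ "\<lambda>b. nat (lattice_inner b s)"] by blast
  define k where "k = lattice_inner b s"
  have k: "k > 0" using b by (simp add: k_def)
  have "k dvd lattice_inner c s" for c
  proof -
    \<comment> \<open>The remainder modulo \<open>k\<close> is again a value of some functional on
      \<open>s\<close>, so minimality of \<open>k\<close> forces it to be 0.\<close>
    define c' where "c' = c - (lattice_inner c s div k) *s b"
    have eq: "lattice_inner c' s = lattice_inner c s mod k"
      by (simp add: c'_def k_def[symmetric] minus_div_mult_eq_mod)
    have "\<not> lattice_inner c' s > 0"
    proof
      assume pos: "lattice_inner c' s > 0"
      then have "k \<le> lattice_inner c' s" using min[OF pos] by (simp add: k_def)
      then show False using eq k pos_mod_bound[OF k, of "lattice_inner c s"] by linarith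
    qed
    then show ?thesis using eq k pos_mod_sign[OF k, of "lattice_inner c s"] by (simp add: dvd_eq_mod_eq_0)
  qed
  then have dvd: "k dvd s $ i" for i using lattice_inner_axis[of i s] by metis
  define u where "u = (\<chi> i. s $ i div k)"
  have s: "s = k *s u" using dvd by (simp add: u_def vec_eq_iff)
  then have "k * lattice_inner b u = k" using k_def by (metis lattice_inner_right(2))
  then show ?thesis using that[OF k s] k by simp
qed

text \<open>Bezout's identity for the entries of \<open>u\<close>. The functional of value 1 is the
  form in which primitivity yields lattice points of the dual side.\<close>

lemma primitive_vec_iff: "primitive_vec u \<longleftrightarrow> (\<exists>b. lattice_inner b u = 1)"
proof
  assume u: "primitive_vec u"
  have "u \<noteq> 0"
  proof
    assume "u = 0"
    \<comment> \<open>Half of the zero vector is again a lattice vector.\<close>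
    then have "(1 / of_int 2) *\<^sub>R real_vec u = real_vec 0" by simp
    then show False using u unfolding primitive_vec_def by (metis rangeI one_less_numeral_iff semiring_norm(76))
  qed
  then obtain k x b where k: "k > 0" "u = k *s x" "lattice_inner b x = 1" by (rule content_decomposition)
  then have "(1 / of_int k) *\<^sub>R real_vec u = real_vec x" by simp
  then have "\<not> k > 1" using u unfolding primitive_vec_def by (metis rangeI)
  then have "k = 1" using k(1) by simp
  then have "u = x" using k(2) by simp
  then show "\<exists>b. lattice_inner b u = 1" using k(3) by simp blast
next
  assume "\<exists>b. lattice_inner b u = 1"
  then obtain b where b: "lattice_inner b u = 1" by blast
  show "primitive_vec u"
    unfolding primitive_vec_def
  proof (intro allI impI notI)
    fix k :: int assume k: "k > 1" "(1 / of_int k) *\<^sub>R real_vec u \<in> range real_vec"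
    then obtain x where "(1 / of_int k) *\<^sub>R real_vec u = real_vec x" by blast
    then have "real_vec (k *s x) = of_int k *\<^sub>R ((1 / of_int k) *\<^sub>R real_vec u)" by simp
    also have "\<dots> = real_vec u" using k by simp
    finally have "u = k *s x" by (simp only: real_vec_eq_iff)
    then have "k * lattice_inner b x = 1" using b by simp
    then show False using k(1) by (simp add: zmult_eq_1_iff)
  qed
qed

text \<open>Pairing with functionals that are 1 on \<open>u\<close> and on \<open>u'\<close> shows
  that both \<open>c\<close> and its inverse are integers.\<close>

lemma primitive_vec_parallel:
  assumes "primitive_vec u" "primitive_vec u'" "real_vec u' = c *\<^sub>R real_vec u" "c > 0"
  shows "u' = u"
proof -
  obtain a where a: "lattice_inner a u = 1" using assms(1) primitive_vec_iff by blast
  obtain b where b: "lattice_inner b u' = 1" using assms(2) primitive_vec_iff by blast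
  have "real_vec a \<bullet> real_vec u' = c * (real_vec a \<bullet> real_vec u)" "real_vec b \<bullet> real_vec u' = c * (real_vec b \<bullet> real_vec u)"
    unfolding assms(3) by simp_all
  then have c: "of_int (lattice_inner a u') = c" "1 = c * of_int (lattice_inner b u)"
    by (simp_all add: inner_real_vec a b)
  then have "real_of_int (lattice_inner a u' * lattice_inner b u) = real_of_int 1" by simp
  then have "lattice_inner a u' * lattice_inner b u = 1" by (simp only: of_int_eq_iff)
  moreover have "lattice_inner a u' > 0" using c(1) assms(4) by simp
  ultimately have "lattice_inner a u' = 1" by (auto simp: zmult_eq_1_iff)
  then have "c = 1" using c(1) by simp
  then show ?thesis using assms(3) by simp
qed

section \<open>Finitely generated cones and their edges\<close>

lemma convex_cone_sum:
  assumes "convex_cone S" "\<And>i. i \<in> A \<Longrightarrow> f i \<in> S"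
  shows "sum f A \<in> S"
  using assms(2)
  by (induction A rule: infinite_finite_induct)
    (auto intro: convex_cone_contains_0 convex_cone_add assms(1))

lemma convex_cone_hull_finite:
  assumes "finite A"
  shows "convex_cone hull (f ` A) = {\<Sum>a\<in>A. c a *\<^sub>R f a |c. \<forall>a\<in>A. c a \<ge> 0}" (is "_ = ?K")
proof
  show "convex_cone hull (f ` A) \<subseteq> ?K"
  proof (rule hull_minimal)
    show "f ` A \<subseteq> ?K"
    proof
      fix x assume "x \<in> f ` A"
      then obtain a where a: "a \<in> A" "x = f a" by blast
      have "(\<Sum>b\<in>A. (if b = a then 1 else 0 :: real) *\<^sub>R f b) = (\<Sum>b\<in>A. if b = a then f b else 0)"
        by (rule sum.cong) auto
      then have "x = (\<Sum>b\<in>A. (if b = a then 1 else 0 :: real) *\<^sub>R f b)" using a assms by simp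
      then show "x \<in> ?K" by (intro CollectI exI[of _ "\<lambda>b. if b = a then 1 else 0"]) auto
    qed
    show "convex_cone ?K"
      unfolding convex_cone_iff
    proof (intro conjI ballI allI impI)
      show "0 \<in> ?K" by (intro CollectI exI[of _ "\<lambda>_. 0"]) simp
    next
      fix x y assume "x \<in> ?K" "y \<in> ?K"
      then obtain c d where "x = (\<Sum>a\<in>A. c a *\<^sub>R f a)" "\<forall>a\<in>A. c a \<ge> 0"
        "y = (\<Sum>a\<in>A. d a *\<^sub>R f a)" "\<forall>a\<in>A. d a \<ge> 0" by blast
      then show "x + y \<in> ?K"
        by (intro CollectI exI[of _ "\<lambda>a. c a + d a"]) (simp add: scaleR_left_distrib sum.distrib)
    next
      fix x and t :: real assume "x \<in> ?K" "0 \<le> t"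
      then obtain c where "x = (\<Sum>a\<in>A. c a *\<^sub>R f a)" "\<forall>a\<in>A. c a \<ge> 0" by blast
      then show "t *\<^sub>R x \<in> ?K" using \<open>0 \<le> t\<close>
        by (intro CollectI exI[of _ "\<lambda>a. t * c a"]) (simp add: scaleR_sum_right)
    qed
  qed
  show "?K \<subseteq> convex_cone hull (f ` A)"
  proof clarify
    fix c :: "_ \<Rightarrow> real" assume "\<forall>a\<in>A. 0 \<le> c a"
    then show "(\<Sum>a\<in>A. c a *\<^sub>R f a) \<in> convex_cone hull (f ` A)"
      by (intro convex_cone_sum[OF convex_cone_convex_cone_hull] convex_cone_hull_mul hull_inc) auto
  qed
qed

locale rational_pointed_cone =
  fixes C :: "(real ^ 'n) set"
  assumes polyhedral: "rational_polyhedral_cone C"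
    and full: "full_dimensional C"
    and pointed: "pointed C"
begin

lemma convex_cone_C: "convex_cone C"
  using polyhedral convex_cone_convex_cone_hull unfolding rational_polyhedral_cone_def by auto

lemma zero_if_line: "x \<in> C \<Longrightarrow> - x \<in> C \<Longrightarrow> x = 0"
proof (rule ccontr)
  assume x: "x \<in> C" "- x \<in> C" "x \<noteq> 0"
  have "t *\<^sub>R x \<in> C" for t
  proof (cases "t \<ge> 0")
    case True
    then show ?thesis using x convex_cone_scaleR[OF convex_cone_C] by blast
  next
    case False
    then have "(- t) *\<^sub>R (- x) \<in> C" using x by (intro convex_cone_scaleR[OF convex_cone_C]) auto
    then show ?thesis by simp
  qed
  then show False using x(3) pointed unfolding pointed_def by blast
qed

lemma polyhedron_C: "polyhedron C"
proof -
  obtain S :: "(int ^ 'n) set" where "finite S" "C = convex_cone hull (real_vec ` S)"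
    using polyhedral unfolding rational_polyhedral_cone_def by blast
  then show ?thesis by (simp add: polyhedron_convex_cone_hull)
qed

lemma edge_properties:
  assumes e: "\<rho> edge_of C" and u: "real_vec u \<in> \<rho>" "u \<noteq> 0"
  shows "0 \<in> \<rho>" "\<And>y. y \<in> \<rho> \<Longrightarrow> y \<noteq> 0 \<Longrightarrow> \<exists>c>0. y = c *\<^sub>R real_vec u"
proof -
  have face: "\<rho> face_of C" and aff: "aff_dim \<rho> = 1" using e by (auto simp: edge_of_def)
  have sub: "\<rho> \<subseteq> C" by (rule edge_of_imp_subset[OF e])
  have uC: "real_vec u \<in> C" using u sub by blast
  \<comment> \<open>A nonzero vector is the midpoint of 0 and its double, so a face through it
    contains the endpoint 0.\<close>
  have "real_vec u \<in> open_segment 0 (2 *\<^sub>R real_vec u)"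
    unfolding in_segment using u(2) by (auto intro!: exI[of _ "1/2"])
  moreover have "2 *\<^sub>R real_vec u \<in> C" by (rule convex_cone_scaleR[OF convex_cone_C _ uC]) simp
  ultimately show z: "0 \<in> \<rho>"
    using face u(1) convex_cone_contains_0[OF convex_cone_C] unfolding face_of_def by blast
  fix y assume y: "y \<in> \<rho>" "y \<noteq> 0"
  have "collinear \<rho>" using aff by (simp add: collinear_aff_dim)
  then have "collinear {0, real_vec u, y}" by (rule collinear_subset) (use z y u in auto)
  then obtain c where c: "y = c *\<^sub>R real_vec u" using collinear_lemma[of "real_vec u" y] y(2) u(2) by auto
  have "c > 0"
  proof (rule ccontr)
    assume "\<not> c > 0"
    then have "(- c) *\<^sub>R real_vec u \<in> C" by (intro convex_cone_scaleR[OF convex_cone_C _ uC]) simp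
    then have "- y \<in> C" using c by simp
    then show False using zero_if_line[of y] y sub by blast
  qed
  then show "\<exists>c>0. y = c *\<^sub>R real_vec u" using c by blast
qed

lemma primitive_generator_nonzero: "u \<in> primitive_generators C \<Longrightarrow> u \<noteq> 0"
  by (auto simp: primitive_generators_def primitive_vec_iff)

lemma primitive_generator_in_cone: "u \<in> primitive_generators C \<Longrightarrow> real_vec u \<in> C"
  using edge_of_imp_subset by (auto simp: primitive_generators_def)

lemma primitive_generator_parallel:
  assumes "\<rho> edge_of C" "u \<in> primitive_generators C" "real_vec u \<in> \<rho>"
    "u' \<in> primitive_generators C" "real_vec u' \<in> \<rho>"
  shows "u' = u"
proof -
  have "real_vec u' \<noteq> 0" using primitive_generator_nonzero[OF assms(4)] by simp
  then obtain c where "c > 0" "real_vec u' = c *\<^sub>R real_vec u"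
    using edge_properties(2)[OF assms(1,3) primitive_generator_nonzero[OF assms(2)] assms(5)] by blast
  then show ?thesis using assms(2,4) primitive_vec_parallel unfolding primitive_generators_def by blast
qed

text \<open>If a nonnegative combination of \<open>T\<close> equals a multiple of \<open>s\<close>,
  moving that multiple to the other side leaves \<open>s\<close> with a coefficient
  \<open>d\<close>. Irredundancy gives \<open>d \<ge> 0\<close>; then the negative of every other
  term lies in the cone as well, and pointedness makes that term 0.\<close>

lemma ray_edge_of:
  assumes T: "finite T" "C = convex_cone hull (real_vec ` T)" and s: "s \<in> T"
    and irredundant: "real_vec s \<notin> convex_cone hull (real_vec ` (T - {s}))"
  shows "{t *\<^sub>R real_vec s |t. t \<ge> 0} edge_of C" (is "?ray edge_of C")
proof -
  let ?s = "real_vec s"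
  have TC: "real_vec q \<in> C" if "q \<in> T" for q using that T(2) by (simp add: hull_inc)
  have s0: "?s \<noteq> 0" using irredundant convex_cone_hull_contains_0 by metis
  have expand: "\<exists>c. (\<forall>q\<in>T. c q \<ge> 0) \<and> x = (\<Sum>q\<in>T. c q *\<^sub>R real_vec q)" if "x \<in> C" for x
    using that unfolding T(2) convex_cone_hull_finite[OF T(1)] by blast
  have key: "\<gamma> q *\<^sub>R real_vec q = 0" if \<gamma>: "\<forall>q\<in>T. \<gamma> q \<ge> 0" and eq: "(\<Sum>q\<in>T. \<gamma> q *\<^sub>R real_vec q) = t *\<^sub>R ?s"
    and q: "q \<in> T" "q \<noteq> s" for \<gamma> t q
  proof -
    define d where "d = \<gamma> s - t"
    have sum0: "(\<Sum>q\<in>T - {s}. \<gamma> q *\<^sub>R real_vec q) + d *\<^sub>R ?s = 0"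
      using eq sum.remove[OF T(1) s, of "\<lambda>q. \<gamma> q *\<^sub>R real_vec q"] by (simp add: d_def algebra_simps)
    have d: "d \<ge> 0"
    proof (rule ccontr)
      assume "\<not> d \<ge> 0"
      then have dneg: "d < 0" by simp
      have "(- d) *\<^sub>R ?s = (\<Sum>q\<in>T - {s}. \<gamma> q *\<^sub>R real_vec q)"
        using sum0 by (simp add: algebra_simps add_eq_0_iff)
      also have "\<dots> \<in> convex_cone hull (real_vec ` (T - {s}))"
        using \<gamma> by (intro convex_cone_sum convex_cone_convex_cone_hull convex_cone_hull_mul hull_inc) auto
      finally have mem: "(- d) *\<^sub>R ?s \<in> convex_cone hull (real_vec ` (T - {s}))" .
      have "(1 / - d) *\<^sub>R ((- d) *\<^sub>R ?s) \<in> convex_cone hull (real_vec ` (T - {s}))"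
        by (rule convex_cone_hull_mul[OF mem]) (use dneg in simp)
      moreover have "(1 / - d) *\<^sub>R ((- d) *\<^sub>R ?s) = ?s" using dneg by simp
      ultimately show False using irredundant by (simp only:)
    qed
    have "- (\<gamma> q *\<^sub>R real_vec q) = (\<Sum>q\<in>T - {s} - {q}. \<gamma> q *\<^sub>R real_vec q) + d *\<^sub>R ?s"
      using sum0 sum.remove[of "T - {s}" q "\<lambda>q. \<gamma> q *\<^sub>R real_vec q"] T(1) q
      by (simp add: add_eq_0_iff2 algebra_simps)
    also have "\<dots> \<in> C"
      using \<gamma> d s by (intro convex_cone_add[OF convex_cone_C] convex_cone_sum[OF convex_cone_C]
          convex_cone_scaleR[OF convex_cone_C] TC) auto
    finally have "- (\<gamma> q *\<^sub>R real_vec q) \<in> C" .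
    moreover have "\<gamma> q *\<^sub>R real_vec q \<in> C"
      using \<gamma> q by (intro convex_cone_scaleR[OF convex_cone_C] TC) auto
    ultimately show ?thesis using zero_if_line by blast
  qed
  have in_ray: "(\<Sum>q\<in>T. c q *\<^sub>R real_vec q) \<in> ?ray"
    if "\<forall>q\<in>T. c q \<ge> 0" "\<forall>q\<in>T. q \<noteq> s \<longrightarrow> c q *\<^sub>R real_vec q = 0" for c
  proof -
    have "(\<Sum>q\<in>T. c q *\<^sub>R real_vec q) = c s *\<^sub>R ?s"
      using that(2) by (subst sum.remove[OF T(1) s]) (simp add: sum.neutral)
    then show ?thesis using that(1) s by blast
  qed
  have "?ray face_of C"
    unfolding face_of_def
  proof (intro conjI ballI impI)
    show "?ray \<subseteq> C" using convex_cone_scaleR[OF convex_cone_C _ TC[OF s]] by auto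
    show "convex ?ray"
      unfolding convex_def
    proof (intro ballI allI impI)
      fix x y and a b :: real assume "x \<in> ?ray" "y \<in> ?ray" and ab: "0 \<le> a" "0 \<le> b"
      then obtain t t' where t: "t \<ge> 0" "t' \<ge> 0" "x = t *\<^sub>R ?s" "y = t' *\<^sub>R ?s" by blast
      then have "a *\<^sub>R x + b *\<^sub>R y = (a * t + b * t') *\<^sub>R ?s" by (simp add: scaleR_left_distrib)
      then show "a *\<^sub>R x + b *\<^sub>R y \<in> ?ray" using ab t by (intro CollectI exI[of _ "a * t + b * t'"]) simp
    qed
  next
    fix a b x assume ab: "a \<in> C" "b \<in> C" "x \<in> ?ray" "x \<in> open_segment a b"
    obtain t where t: "x = t *\<^sub>R ?s" using ab(3) by blast
    obtain \<mu> where \<mu>: "0 < \<mu>" "\<mu> < 1" "x = (1 - \<mu>) *\<^sub>R a + \<mu> *\<^sub>R b"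
      using ab(4) unfolding in_segment by blast
    obtain \<alpha> where \<alpha>: "\<forall>q\<in>T. \<alpha> q \<ge> 0" "a = (\<Sum>q\<in>T. \<alpha> q *\<^sub>R real_vec q)" using expand[OF ab(1)] by blast
    obtain \<beta> where \<beta>: "\<forall>q\<in>T. \<beta> q \<ge> 0" "b = (\<Sum>q\<in>T. \<beta> q *\<^sub>R real_vec q)" using expand[OF ab(2)] by blast
    \<comment> \<open>Coefficients of \<open>x\<close> obtained from those of \<open>a\<close> and
      \<open>b\<close>. Where this sum of nonnegative numbers vanishes, both summands
      vanish.\<close>
    define \<gamma> where "\<gamma> = (\<lambda>q. (1 - \<mu>) * \<alpha> q + \<mu> * \<beta> q)"
    have "(\<Sum>q\<in>T. \<gamma> q *\<^sub>R real_vec q) = x"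
      unfolding \<mu>(3) \<alpha>(2) \<beta>(2) \<gamma>_def by (simp add: scaleR_left_distrib sum.distrib scaleR_sum_right)
    then have sum: "(\<Sum>q\<in>T. \<gamma> q *\<^sub>R real_vec q) = t *\<^sub>R ?s" using t by simp
    have \<gamma>0: "\<forall>q\<in>T. \<gamma> q \<ge> 0" using \<alpha>(1) \<beta>(1) \<mu> by (simp add: \<gamma>_def)
    \<comment> \<open>\<open>T\<close> may contain the zero vector, for which \<open>key\<close>
      says nothing about the coefficient; hence the claim concerns the terms.\<close>
    have "\<alpha> q *\<^sub>R real_vec q = 0 \<and> \<beta> q *\<^sub>R real_vec q = 0" if q: "q \<in> T" "q \<noteq> s" for q
    proof (cases "q = 0")
      case False
      then have "\<gamma> q = 0" using key[OF \<gamma>0 sum q] by simp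
      moreover have "(1 - \<mu>) * \<alpha> q \<ge> 0" "\<mu> * \<beta> q \<ge> 0" using \<alpha>(1) \<beta>(1) \<mu> q by simp_all
      ultimately have "(1 - \<mu>) * \<alpha> q = 0" "\<mu> * \<beta> q = 0" unfolding \<gamma>_def by linarith+
      then show ?thesis using \<mu> by simp
    qed simp
    then show "a \<in> ?ray" "b \<in> ?ray" unfolding \<alpha>(2) \<beta>(2) using in_ray \<alpha>(1) \<beta>(1) by simp_all
  qed
  moreover have "aff_dim ?ray = 1"
  proof -
    have mem: "0 \<in> ?ray" "?s \<in> ?ray"
      by (rule CollectI, rule exI[of _ 0], simp) (rule CollectI, rule exI[of _ 1], simp)
    have "span ?ray = span {?s}"
    proof (rule subset_antisym; rule span_minimal)
      show "?ray \<subseteq> span {?s}" by (auto intro: span_scale span_base)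
      show "{?s} \<subseteq> span ?ray" using span_base[OF mem(2)] by (simp only: insert_subset empty_subsetI)
    qed simp_all
    then have "dim ?ray = dim {?s}" by (rule span_eq_dim)
    also have "dim {?s} = 1" using s0 by (simp only: dim_singleton if_False)
    finally show ?thesis using aff_dim_zero[OF hull_inc[OF mem(1)]] by simp
  qed
  ultimately show ?thesis by (simp add: edge_of_def)
qed

text \<open>A generating set \<open>T\<close> of least cardinality is irredundant, so its members
  span edges and are positive multiples of primitive generators. Conversely every primitive
  generator is parallel to a member of \<open>T\<close>, which makes the number of primitive
  generators finite.\<close>

lemma primitive_generators_generate:
  "finite (primitive_generators C)" "C = convex_cone hull (real_vec ` primitive_generators C)"
proof -
  let ?gen = "\<lambda>T :: (int ^ 'n) set. finite T \<and> C = convex_cone hull (real_vec ` T)"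
  obtain T0 where "?gen T0" using polyhedral unfolding rational_polyhedral_cone_def by blast
  then obtain T where T: "finite T" "C = convex_cone hull (real_vec ` T)"
    and min: "\<And>S. ?gen S \<Longrightarrow> card T \<le> card S"
    using ex_has_least_nat[of ?gen T0 card] by blast
  have irr: "real_vec s \<notin> convex_cone hull (real_vec ` (T - {s}))" if s: "s \<in> T" for s
  proof
    assume "real_vec s \<in> convex_cone hull (real_vec ` (T - {s}))"
    then have "convex_cone hull (insert (real_vec s) (real_vec ` (T - {s}))) = convex_cone hull (real_vec ` (T - {s}))"
      by (rule hull_redundant)
    moreover have "insert (real_vec s) (real_vec ` (T - {s})) = real_vec ` T" using s by blast
    ultimately have "card T \<le> card (T - {s})" using T by (intro min) simp
    then show False using card_Diff1_less[OF T(1) s] by simp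
  qed
  have from_T: "\<exists>u\<in>primitive_generators C. \<exists>c>0. real_vec s = c *\<^sub>R real_vec u" if s: "s \<in> T" for s
  proof -
    have "s \<noteq> 0" using irr[OF s] convex_cone_hull_contains_0 by (metis real_vec_simps(3))
    then obtain k u b where k: "k > 0" "s = k *s u" "lattice_inner b u = 1" by (rule content_decomposition)
    have "real_vec u = (1 / of_int k) *\<^sub>R real_vec s" using k by simp
    then have "real_vec u \<in> {t *\<^sub>R real_vec s |t. t \<ge> 0}"
      using k(1) by (intro CollectI exI[of _ "1 / of_int k"]) simp
    moreover have "primitive_vec u" using k(3) primitive_vec_iff by blast
    ultimately have "u \<in> primitive_generators C"
      unfolding primitive_generators_def using ray_edge_of[OF T s irr[OF s]] by blast
    moreover have "real_vec s = of_int k *\<^sub>R real_vec u" using k by simp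
    ultimately show ?thesis using k(1) by (metis of_int_0_less_iff)
  qed
  have to_T: "\<exists>s\<in>T. \<exists>c>0. real_vec s = c *\<^sub>R real_vec u" if u: "u \<in> primitive_generators C" for u
  proof -
    obtain \<rho> where \<rho>: "\<rho> edge_of C" "real_vec u \<in> \<rho>" using u unfolding primitive_generators_def by blast
    have u0: "u \<noteq> 0" by (rule primitive_generator_nonzero[OF u])
    have TC: "real_vec q \<in> C" if "q \<in> T" for q using that T(2) by (simp add: hull_inc)
    obtain c where c: "\<forall>q\<in>T. c q \<ge> 0" "real_vec u = (\<Sum>q\<in>T. c q *\<^sub>R real_vec q)"
      using primitive_generator_in_cone[OF u] unfolding T(2) convex_cone_hull_finite[OF T(1)] by blast
    have "\<exists>q\<in>T. c q *\<^sub>R real_vec q \<noteq> 0"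
    proof (rule ccontr)
      assume "\<not> ?thesis"
      then have "real_vec u = 0" unfolding c(2) by (simp add: sum.neutral)
      then show False using u0 by simp
    qed
    then obtain q where q: "q \<in> T" "c q *\<^sub>R real_vec q \<noteq> 0" by blast
    \<comment> \<open>\<open>u\<close> is split into one nonzero term \<open>a\<close> and the rest
      \<open>b\<close>, so it is the midpoint of the doubles of \<open>a\<close> and
      \<open>b\<close>, and the face property of the edge applies; for \<open>a = b\<close> the open
      segment is empty and \<open>u\<close> is itself the double of \<open>a\<close>.\<close>
    define a where "a = c q *\<^sub>R real_vec q"
    define b where "b = (\<Sum>q\<in>T - {q}. c q *\<^sub>R real_vec q)"
    have uab: "real_vec u = a + b" unfolding c(2) a_def b_def by (rule sum.remove[OF T(1) q(1)])
    have aC: "2 *\<^sub>R a \<in> C" and bC: "2 *\<^sub>R b \<in> C"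
      unfolding a_def b_def using c(1) q(1)
      by (auto intro!: convex_cone_sum[OF convex_cone_C] convex_cone_scaleR[OF convex_cone_C] TC)
    have "2 *\<^sub>R a \<in> \<rho>"
    proof (cases "a = b")
      case True
      then have "real_vec u = 2 *\<^sub>R a" using uab by (simp add: scaleR_2)
      then show ?thesis using \<rho>(2) by simp
    next
      case False
      have "real_vec u \<in> open_segment (2 *\<^sub>R a) (2 *\<^sub>R b)"
        unfolding in_segment uab using False by (auto intro!: exI[of _ "1/2"])
      then show ?thesis
        using \<rho> aC bC unfolding edge_of_def face_of_def by blast
    qed
    moreover have "2 *\<^sub>R a \<noteq> 0" using q(2) by (simp add: a_def)
    ultimately obtain d where d: "d > 0" "2 *\<^sub>R a = d *\<^sub>R real_vec u"
      using edge_properties(2)[OF \<rho> u0] by blast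
    have cq: "c q > 0" using c(1) q by (metis less_eq_real_def scaleR_zero_left)
    have "real_vec q = (1 / (2 * c q)) *\<^sub>R (2 *\<^sub>R a)" using cq by (simp add: a_def)
    then have "real_vec q = (d / (2 * c q)) *\<^sub>R real_vec u" unfolding d(2) by simp
    then show ?thesis using q(1) d(1) cq by (metis divide_pos_pos mult_pos_pos zero_less_numeral)
  qed
  then obtain f where f: "\<And>u. u \<in> primitive_generators C \<Longrightarrow> f u \<in> T \<and> (\<exists>c>0. real_vec (f u) = c *\<^sub>R real_vec u)"
    by metis
  have "inj_on f (primitive_generators C)"
  proof (rule inj_onI)
    fix u u' assume u: "u \<in> primitive_generators C" "u' \<in> primitive_generators C" "f u = f u'"
    then obtain c c' where c: "c > 0" "c' > 0" "c *\<^sub>R real_vec u = c' *\<^sub>R real_vec u'" using f by metis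
    have "(1 / c) *\<^sub>R (c *\<^sub>R real_vec u) = (1 / c) *\<^sub>R (c' *\<^sub>R real_vec u')" by (simp only: c(3))
    then have "real_vec u = (c' / c) *\<^sub>R real_vec u'" using c(1) by simp
    then show "u = u'"
      using primitive_vec_parallel[of u' u "c' / c"] u c unfolding primitive_generators_def by simp
  qed
  moreover have "f ` primitive_generators C \<subseteq> T" using f by blast
  ultimately show "finite (primitive_generators C)" using T(1) by (rule inj_on_finite)
  show "C = convex_cone hull (real_vec ` primitive_generators C)"
  proof
    show "convex_cone hull (real_vec ` primitive_generators C) \<subseteq> C"
      by (rule hull_minimal) (use primitive_generator_in_cone convex_cone_C in auto)
    have "real_vec ` T \<subseteq> convex_cone hull (real_vec ` primitive_generators C)"
    proof
      fix x assume "x \<in> real_vec ` T"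
      then obtain s where "s \<in> T" "x = real_vec s" by blast
      then obtain u c where "u \<in> primitive_generators C" "c > 0" "x = c *\<^sub>R real_vec u" using from_T by blast
      then show "x \<in> convex_cone hull (real_vec ` primitive_generators C)"
        by (simp add: convex_cone_hull_mul hull_inc)
    qed
    then have "convex_cone hull (real_vec ` T) \<subseteq> convex_cone hull (real_vec ` primitive_generators C)"
      by (rule hull_minimal) (rule convex_cone_convex_cone_hull)
    then show "C \<subseteq> convex_cone hull (real_vec ` primitive_generators C)" using T(2) by simp
  qed
qed

lemma dual_lattice_points_iff:
  "l \<in> dual_lattice_points C \<longleftrightarrow> (\<forall>u\<in>primitive_generators C. 0 \<le> lattice_inner l u)"
proof
  assume l: "l \<in> dual_lattice_points C"
  show "\<forall>u\<in>primitive_generators C. 0 \<le> lattice_inner l u"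
  proof
    fix u assume "u \<in> primitive_generators C"
    then have "0 \<le> real_vec l \<bullet> real_vec u"
      using l primitive_generator_in_cone by (auto simp: dual_lattice_points_def dual_cone_def)
    then show "0 \<le> lattice_inner l u" by (simp add: inner_real_vec)
  qed
next
  assume l: "\<forall>u\<in>primitive_generators C. 0 \<le> lattice_inner l u"
  have "convex_cone hull (real_vec ` primitive_generators C) \<subseteq> {x. real_vec l \<bullet> x \<ge> 0}"
    by (rule hull_minimal) (use l convex_cone_halfspace_ge in \<open>auto simp: inner_real_vec\<close>)
  then show "l \<in> dual_lattice_points C"
    using primitive_generators_generate(2) by (auto simp: dual_lattice_points_def dual_cone_def)
qed

text \<open>Full dimensionality enters here: a functional that vanishes on all rays vanishes on the
  span of the cone.\<close>

lemma lattice_inner_eq_0: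
  assumes "\<And>u. u \<in> primitive_generators C \<Longrightarrow> lattice_inner l u = 0"
  shows "l = 0"
proof -
  have sub: "subspace {x. real_vec l \<bullet> x = 0}" by (rule subspace_hyperplane)
  have cone: "convex_cone {x. real_vec l \<bullet> x = 0}"
    by (simp add: convex_cone_iff inner_add_right)
  have "convex_cone hull (real_vec ` primitive_generators C) \<subseteq> {x. real_vec l \<bullet> x = 0}"
    by (rule hull_minimal) (use assms cone in \<open>auto simp: inner_real_vec\<close>)
  then have "C \<subseteq> {x. real_vec l \<bullet> x = 0}" using primitive_generators_generate(2) by simp
  then have "span C \<subseteq> {x. real_vec l \<bullet> x = 0}" using sub by (rule span_minimal)
  then have "real_vec l \<bullet> real_vec l = 0" using full unfolding full_dimensional_def by blast
  then show ?thesis by simp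
qed

lemma primitive_generators_nonempty: "primitive_generators C \<noteq> {}"
proof
  assume "primitive_generators C = {}"
  then have "(axis undefined 1 :: int ^ 'n) = 0" by (intro lattice_inner_eq_0) simp
  then show False by (simp add: axis_eq_0_iff)
qed

text \<open>Faces of polyhedra are exposed, and a hyperplane exposing the edge passes through 0. The
  sign is reversed because exposed faces are described by an upper bound.\<close>

lemma exposing_functional:
  assumes u: "u \<in> primitive_generators C"
  obtains h where "h \<bullet> real_vec u = 0" "\<And>u'. u' \<in> primitive_generators C \<Longrightarrow> u' \<noteq> u \<Longrightarrow> 0 < h \<bullet> real_vec u'"
proof -
  obtain \<rho> where \<rho>: "\<rho> edge_of C" "real_vec u \<in> \<rho>" using u unfolding primitive_generators_def by blast
  then have "\<rho> exposed_face_of C" using exposed_face_of_polyhedron[OF polyhedron_C] by (simp add: edge_of_def)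
  then obtain a b where ab: "C \<subseteq> {x. a \<bullet> x \<le> b}" "\<rho> = C \<inter> {x. a \<bullet> x = b}"
    unfolding exposed_face_of_def by blast
  have "0 \<in> \<rho>" by (rule edge_properties(1)[OF \<rho> primitive_generator_nonzero[OF u]])
  then have b: "b = 0" using ab(2) by simp
  show ?thesis
  proof (rule that[of "- a"])
    show "- a \<bullet> real_vec u = 0" using \<rho>(2) ab(2) b by simp
    fix u' assume u': "u' \<in> primitive_generators C" "u' \<noteq> u"
    then have "real_vec u' \<in> C" "real_vec u' \<notin> \<rho>"
      using primitive_generator_in_cone primitive_generator_parallel[OF \<rho>(1) u \<rho>(2)] by auto
    then have "a \<bullet> real_vec u' \<le> 0" "a \<bullet> real_vec u' \<noteq> 0" using ab b by auto
    then show "0 < - a \<bullet> real_vec u'" by simp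
  qed
qed

text \<open>Round a large multiple of a real exposing functional and correct it along a lattice vector
  that has value 1 on \<open>u\<close>.\<close>

lemma facet_lattice_point:
  assumes u: "u \<in> primitive_generators C"
  obtains t where "lattice_inner t u = 0" "\<And>u'. u' \<in> primitive_generators C \<Longrightarrow> u' \<noteq> u \<Longrightarrow> 0 < lattice_inner t u'"
proof -
  obtain h where h: "h \<bullet> real_vec u = 0" "\<And>u'. u' \<in> primitive_generators C \<Longrightarrow> u' \<noteq> u \<Longrightarrow> 0 < h \<bullet> real_vec u'"
    using exposing_functional[OF u] by blast
  obtain m where m: "lattice_inner m u = 1"
    using u primitive_vec_iff unfolding primitive_generators_def by blast
  \<comment> \<open>The 1-norm of \<open>x\<close> bounds its pairing with a rounding error whose
    coordinates are at most 1 in absolute value.\<close>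
  define K :: "int ^ 'n \<Rightarrow> real" where
    "K x = (\<Sum>i\<in>UNIV. \<bar>of_int (x $ i)\<bar>)" for x
  have K0: "K x \<ge> 0" for x by (simp add: K_def sum_nonneg)
  \<comment> \<open>The two errors to be outweighed: rounding, evaluated at \<open>x\<close>, and
    the correction along \<open>m\<close>, whose coefficient is itself a rounding error at
    \<open>u\<close>.\<close>
  define bound where "bound x = K x + K u * \<bar>of_int (lattice_inner m x)\<bar>" for x
  have "\<exists>n. bound x < of_nat n * (h \<bullet> real_vec x)" if "x \<in> primitive_generators C - {u}" for x
    using reals_Archimedean3[OF h(2)] that by blast
  then obtain n where n: "\<And>x. x \<in> primitive_generators C - {u} \<Longrightarrow> bound x < of_nat (n x) * (h \<bullet> real_vec x)"
    by metis
  define N where "N = (\<Sum>x\<in>primitive_generators C - {u}. n x)"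
  have N: "bound x < of_nat N * (h \<bullet> real_vec x)" if x: "x \<in> primitive_generators C - {u}" for x
  proof -
    have "n x \<le> N" unfolding N_def using primitive_generators_generate(1) x by (intro member_le_sum) auto
    then have "of_nat (n x) * (h \<bullet> real_vec x) \<le> of_nat N * (h \<bullet> real_vec x)"
      using h(2) x by (intro mult_right_mono) (auto intro: less_imp_le)
    then show ?thesis using n[OF x] by linarith
  qed
  define g :: "int ^ 'n" where "g = (\<chi> i. \<lfloor>of_nat N * h $ i\<rfloor>)"
  define e where "e = of_nat N *\<^sub>R h - real_vec g"
  have e01: "\<bar>e $ i\<bar> \<le> 1" for i
    by (simp add: e_def g_def real_vec_def) linarith
  have eK: "\<bar>e \<bullet> real_vec x\<bar> \<le> K x" for x
  proof -
    have "\<bar>e \<bullet> real_vec x\<bar> \<le> (\<Sum>i\<in>UNIV. \<bar>e $ i * of_int (x $ i)\<bar>)"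
      unfolding inner_vec_def real_vec_def by (simp add: sum_abs)
    also have "\<dots> \<le> K x"
      unfolding K_def by (rule sum_mono) (simp add: abs_mult e01 mult_left_le_one_le)
    finally show ?thesis .
  qed
  have g: "of_int (lattice_inner g x) = of_nat N * (h \<bullet> real_vec x) - e \<bullet> real_vec x" for x
    unfolding inner_real_vec[symmetric] by (simp add: e_def inner_diff_left)
  define t where "t = g - lattice_inner g u *s m"
  show ?thesis
  proof (rule that[of t])
    show "lattice_inner t u = 0" by (simp add: t_def m)
    fix x assume x: "x \<in> primitive_generators C" "x \<noteq> u"
    have "of_int (lattice_inner g u) = - (e \<bullet> real_vec u)" using g[of u] h(1) by simp
    then have "\<bar>of_int (lattice_inner g u) * of_int (lattice_inner m x)\<bar> \<le> K u * \<bar>real_of_int (lattice_inner m x)\<bar>"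
      using eK[of u] by (simp add: abs_mult mult_right_mono)
    moreover have "real_of_int (lattice_inner t x) = of_nat N * (h \<bullet> real_vec x) - e \<bullet> real_vec x
        - of_int (lattice_inner g u) * of_int (lattice_inner m x)"
      using g[of x] by (simp add: t_def)
    ultimately have "0 < real_of_int (lattice_inner t x)"
      using N[of x] x eK[of x] unfolding bound_def by simp
    then show "0 < lattice_inner t x" by simp
  qed
qed

text \<open>A multiple of a lattice vector with value 1 on \<open>u\<close> gives the prescribed
  value; a large multiple of a lattice point that is 0 on \<open>u\<close> and positive on the other
  rays then lifts the remaining values. Such exponents supply uniformizers, local inverses and
  common denominators.\<close>

lemma prescribed_value_lattice_point:
  assumes u: "u \<in> primitive_generators C"
  obtains t where "lattice_inner t u = a" "\<And>u'. u' \<in> primitive_generators C \<Longrightarrow> u' \<noteq> u \<Longrightarrow> b u' \<le> lattice_inner t u'"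
proof -
  obtain m where m: "lattice_inner m u = 1"
    using u primitive_vec_iff unfolding primitive_generators_def by blast
  obtain s where s: "lattice_inner s u = 0" "\<And>u'. u' \<in> primitive_generators C \<Longrightarrow> u' \<noteq> u \<Longrightarrow> 0 < lattice_inner s u'"
    using facet_lattice_point[OF u] by blast
  define k where "k = (\<Sum>x\<in>primitive_generators C. \<bar>b x - a * lattice_inner m x\<bar>)"
  show ?thesis
  proof (rule that[of "a *s m + k *s s"])
    show "lattice_inner (a *s m + k *s s) u = a" by (simp add: m s)
    fix x assume x: "x \<in> primitive_generators C" "x \<noteq> u"
    have "\<bar>b x - a * lattice_inner m x\<bar> \<le> k"
      unfolding k_def using primitive_generators_generate(1) x by (intro member_le_sum) auto
    moreover have "k * 1 \<le> k * lattice_inner s x"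
      using s(2)[OF x] by (intro mult_left_mono) (auto simp: k_def sum_nonneg)
    ultimately show "b x \<le> lattice_inner (a *s m + k *s s) x" by simp
  qed
qed

end

section \<open>Toric algebras\<close>

lemma weight_lattice_inner: "weight (\<lambda>m. lattice_inner m u)"
  by standard simp

lemma keys_monomial_mult:
  fixes f :: "int ^ 'n \<Rightarrow>\<^sub>0 'k::field"
  assumes "m \<in> Poly_Mapping.keys (monomial t * f)"
  obtains k where "k \<in> Poly_Mapping.keys f" "m = t + k"
  using keys_timesE[OF assms] by (auto simp: monomial_def split: if_splits)

lemma monomial_nonzero [simp]: "(monomial t :: int ^ 'n \<Rightarrow>\<^sub>0 'k::field) \<noteq> 0"
  by (simp add: monomial_def single_eq_0_iff)

lemma keys_monomial [simp]: "Poly_Mapping.keys (monomial t :: int ^ 'n \<Rightarrow>\<^sub>0 'k::field) = {t}"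
  by (simp add: monomial_def)

lemma monomial_add: "monomial (s + t) = (monomial s * monomial t :: int ^ 'n \<Rightarrow>\<^sub>0 'k::field)"
  by (simp add: monomial_def mult_single)

lemma homogeneous_monomial: "homogeneous w (monomial t :: int ^ 'n \<Rightarrow>\<^sub>0 'k::field)"
  unfolding monomial_def by (rule homogeneous_single)

lemma wmin_monomial [simp]: "wmin w (monomial t :: int ^ 'n \<Rightarrow>\<^sub>0 'k::field) = w t"
  by (simp add: wmin_def)

lemma toric_algebra_simps [simp]:
  "f \<in> carrier (toric_algebra C) \<longleftrightarrow> Poly_Mapping.keys f \<subseteq> dual_lattice_points C"
  "f \<otimes>\<^bsub>toric_algebra C\<^esub> g = f * g" "f \<oplus>\<^bsub>toric_algebra C\<^esub> g = f + g"
  "\<one>\<^bsub>toric_algebra C\<^esub> = 1" "\<zero>\<^bsub>toric_algebra C\<^esub> = 0"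
  by (simp_all add: toric_algebra_def semigroup_algebra_def)

lemma domain_toric_algebra: "domain (toric_algebra C :: (int ^ 'n \<Rightarrow>\<^sub>0 'k::field) ring)"
proof (rule domain.intro[OF cring_toric_algebra], unfold_locales)
  fix a b :: "int ^ 'n \<Rightarrow>\<^sub>0 'k"
  assume "a \<otimes>\<^bsub>toric_algebra C\<^esub> b = \<zero>\<^bsub>toric_algebra C\<^esub>"
  then have "a * b = 0" by (simp only: toric_algebra_simps)
  then show "a = \<zero>\<^bsub>toric_algebra C\<^esub> \<or> b = \<zero>\<^bsub>toric_algebra C\<^esub>" by simp
qed simp

lemma dual_lattice_points_0: "0 \<in> dual_lattice_points C"
  by (simp add: dual_lattice_points_def dual_cone_def)

lemma dual_lattice_points_add:
  "x \<in> dual_lattice_points C \<Longrightarrow> y \<in> dual_lattice_points C \<Longrightarrow> x + y \<in> dual_lattice_points C"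
  by (auto simp: dual_lattice_points_def dual_cone_def inner_add_left)

lemma ideal_if_monomials:
  fixes f :: "int ^ 'n \<Rightarrow>\<^sub>0 'k::field"
  assumes I: "ideal I (toric_algebra C)" and f: "\<And>m. m \<in> Poly_Mapping.keys f \<Longrightarrow> monomial m \<in> I"
  shows "f \<in> I"
proof -
  interpret I: ideal I "toric_algebra C" by (rule I)
  have single: "Poly_Mapping.single m c \<in> I" if "m \<in> Poly_Mapping.keys f" for m c
  proof -
    have "Poly_Mapping.single 0 c \<in> carrier (toric_algebra C)"
      using dual_lattice_points_0 by auto
    from I.I_l_closed[OF f[OF that] this] show ?thesis
      by (simp add: monomial_def mult_single)
  qed
  have sum: "(\<Sum>m\<in>A. Poly_Mapping.single m (Poly_Mapping.lookup f m)) \<in> I"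
    if "A \<subseteq> Poly_Mapping.keys f" for A
    using finite_subset[OF that finite_keys] that
  proof (induction A rule: finite_induct)
    case empty
    then show ?case using additive_subgroup.zero_closed[OF ideal.axioms(1)[OF I]] by (simp only: sum.empty toric_algebra_simps)
  next
    case (insert m A)
    then show ?case using additive_subgroup.a_closed[OF ideal.axioms(1)[OF I] single[of m "Poly_Mapping.lookup f m"]] by simp
  qed
  have "f = (\<Sum>m\<in>Poly_Mapping.keys f. Poly_Mapping.single m (Poly_Mapping.lookup f m))"
    by (rule poly_mapping_eqI) (simp add: lookup_sum lookup_single when_def in_keys_iff)
  with sum[OF subset_refl] show ?thesis by simp
qed

context rational_pointed_cone
begin

section \<open>Valuations of the toric algebra\<close>

abbreviation toric :: "(int ^ 'n \<Rightarrow>\<^sub>0 'k::field) ring" where "toric \<equiv> toric_algebra C"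

text \<open>Laurent polynomials are fractions with monomial denominators: on every ray,
  \<open>t\<close> is made at least as large as the absolute values of all exponents of
  \<open>f\<close>.\<close>

lemma clear_denominators:
  fixes f :: "int ^ 'n \<Rightarrow>\<^sub>0 'k::field"
  obtains t where "t \<in> dual_lattice_points C" "monomial t * f \<in> carrier toric"
proof -
  obtain u where u: "u \<in> primitive_generators C" using primitive_generators_nonempty by blast
  define b where "b x = (\<Sum>k\<in>Poly_Mapping.keys f. \<bar>lattice_inner k x\<bar>)" for x
  obtain t where t: "lattice_inner t u = b u"
    "\<And>x. x \<in> primitive_generators C \<Longrightarrow> x \<noteq> u \<Longrightarrow> b x \<le> lattice_inner t x"
    using prescribed_value_lattice_point[OF u, of "b u" b] by blast
  then have tb: "b x \<le> lattice_inner t x" if "x \<in> primitive_generators C" for x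
    using that by (cases "x = u") auto
  have b0: "0 \<le> b x" for x by (simp add: b_def sum_nonneg)
  show ?thesis
  proof (rule that[of t])
    show "t \<in> dual_lattice_points C"
      unfolding dual_lattice_points_iff using tb b0 order_trans by blast
    show "monomial t * f \<in> carrier toric"
      unfolding toric_algebra_simps
    proof
      fix m assume "m \<in> Poly_Mapping.keys (monomial t * f)"
      then obtain k where k: "k \<in> Poly_Mapping.keys f" "m = t + k" by (rule keys_monomial_mult)
      show "m \<in> dual_lattice_points C"
        unfolding dual_lattice_points_iff
      proof
        fix x assume x: "x \<in> primitive_generators C"
        have "\<bar>lattice_inner k x\<bar> \<le> b x" unfolding b_def by (rule member_le_sum) (use k in auto)
        then show "0 \<le> lattice_inner m x" using tb[OF x] by (simp add: k(2))
      qed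
    qed
  qed
qed

text \<open>The order of vanishing along the torus-invariant divisor of the ray of \<open>u\<close>.
  \<open>nat\<close> loses nothing on nonzero elements of the toric algebra, where the minimum is
  nonnegative.\<close>

definition ray_val :: "int ^ 'n \<Rightarrow> (int ^ 'n \<Rightarrow>\<^sub>0 'k::field) \<Rightarrow> nat" where
  "ray_val u f = nat (wmin (\<lambda>m. lattice_inner m u) f)"

lemma wmin_ray_nonneg:
  assumes "u \<in> primitive_generators C" "f \<in> carrier toric" "f \<noteq> 0"
  shows "0 \<le> wmin (\<lambda>m. lattice_inner m u) f"
  using assms dual_lattice_points_iff by (auto simp: le_wmin_iff)

text \<open>Let \<open>t\<close> have minus the value of \<open>g\<close> on \<open>u\<close> and
  nonnegative values on the other rays. Shifting \<open>g\<close> by \<open>t\<close> gives a ring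
  element of value 0; shifting \<open>f\<close> by the same \<open>t\<close> stays in the ring
  because the value of \<open>f\<close> is at least that of \<open>g\<close>.\<close>

lemma essential_valuation_ray_val:
  assumes u: "u \<in> primitive_generators C"
  shows "essential_valuation (toric :: (int ^ 'n \<Rightarrow>\<^sub>0 'k::field) ring) (ray_val u)"
proof -
  interpret D: "domain" "toric :: (int ^ 'n \<Rightarrow>\<^sub>0 'k::field) ring" by (rule domain_toric_algebra)
  let ?w = "\<lambda>m. lattice_inner m u"
  interpret w: weight ?w by (rule weight_lattice_inner)
  show ?thesis
  proof (unfold_locales, unfold toric_algebra_simps(2,5))
    fix f g :: "int ^ 'n \<Rightarrow>\<^sub>0 'k"
    assume fg: "f \<in> carrier toric" "f \<noteq> 0" "g \<in> carrier toric" "g \<noteq> 0"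
    show "ray_val u (f * g) = ray_val u f + ray_val u g"
      unfolding ray_val_def w.wmin_mult[OF fg(2,4)]
      by (rule nat_add_distrib) (intro wmin_ray_nonneg u fg)+
    assume le: "ray_val u g \<le> ray_val u f"
    then have le: "wmin ?w g \<le> wmin ?w f"
      using wmin_ray_nonneg[OF u fg(1,2)] wmin_ray_nonneg[OF u fg(3,4)]
      unfolding ray_val_def by (simp add: nat_le_eq_zle)
    obtain t where t: "?w t = - wmin ?w g" "\<And>x. x \<in> primitive_generators C \<Longrightarrow> x \<noteq> u \<Longrightarrow> 0 \<le> lattice_inner t x"
      using prescribed_value_lattice_point[OF u, of "- wmin ?w g" "\<lambda>_. 0"] by blast
    have carr: "monomial t * h \<in> carrier toric" if h: "h \<in> carrier toric" "wmin ?w g \<le> wmin ?w h"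
      for h :: "int ^ 'n \<Rightarrow>\<^sub>0 'k"
      unfolding toric_algebra_simps
    proof
      fix m assume "m \<in> Poly_Mapping.keys (monomial t * h)"
      then obtain k where k: "k \<in> Poly_Mapping.keys h" "m = t + k" by (rule keys_monomial_mult)
      have kS: "k \<in> dual_lattice_points C" using k(1) h(1) by auto
      show "m \<in> dual_lattice_points C"
        unfolding dual_lattice_points_iff
      proof
        fix x assume x: "x \<in> primitive_generators C"
        show "0 \<le> lattice_inner m x"
        proof (cases "x = u")
          case True
          then show ?thesis using t(1) h(2) wmin_le[OF k(1), of ?w] by (simp add: k(2))
        next
          case False
          have "0 \<le> lattice_inner k x" using kS x dual_lattice_points_iff by blast
          then show ?thesis using t(2)[OF x False] by (simp add: k(2))
        qed
      qed
    qed
    have "ray_val u (monomial t * g) = 0"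
      unfolding ray_val_def using w.wmin_mult[OF monomial_nonzero fg(4), of t] t(1) by simp
    moreover have "monomial t * g \<noteq> 0" using fg by simp
    moreover have "(monomial t * g) * f = g * (monomial t * f)" by (simp add: mult_ac)
    ultimately show "\<exists>u'\<in>carrier toric. \<exists>z\<in>carrier toric. u' \<noteq> 0 \<and> ray_val u u' = 0 \<and> u' * f = g * z"
      using carr[OF fg(1) le] carr[OF fg(3)] by blast
  next
    obtain t where t: "?w t = 1" "\<And>x. x \<in> primitive_generators C \<Longrightarrow> x \<noteq> u \<Longrightarrow> 0 \<le> lattice_inner t x"
      using prescribed_value_lattice_point[OF u, of 1 "\<lambda>_. 0"] by blast
    have "t \<in> dual_lattice_points C"
      unfolding dual_lattice_points_iff using t by (metis zero_le_one)
    then have "monomial t \<in> carrier (toric :: (int ^ 'n \<Rightarrow>\<^sub>0 'k) ring)" by simp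
    moreover have "ray_val u (monomial t :: int ^ 'n \<Rightarrow>\<^sub>0 'k) = 1" by (simp add: ray_val_def t(1))
    ultimately show "\<exists>p\<in>carrier (toric :: (int ^ 'n \<Rightarrow>\<^sub>0 'k) ring). p \<noteq> 0 \<and> ray_val u p = 1"
      using monomial_nonzero by blast
  qed
qed

text \<open>Stripping the powers of \<open>p\<close> from \<open>f\<close> and \<open>g\<close>
  gives an identity \<open>u * f = g * z\<close> of Laurent polynomials with \<open>u\<close> of
  value 0. Monomials have value 0 as well, so they may be used to bring \<open>u\<close> and
  \<open>z\<close> into the toric algebra.\<close>

lemma essential_valuation_hval:
  fixes p :: "int ^ 'n \<Rightarrow>\<^sub>0 'k::field"
  assumes "weight w" and p: "weight.hprime w p"
  shows "essential_valuation (toric :: (int ^ 'n \<Rightarrow>\<^sub>0 'k::field) ring) (weight.hval w p)"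
proof -
  interpret D: "domain" "toric :: (int ^ 'n \<Rightarrow>\<^sub>0 'k::field) ring" by (rule domain_toric_algebra)
  interpret w: weight w by fact
  have p0: "p \<noteq> 0" using p by (simp add: w.hprime_def)
  have hval_monomial: "w.hval p (monomial t) = 0" for t
    by (rule w.hval_homogeneous[OF p monomial_nonzero homogeneous_monomial])
  show ?thesis
  proof (unfold_locales, unfold toric_algebra_simps(2,5))
    fix f g :: "int ^ 'n \<Rightarrow>\<^sub>0 'k"
    assume fg: "f \<in> carrier toric" "f \<noteq> 0" "g \<in> carrier toric" "g \<noteq> 0"
    show "w.hval p (f * g) = w.hval p f + w.hval p g" by (rule w.hval_mult[OF p fg(2,4)])
    assume le: "w.hval p g \<le> w.hval p f"
    obtain t f' where t: "t \<noteq> 0" "homogeneous w t" "t * f = p ^ w.hval p f * f'"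
      "f' \<noteq> 0" "\<not> w.hdvd p f'"
      by (rule w.hval_cofactor[OF p fg(2)])
    obtain s g' where s: "s \<noteq> 0" "homogeneous w s" "s * g = p ^ w.hval p g * g'"
      "g' \<noteq> 0" "\<not> w.hdvd p g'"
      by (rule w.hval_cofactor[OF p fg(4)])
    define u where "u = t * g'"
    define z where "z = s * p ^ (w.hval p f - w.hval p g) * f'"
    have eq: "u * f = g * z"
    proof -
      have "u * f = (t * f) * g'" by (simp add: u_def mult_ac)
      also have "\<dots> = p ^ (w.hval p g + (w.hval p f - w.hval p g)) * f' * g'"
        unfolding t(3) using le by simp
      also have "\<dots> = (s * g) * (p ^ (w.hval p f - w.hval p g) * f')"
        unfolding s(3) power_add by (simp add: mult_ac)
      also have "\<dots> = g * z" by (simp add: z_def mult_ac)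
      finally show ?thesis .
    qed
    obtain a where a: "a \<in> dual_lattice_points C" "monomial a * u \<in> carrier toric"
      by (rule clear_denominators)
    obtain b where b: "b \<in> dual_lattice_points C" "monomial b * z \<in> carrier toric"
      by (rule clear_denominators)
    have ma: "monomial a \<in> carrier (toric :: (int ^ 'n \<Rightarrow>\<^sub>0 'k) ring)"
      and mb: "monomial b \<in> carrier (toric :: (int ^ 'n \<Rightarrow>\<^sub>0 'k) ring)" using a b by simp_all
    have "w.hval p g' = 0" using w.hval_pos_iff[OF p s(4)] s(5) by simp
    then have "w.hval p u = 0"
      unfolding u_def using w.hval_mult[OF p t(1) s(4)] w.hval_homogeneous[OF p t(1,2)] by simp
    moreover have u0: "u \<noteq> 0" using t s by (simp add: u_def)
    ultimately have "w.hval p (monomial b * (monomial a * u)) = 0"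
      using hval_monomial by (simp add: w.hval_mult[OF p])
    moreover have "monomial b * (monomial a * u) \<in> carrier toric"
      using D.m_closed[OF mb a(2)] by (simp only: toric_algebra_simps(2))
    moreover have "monomial a * (monomial b * z) \<in> carrier toric"
      using D.m_closed[OF ma b(2)] by (simp only: toric_algebra_simps(2))
    moreover have "monomial b * (monomial a * u) * f = g * (monomial a * (monomial b * z))"
    proof -
      have "monomial b * (monomial a * u) * f = monomial a * monomial b * (u * f)" by (simp add: mult_ac)
      also have "\<dots> = g * (monomial a * (monomial b * z))" unfolding eq by (simp add: mult_ac)
      finally show ?thesis .
    qed
    moreover have "monomial b * (monomial a * u) \<noteq> 0" using u0 by simp
    ultimately show "\<exists>u\<in>carrier toric. \<exists>z\<in>carrier toric. u \<noteq> 0 \<and> w.hval p u = 0 \<and> u * f = g * z" by blast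
  next
    obtain t where t: "t \<in> dual_lattice_points C" "monomial t * p \<in> carrier toric" by (rule clear_denominators)
    have "w.hval p (monomial t * p) = 1"
      using w.hval_mult[OF p monomial_nonzero p0] hval_monomial w.hval_self[OF p] by simp
    moreover have "monomial t * p \<noteq> 0" using p0 by simp
    ultimately show "\<exists>q\<in>carrier (toric :: (int ^ 'n \<Rightarrow>\<^sub>0 'k) ring). q \<noteq> 0 \<and> w.hval p q = 1" using t(2) by blast
  qed
qed

text \<open>The rays detect exponents outside the dual cone; the primes of the coordinate
  localizations detect divisibility of Laurent polynomials, and their centers contain no
  monomial.\<close>

definition toric_valuations :: "((int ^ 'n \<Rightarrow>\<^sub>0 'k::field) \<Rightarrow> nat) set" where
  "toric_valuations = ray_val ` primitive_generators C \<union>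
     (\<Union>i. weight.hval (\<lambda>m. m $ i) ` {p. weight.hprime (\<lambda>m. m $ i) p})"

text \<open>The quotient exists as a Laurent polynomial by divisibility in all coordinate
  localizations; the ray valuations then force its exponents into the dual cone. Supports are finite
  because there are finitely many rays and coordinates, and each localization contributes finitely
  many valuations.\<close>

lemma krull_domain_toric_algebra:
  "krull_domain (toric :: (int ^ 'n \<Rightarrow>\<^sub>0 'k::field) ring) toric_valuations"
proof -
  interpret D: "domain" "toric :: (int ^ 'n \<Rightarrow>\<^sub>0 'k::field) ring" by (rule domain_toric_algebra)
  show ?thesis
  proof (rule krull_domain.intro[OF domain_toric_algebra], rule krull_domain_axioms.intro,
      unfold toric_algebra_simps(2,5))
    fix v :: "(int ^ 'n \<Rightarrow>\<^sub>0 'k) \<Rightarrow> nat"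
    assume "v \<in> toric_valuations"
    then show "essential_valuation toric v"
      unfolding toric_valuations_def
      using essential_valuation_ray_val essential_valuation_hval[OF weight_coordinate] by blast
  next
    fix f g :: "int ^ 'n \<Rightarrow>\<^sub>0 'k"
    assume fg: "f \<in> carrier toric" "f \<noteq> 0" "g \<in> carrier toric" "g \<noteq> 0"
      and val: "\<And>v. v \<in> toric_valuations \<Longrightarrow> v g \<le> v f"
    have "\<exists>t. t \<noteq> 0 \<and> homogeneous (\<lambda>m. m $ i) t \<and> g dvd t * f" for i
    proof -
      interpret w: weight "\<lambda>m. m $ i" by (rule weight_coordinate)
      have "w.hdvd g f"
        by (rule w.hdvd_if_hval_le[OF fg(2,4)]) (rule val, unfold toric_valuations_def, blast)
      then show ?thesis unfolding w.hdvd_def .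
    qed
    then have "g dvd f" by (rule dvd_if_dvd_up_to_homogeneous[OF fg(4)])
    then obtain z where z: "f = g * z" by (elim dvdE)
    then have z0: "z \<noteq> 0" using fg by auto
    have "m \<in> dual_lattice_points C" if m: "m \<in> Poly_Mapping.keys z" for m
      unfolding dual_lattice_points_iff
    proof
      fix u assume u: "u \<in> primitive_generators C"
      interpret w: weight "\<lambda>m. lattice_inner m u" by (rule weight_lattice_inner)
      have "ray_val u g \<le> ray_val u f" by (rule val, unfold toric_valuations_def) (use u in blast)
      then have "wmin (\<lambda>m. lattice_inner m u) g \<le> wmin (\<lambda>m. lattice_inner m u) f"
        using wmin_ray_nonneg[OF u fg(1,2)] wmin_ray_nonneg[OF u fg(3,4)]
        unfolding ray_val_def by (simp add: nat_le_eq_zle)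
      also have "\<dots> = wmin (\<lambda>m. lattice_inner m u) g + wmin (\<lambda>m. lattice_inner m u) z"
        unfolding z by (rule w.wmin_mult[OF fg(4) z0])
      finally show "0 \<le> lattice_inner m u" using wmin_le[OF m, of "\<lambda>m. lattice_inner m u"] by linarith
    qed
    then have "z \<in> carrier toric" by auto
    then show "\<exists>z\<in>carrier toric. f = g * z" using z by blast
  next
    fix f :: "int ^ 'n \<Rightarrow>\<^sub>0 'k"
    assume f: "f \<in> carrier toric" "f \<noteq> 0"
    have "{v \<in> toric_valuations. 0 < v f} \<subseteq> ray_val ` primitive_generators C \<union>
      (\<Union>i. {weight.hval (\<lambda>m. m $ i) p |p. weight.hprime (\<lambda>m. m $ i) p \<and> weight.hdvd (\<lambda>m. m $ i) p f})"
      unfolding toric_valuations_def using weight.hval_pos_iff[OF weight_coordinate _ f(2)] by blast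
    moreover have "finite \<dots>"
      by (intro finite_UnI finite_imageI finite_UN_I primitive_generators_generate(1) finite
          weight.finite_hval[OF weight_coordinate f(2)])
    ultimately show "finite {v \<in> toric_valuations. 0 < v f}" by (rule finite_subset)
  qed
qed

section \<open>Monomial primes and the weights of their faces\<close>

lemma lattice_inner_generator_sum:
  "lattice_inner m (generator_sum C) = (\<Sum>u\<in>primitive_generators C. lattice_inner m u)"
  unfolding generator_sum_def by (rule lattice_inner_sum_right)

text \<open>The pairings with the rays are nonnegative, and full dimensionality prevents all of them
  from vanishing. This makes the maximum in the definition of \<open>U\<close> positive.\<close>

lemma generator_sum_pos:
  assumes "m \<in> dual_lattice_points C" "m \<noteq> 0"
  shows "0 < lattice_inner m (generator_sum C)"
proof -
  have nonneg: "\<And>u. u \<in> primitive_generators C \<Longrightarrow> 0 \<le> lattice_inner m u"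
    using assms(1) dual_lattice_points_iff by blast
  obtain u where "u \<in> primitive_generators C" "lattice_inner m u \<noteq> 0"
    using assms(2) lattice_inner_eq_0 by blast
  then show ?thesis
    unfolding lattice_inner_generator_sum using primitive_generators_generate(1) nonneg
    by (intro sum_pos2[of _ u]) (auto simp: order_less_le)
qed

lemma exists_nonzero_dual_lattice_point: "\<exists>m\<in>dual_lattice_points C. m \<noteq> 0"
proof -
  obtain u where u: "u \<in> primitive_generators C" using primitive_generators_nonempty by blast
  obtain t where t: "lattice_inner t u = 1" "\<And>x. x \<in> primitive_generators C \<Longrightarrow> x \<noteq> u \<Longrightarrow> 0 \<le> lattice_inner t x"
    using prescribed_value_lattice_point[OF u, of 1 "\<lambda>_. 0"] by blast
  have "t \<in> dual_lattice_points C"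
    unfolding dual_lattice_points_iff using t by (metis zero_le_one)
  moreover have "t \<noteq> 0" using t(1) by auto
  ultimately show ?thesis by blast
qed

text \<open>Subtracting \<open>m\<close> from a large multiple of a relatively interior point \<open>m0\<close> of the face \<open>F\<close> of
  monomials outside \<open>P\<close> shows that \<open>m\<close> itself lies in \<open>F\<close>.\<close>

lemma prime_face_functional:
  fixes P :: "(int ^ 'n \<Rightarrow>\<^sub>0 'k::field) set"
  assumes P: "primeideal P toric"
  obtains G where "G \<subseteq> primitive_generators C"
    "\<And>m. m \<in> dual_lattice_points C \<Longrightarrow> lattice_inner m (\<Sum>G) = 0 \<longleftrightarrow> monomial m \<notin> P"
proof -
  interpret P: primeideal P toric by (rule P)
  let ?S = "dual_lattice_points C" and ?G = "primitive_generators C"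
  define F where "F = {m \<in> ?S. monomial m \<notin> P}"
  define G where "G = {u \<in> ?G. \<forall>m\<in>F. lattice_inner m u = 0}"
  have finG: "finite G" "finite ?G" using primitive_generators_generate(1) by (auto simp: G_def)
  have nonneg: "0 \<le> lattice_inner m u" if "m \<in> ?S" "u \<in> ?G" for m u
    using that dual_lattice_points_iff by blast
  have F0: "0 \<in> F"
  proof -
    have "(monomial 0 :: int ^ 'n \<Rightarrow>\<^sub>0 'k) = \<one>\<^bsub>toric\<^esub>" by (simp add: monomial_def)
    then have "(monomial 0 :: int ^ 'n \<Rightarrow>\<^sub>0 'k) \<notin> P" using P.one_imp_carrier P.I_notcarr by metis
    then show ?thesis by (simp add: F_def dual_lattice_points_0)
  qed
  \<comment> \<open>Primality closes \<open>F\<close> under sums; the ideal property then closes it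
    under summands from the semigroup.\<close>
  have Fadd: "x + y \<in> F" if "x \<in> F" "y \<in> F" for x y
  proof -
    have "monomial x \<otimes>\<^bsub>toric\<^esub> monomial y \<notin> P"
      using that P.I_prime[of "monomial x" "monomial y"] by (auto simp: F_def)
    then show ?thesis using that by (simp add: F_def monomial_add dual_lattice_points_add)
  qed
  have Fface: "x \<in> F" if "x + y \<in> F" "x \<in> ?S" "y \<in> ?S" for x y
  proof -
    have "monomial x \<notin> P"
    proof
      assume "monomial x \<in> P"
      then have "monomial x \<otimes>\<^bsub>toric\<^esub> monomial y \<in> P"
        using that by (intro P.I_r_closed) simp_all
      then show False using that by (simp add: F_def monomial_add)
    qed
    then show ?thesis using that by (simp add: F_def)
  qed
  have Fsum: "sum f A \<in> F" if "\<And>i. i \<in> A \<Longrightarrow> f i \<in> F" for f :: "int ^ 'n \<Rightarrow> int ^ 'n" and A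
    using that by (induction A rule: infinite_finite_induct) (auto intro: F0 Fadd)
  have Fmul: "int k *s m \<in> F" if "m \<in> F" for k m
  proof (induction k)
    case (Suc k)
    have "int (Suc k) *s m = m + int k *s m" by (simp add: vec_eq_iff algebra_simps)
    then show ?case using Fadd[OF that Suc] by simp
  qed (simp add: F0)
  \<comment> \<open>Each generator outside \<open>G\<close> is positive on some element of
    \<open>F\<close>; the sum of these elements is positive on all such generators at once.\<close>
  have "\<exists>m\<in>F. lattice_inner m u > 0" if "u \<in> ?G - G" for u
    using that nonneg by (force simp: G_def F_def)
  then obtain c where c: "\<And>u. u \<in> ?G - G \<Longrightarrow> c u \<in> F \<and> lattice_inner (c u) u > 0" by metis
  define m0 where "m0 = (\<Sum>u\<in>?G - G. c u)"
  have m0: "m0 \<in> F" unfolding m0_def using c by (intro Fsum) blast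
  have m0_pos: "lattice_inner m0 u > 0" if u: "u \<in> ?G - G" for u
    unfolding m0_def lattice_inner_sum_left
    using c u finG nonneg by (intro sum_pos2[of _ u]) (auto simp: F_def)
  have "m \<in> F" if m: "m \<in> ?S" "lattice_inner m (\<Sum>G) = 0" for m
  proof -
    have "(\<Sum>u\<in>G. lattice_inner m u) = 0" using m(2) by (simp add: lattice_inner_sum_right)
    then have mG: "lattice_inner m u = 0" if "u \<in> G" for u
      using that finG m(1) nonneg by (subst (asm) sum_nonneg_eq_0_iff) (auto simp: G_def)
    \<comment> \<open>Large enough for \<open>int k *s m0 - m\<close> to lie in the dual cone: on
      \<open>G\<close> both parts vanish, elsewhere \<open>m0\<close> has value at least 1.\<close>
    define k where "k = nat (\<Sum>u\<in>?G. lattice_inner m u)"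
    have k: "lattice_inner m u \<le> int k" if u: "u \<in> ?G" for u
    proof -
      have "lattice_inner m u \<le> (\<Sum>u\<in>?G. lattice_inner m u)"
        using finG m(1) nonneg u by (intro member_le_sum) auto
      then show ?thesis by (simp add: k_def)
    qed
    have "int k *s m0 - m \<in> ?S"
      unfolding dual_lattice_points_iff
    proof
      fix u assume u: "u \<in> ?G"
      show "0 \<le> lattice_inner (int k *s m0 - m) u"
      proof (cases "u \<in> G")
        case True
        then have "lattice_inner m0 u = 0" using m0 by (simp add: G_def)
        then show ?thesis using mG[OF True] by simp
      next
        case False
        then have "int k * 1 \<le> int k * lattice_inner m0 u"
          using m0_pos[of u] u by (intro mult_left_mono) auto
        then show ?thesis using k[OF u] by simp
      qed
    qed
    moreover have "m + (int k *s m0 - m) \<in> F" using Fmul[OF m0] by simp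
    ultimately show ?thesis using Fface m(1) by blast
  qed
  moreover have "lattice_inner m (\<Sum>G) = 0" if "m \<in> F" for m
    unfolding lattice_inner_sum_right using that by (intro sum.neutral) (auto simp: G_def)
  ultimately have "\<And>m. m \<in> ?S \<Longrightarrow> lattice_inner m (\<Sum>G) = 0 \<longleftrightarrow> monomial m \<notin> P"
    unfolding F_def by blast
  then show ?thesis using that[of G] by (auto simp: G_def)
qed

lemma ideal_keys_ge:
  fixes w :: "int ^ 'n \<Rightarrow> int"
  assumes add: "\<And>x y. w (x + y) = w x + w y" and nonneg: "\<And>m. m \<in> dual_lattice_points C \<Longrightarrow> 0 \<le> w m"
  shows "ideal {f \<in> carrier (toric :: (int ^ 'n \<Rightarrow>\<^sub>0 'k::field) ring). \<forall>m\<in>Poly_Mapping.keys f. a \<le> w m} toric"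
    (is "ideal ?I _")
proof -
  interpret D: "domain" "toric :: (int ^ 'n \<Rightarrow>\<^sub>0 'k::field) ring" by (rule domain_toric_algebra)
  have mult: "x * b \<in> ?I" if b: "b \<in> ?I" and x: "x \<in> carrier toric" for b x
  proof -
    have "x * b \<in> carrier toric" using D.m_closed[of x b] b x by (simp only: toric_algebra_simps(2) mem_Collect_eq)
    moreover have "a \<le> w m" if m: "m \<in> Poly_Mapping.keys (x * b)" for m
    proof -
      obtain k l where kl: "k \<in> Poly_Mapping.keys x" "l \<in> Poly_Mapping.keys b" "m = k + l"
        by (rule keys_timesE[OF m])
      then have "0 \<le> w k" "a \<le> w l" using x b nonneg by auto
      then show ?thesis using add kl(3) by simp
    qed
    ultimately show ?thesis by blast
  qed
  show ?thesis
  proof (rule idealI[OF D.ring_axioms])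
    show "subgroup ?I (add_monoid toric)"
    proof (rule D.add.subgroupI)
      fix x assume x: "x \<in> ?I"
      have "- 1 \<in> carrier (toric :: (int ^ 'n \<Rightarrow>\<^sub>0 'k) ring)" using dual_lattice_points_0 by simp
      from mult[OF x this] have "- x \<in> ?I" by simp
      moreover have "\<ominus>\<^bsub>toric\<^esub> x = - x"
        by (rule D.minus_equality) (use x calculation in \<open>auto simp: toric_algebra_simps(3,5)\<close>)
      ultimately show "\<ominus>\<^bsub>toric\<^esub> x \<in> ?I" by (simp only:)
    next
      fix x y assume "x \<in> ?I" "y \<in> ?I"
      then show "x \<oplus>\<^bsub>toric\<^esub> y \<in> ?I"
        using keys_add[of x y] unfolding toric_algebra_simps by blast
    next
      have "0 \<in> ?I" by simp
      then show "?I \<noteq> {}" by blast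
    qed auto
  next
    fix b x :: "int ^ 'n \<Rightarrow>\<^sub>0 'k" assume "b \<in> ?I" "x \<in> carrier toric"
    from mult[OF this] show "x \<otimes>\<^bsub>toric\<^esub> b \<in> ?I" "b \<otimes>\<^bsub>toric\<^esub> x \<in> ?I"
      by (simp_all only: toric_algebra_simps(2) mult.commute)
  qed
qed

text \<open>With \<open>w\<close> the sum of the generators vanishing on the face of \<open>P\<close>, an element of \<open>P^(a)\<close> only has
  exponents of \<open>w\<close>-value at least \<open>a\<close>; since every \<open>b \<in> B\<close> has value at most \<open>d\<close>, such an exponent
  is a sum with at least \<open>r\<close> terms from \<open>B\<close> outside the face.\<close>

lemma monomial_prime_symbolic_power:
  fixes P :: "(int ^ 'n \<Rightarrow>\<^sub>0 'k::field) set"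
  assumes P: "primeideal P toric" "monomial_ideal C P"
    and B: "finite B" "generates_semigroup B (dual_lattice_points C)"
    and d: "\<And>b. b \<in> B \<Longrightarrow> lattice_inner b (generator_sum C) \<le> int d" and "d \<le> U" "0 < r"
  shows "symbolic_power toric P (U * (r - 1) + 1) \<subseteq> ideal_power toric P r"
proof
  interpret D: "domain" "toric :: (int ^ 'n \<Rightarrow>\<^sub>0 'k::field) ring" by (rule domain_toric_algebra)
  interpret P: primeideal P toric by (rule P)
  let ?S = "dual_lattice_points C"
  obtain G where G: "G \<subseteq> primitive_generators C"
    "\<And>m. m \<in> ?S \<Longrightarrow> lattice_inner m (\<Sum>G) = 0 \<longleftrightarrow> monomial m \<notin> P"
    using prime_face_functional[OF P(1)] by blast
  define w where "w = (\<lambda>m. lattice_inner m (\<Sum>G))"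
  interpret w: weight w unfolding w_def by (rule weight_lattice_inner)
  have finG: "finite (primitive_generators C)" by (rule primitive_generators_generate)
  have nonneg: "0 \<le> lattice_inner m u" if "m \<in> ?S" "u \<in> primitive_generators C" for m u
    using that dual_lattice_points_iff by blast
  have w_nonneg: "0 \<le> w m" if "m \<in> ?S" for m
    unfolding w_def lattice_inner_sum_right using that G(1) nonneg by (intro sum_nonneg) blast
  \<comment> \<open>\<open>G\<close> is a part of the generators summed in
    \<open>generator_sum C\<close>, so a bound on \<open>B\<close> for the full sum also bounds the
    weight \<open>w\<close>.\<close>
  have w_le: "w m \<le> lattice_inner m (generator_sum C)" if "m \<in> ?S" for m
    unfolding w_def lattice_inner_sum_right lattice_inner_generator_sum
    using that G(1) nonneg finG by (intro sum_mono2) auto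
  have w_pos: "1 \<le> w m" if "m \<in> ?S" "monomial m \<in> P" for m
    using w_nonneg[OF that(1)] G(2)[OF that(1)] that(2) unfolding w_def by linarith
  define J where "J a = {f \<in> carrier (toric :: (int ^ 'n \<Rightarrow>\<^sub>0 'k) ring). \<forall>m\<in>Poly_Mapping.keys f. int a \<le> w m}" for a
  have idealJ: "ideal (J a) toric" for a
    unfolding J_def by (rule ideal_keys_ge) (use w.add w_nonneg in auto)
  \<comment> \<open>Here \<open>P\<close> has to be monomial: its generators have weight at least 1,
    and \<open>J 1\<close> is an ideal.\<close>
  have PJ: "P \<subseteq> J 1"
  proof -
    obtain M where M: "M \<subseteq> ?S" "P = genideal toric (monomial ` M)"
      using P(2) unfolding monomial_ideal_def by blast
    have sub: "monomial ` M \<subseteq> carrier (toric :: (int ^ 'n \<Rightarrow>\<^sub>0 'k) ring)" using M(1) by auto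
    have "monomial ` M \<subseteq> P" unfolding M(2) by (rule D.genideal_self[OF sub])
    then have "1 \<le> w m" if "m \<in> M" for m using that M(1) by (intro w_pos) auto
    then have "monomial ` M \<subseteq> J 1" using sub unfolding J_def by auto
    then show ?thesis unfolding M(2) by (rule D.genideal_minimal[OF idealJ])
  qed
  have powJ: "ideal_power toric P a \<subseteq> J a" for a
  proof (induction a)
    case 0
    show ?case
      unfolding D.ideal_power_0
    proof
      fix x :: "int ^ 'n \<Rightarrow>\<^sub>0 'k" assume x: "x \<in> carrier toric"
      then have "\<forall>m\<in>Poly_Mapping.keys x. 0 \<le> w m" using w_nonneg unfolding toric_algebra_simps(1) by blast
      with x show "x \<in> J 0" by (simp add: J_def)
    qed
  next
    case (Suc a)
    show ?case
    proof
      fix x assume "x \<in> ideal_power toric P (Suc a)"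
      then have "x \<in> ideal_prod toric (ideal_power toric P a) P" by (simp only: D.ideal_power_Suc)
      then show "x \<in> J (Suc a)"
      proof (induction x rule: ideal_prod.induct)
        case (prod i j)
        then have ij: "i \<in> J a" "j \<in> J 1" using Suc PJ by auto
        then have "i \<otimes>\<^bsub>toric\<^esub> j \<in> carrier toric" by (intro D.m_closed) (auto simp: J_def)
        moreover have "int (Suc a) \<le> w m" if m: "m \<in> Poly_Mapping.keys (i * j)" for m
        proof -
          obtain k l where kl: "k \<in> Poly_Mapping.keys i" "l \<in> Poly_Mapping.keys j" "m = k + l"
            by (rule keys_timesE[OF m])
          then have "int a \<le> w k" "1 \<le> w l" using ij by (auto simp: J_def)
          then show ?thesis using w.add[of k l] kl(3) by simp
        qed
        ultimately show ?case unfolding J_def toric_algebra_simps(2) by blast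
      next
        case (sum s1 s2)
        then show ?case using idealJ additive_subgroup.a_closed ideal.axioms(1) by metis
      qed
    qed
  qed
  have BS: "b \<in> ?S" if b: "b \<in> B" for b
  proof -
    have "(\<Sum>c\<in>B. int (if c = b then 1 else 0) *s c) = (\<Sum>c\<in>B. if c = b then c else 0)"
      by (rule sum.cong) auto
    then have eq: "b = (\<Sum>c\<in>B. int (if c = b then 1 else 0) *s c)" using b B(1) by simp
    show ?thesis
      unfolding B(2)[unfolded generates_semigroup_def]
      by (rule CollectI, intro exI[of _ "\<lambda>c. if c = b then 1 else 0"] conjI TrueI eq)
  qed
  have mulS: "int k *s m \<in> ?S" if "m \<in> ?S" for k m
    using that by (simp add: dual_lattice_points_iff)
  have idealPr: "ideal (ideal_power toric P k) toric" for k by (rule D.ideal_ideal_power[OF P.ideal_axioms])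
  have mulP: "monomial (int k *s m) \<in> ideal_power toric P k" if "monomial m \<in> P" for k m
  proof (induction k)
    case 0
    show ?case unfolding D.ideal_power_0 by (simp add: dual_lattice_points_0)
  next
    case (Suc k)
    have eq: "monomial (int (Suc k) *s m) = (monomial (int k *s m) \<otimes>\<^bsub>toric\<^esub> monomial m :: int ^ 'n \<Rightarrow>\<^sub>0 'k)"
      unfolding toric_algebra_simps monomial_add[symmetric]
      by (rule arg_cong[of _ _ monomial]) (simp add: vec_eq_iff algebra_simps)
    show ?case unfolding D.ideal_power_Suc eq by (rule ideal_prod.prod[OF Suc that])
  qed
  fix f assume "f \<in> symbolic_power toric P (U * (r - 1) + 1)"
  then obtain x where f: "f \<in> carrier toric" and x: "x \<in> carrier toric" "x \<notin> P"
    "x * f \<in> ideal_power toric P (U * (r - 1) + 1)"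
    unfolding symbolic_power_def by auto
  \<comment> \<open>An element outside \<open>P\<close> has an exponent on the face, where the
    weight is 0; multiplication by \<open>x\<close> therefore leaves \<open>wmin\<close>
    unchanged.\<close>
  have "\<exists>m\<in>Poly_Mapping.keys x. monomial m \<notin> P"
    using ideal_if_monomials[OF P.ideal_axioms, of x] x(2) by blast
  then obtain m where m: "m \<in> Poly_Mapping.keys x" "monomial m \<notin> P" by blast
  then have wm: "w m = 0" using G(2)[of m] x(1) by (auto simp: w_def)
  have "wmin w x = w m"
    by (rule wmin_eqI[OF m(1)]) (use wm x(1) w_nonneg in auto)
  then have wx: "wmin w x = 0" using wm by simp
  show "f \<in> ideal_power toric P r"
  proof (rule ideal_if_monomials[OF idealPr])
    fix m assume m: "m \<in> Poly_Mapping.keys f"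
    then have f0: "f \<noteq> 0" by auto
    have x0: "x \<noteq> 0" using x(2) P.zero_closed by auto
    have "x * f \<in> J (U * (r - 1) + 1)" using x(3) powJ by blast
    then have "int (U * (r - 1) + 1) \<le> wmin w (x * f)"
      unfolding J_def le_wmin_iff[OF laurent_mult_nonzero[OF x0 f0]] by blast
    also have "\<dots> = wmin w f" using w.wmin_mult[OF x0 f0] wx by simp
    also have "\<dots> \<le> w m" by (rule wmin_le[OF m])
    finally have wm: "int (U * (r - 1) + 1) \<le> w m" .
    have "m \<in> ?S" using m f by auto
    then obtain a :: "int ^ 'n \<Rightarrow> nat" where a: "m = (\<Sum>b\<in>B. int (a b) *s b)"
      using B(2) unfolding generates_semigroup_def by blast
    \<comment> \<open>Only summands whose monomial lies in \<open>P\<close> are counted; those on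
      the face contribute neither weight nor factors from \<open>P\<close>.\<close>
    define e where "e b = (if monomial b \<in> P then a b else 0)" for b
    have in_power: "monomial (\<Sum>b\<in>A. int (a b) *s b) \<in> ideal_power toric P (sum e A)"
      if "A \<subseteq> B" for A
      using finite_subset[OF that B(1)] that
    proof (induction A rule: finite_induct)
      case empty
      show ?case unfolding sum.empty D.ideal_power_0 by (simp add: dual_lattice_points_0)
    next
      case (insert b A)
      have "monomial (int (a b) *s b) \<in> ideal_power toric P (e b)"
      proof (cases "monomial b \<in> P")
        case True
        then show ?thesis using mulP by (simp add: e_def)
      next
        case False
        then have "e b = 0" by (simp add: e_def)
        then show ?thesis using mulS[OF BS, of b "a b"] insert.prems by (simp only: D.ideal_power_0) simp
      qed
      from D.ideal_power_mult[OF P.ideal_axioms this] insert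
      have "monomial (int (a b) *s b) \<otimes>\<^bsub>toric\<^esub> monomial (\<Sum>b\<in>A. int (a b) *s b) \<in> ideal_power toric P (e b + sum e A)"
        by blast
      then show ?case using insert.hyps by (simp add: monomial_add)
    qed
    have "w m = (\<Sum>b\<in>B. int (a b) * w b)"
      unfolding a w_def lattice_inner_sum_left by simp
    also have "\<dots> \<le> (\<Sum>b\<in>B. int (e b) * int d)"
    proof (rule sum_mono)
      fix b assume b: "b \<in> B"
      show "int (a b) * w b \<le> int (e b) * int d"
      proof (cases "monomial b \<in> P")
        case True
        have "w b \<le> int d" using w_le[OF BS[OF b]] d[OF b] by linarith
        then show ?thesis using True by (simp add: e_def mult_left_mono)
      next
        case False
        then have "w b = 0" using G(2)[OF BS[OF b]] by (simp add: w_def)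
        then show ?thesis by simp
      qed
    qed
    also have "\<dots> = int (sum e B * d)" by (simp add: sum_distrib_right)
    finally have "U * (r - 1) + 1 \<le> sum e B * d" using wm by linarith
    also have "\<dots> \<le> sum e B * U" using \<open>d \<le> U\<close> by simp
    finally have "U * (r - 1) + 1 \<le> sum e B * U" .
    \<comment> \<open>The 1 in the symbolic exponent makes the inequality strict, so that cancelling
      \<open>U\<close> leaves more than \<open>r - 1\<close> factors.\<close>
    then have "U * (r - 1) < U * sum e B" unfolding mult.commute[of "sum e B"] by linarith
    then have "r - 1 < sum e B" by simp
    then have "r \<le> sum e B" by linarith
    then show "monomial m \<in> ideal_power toric P r"
      using in_power[OF subset_refl] D.ideal_power_antimono[OF P.ideal_axioms] unfolding a by blast
  qed
qed

end

section \<open>Positivity of \<open>U\<close> and union of the two classes of primes\<close>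

theorem theorem1p2:
  fixes C :: "(real ^ 'n) set"
    and R :: "(int ^ 'n \<Rightarrow>\<^sub>0 'k::field) ring"
    and B :: "(int ^ 'n) set"
    and U :: nat
  assumes "rational_polyhedral_cone C"
    and "full_dimensional C"
    and "pointed C"
    and "R = toric_algebra C"
    and "finite (carrier (class_group R))"
    and "finite B"
    and "generates_semigroup B (dual_lattice_points C)"
    and "U = lcm (nat (Max ((\<lambda>w. lattice_inner w (generator_sum C)) ` B)))
                 (card (carrier (class_group R)))"
  shows "U > 0 \<and>
    (\<forall>r P. r > 0 \<longrightarrow> primeideal P R \<longrightarrow> monomial_ideal C P \<or> height R P = 1 \<longrightarrow>
       symbolic_power R P (U * (r - 1) + 1) \<subseteq> ideal_power R P r)"
proof -
  interpret rational_pointed_cone C by standard fact+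
  interpret krull_domain "toric :: (int ^ 'n \<Rightarrow>\<^sub>0 'k) ring" toric_valuations
    by (rule krull_domain_toric_algebra)
  define N where "N = card (carrier (class_group R))"
  define d where "d = nat (Max ((\<lambda>w. lattice_inner w (generator_sum C)) ` B))"
  have U: "U = lcm d N" using assms(8) by (simp add: d_def N_def)
  \<comment> \<open>Nonempty and finite together make the class number positive; \<open>card\<close>
    would be 0 for an infinite group.\<close>
  have "carrier (class_group R) \<noteq> {}"
    using group.is_monoid[OF group_free_Abelian_group] monoid.one_closed
    unfolding class_group_def carrier_FactGroup by blast
  then have N: "N > 0" using assms(5) by (simp add: N_def card_gt_0_iff)
  have le_d: "lattice_inner b (generator_sum C) \<le> int d" if "b \<in> B" for b
  proof -
    have "lattice_inner b (generator_sum C) \<le> Max ((\<lambda>w. lattice_inner w (generator_sum C)) ` B)"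
      using assms(6) that by (intro Max_ge) auto
    then show ?thesis by (simp add: d_def)
  qed
  \<comment> \<open>\<open>nat\<close> would turn a nonpositive maximum into 0. But a nonzero point
    of the dual cone is a combination of \<open>B\<close> and pairs positively with the generator
    sum, so some element of \<open>B\<close> does too; in particular \<open>B\<close> is not
    empty.\<close>
  have "d > 0"
  proof (rule ccontr)
    assume "\<not> d > 0"
    then have le0: "lattice_inner b (generator_sum C) \<le> 0" if "b \<in> B" for b using le_d[OF that] by simp
    obtain m where m: "m \<in> dual_lattice_points C" "m \<noteq> 0" using exists_nonzero_dual_lattice_point by blast
    then obtain a :: "int ^ 'n \<Rightarrow> nat" where a: "m = (\<Sum>b\<in>B. int (a b) *s b)"
      using assms(7) unfolding generates_semigroup_def by blast
    have "lattice_inner m (generator_sum C) = (\<Sum>b\<in>B. int (a b) * lattice_inner b (generator_sum C))"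
      unfolding a lattice_inner_sum_left by simp
    also have "\<dots> \<le> 0" using le0 by (intro sum_nonpos) (simp add: mult_nonneg_nonpos)
    finally show False using generator_sum_pos[OF m] by simp
  qed
  then have U0: "U > 0" using N by (simp add: U lcm_pos_nat)
  then have dU: "d \<le> U" by (intro dvd_imp_le) (simp_all add: U)
  have "symbolic_power R P (U * (r - 1) + 1) \<subseteq> ideal_power R P r"
    if "r > 0" "primeideal P R" "monomial_ideal C P \<or> height R P = 1" for r P
    using that(3)
  proof
    assume "monomial_ideal C P"
    then show ?thesis
      using that(1,2) monomial_prime_symbolic_power[OF _ _ assms(6,7) le_d dU] unfolding assms(4) by blast
  next
    assume "height R P = 1"
    then have "P \<in> height_one_primes toric" using that(2) by (simp add: height_one_primes_def assms(4))
    then show ?thesis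
      using symbolic_power_subset_ideal_power[OF _ _ _ U0 that(1)] N
      unfolding assms(4) U N_def by simp
  qed
  then show ?thesis using U0 by blast
qed

end
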